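(* Let $R$ be a noetherian ring, $I$ an ideal of $R$, and $f\in I^s\setminus I^{s+1}$. On the blowup $S_I$ of $I$ in $\operatorname{Spec} R$, the weak transform $(f)^\#$ is equal to the strict transform $(f)'$ if and only if the support of the exceptional divisor $\mathcal{E}_I$ does not contain any associated point of the scheme $(f)^\#$, i.e. $$\operatorname{Supp}(\mathcal{E}_I)\cap \operatorname{Ass}((f)^\#)=\emptyset .$$
   Context: $B(R)=R[It]=\bigoplus_{n\ge 0} I^nt^n$ (with $I^0=R$), graded by powers of $t$; $S_I=\operatorname{Proj} B(R)$, with blowup morphism $b_I:S_I\to\operatorname{Spec} R$. The exceptional divisor $\mathcal{E}_I=(b_I)^{-1}(V(I))$ is the closed subscheme of $S_I$ defined by the homogeneous ideal $I\cdot B(R)$. The weak transform $(f)^\#$ of $f\in I^s\setminus I^{s+1}$ is the closed subscheme of $S_I$ defined by the homogeneous ideal $ft^sB(R)$ (equivalently, if $h_0,\dots,h_r$ generate $I$, it is defined by $f/h_i^s$ in the chart $D_+(h_it)\cong\operatorname{Spec} R[I/h_i]$). The strict transform of a closed subscheme $Y\subset \operatorname{Spec} R$ is the scheme-theoretic closure in $S_I$ (smallest closed subscheme containing it) of $(b_I)^{-1}(Y\setminus V(I))$; $(f)'$ denotes the strict transform of $Y=\operatorname{Spec} R/(f)$. $\operatorname{Ass}((f)^\#)$ is the set of associated points of $\mathcal{O}_{(f)^\#}$, and $\operatorname{Supp}$ denotes the underlying set. *)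

theory Defs
  imports "HOL-Algebra.UnivPoly" "HOL-Algebra.Ideal_Product" "HOL-Algebra.Ring_Divisibility"
    "HOL-Analysis.Abstract_Topology"
begin

section \<open>Ringed spaces, stalks, closed subspaces\<close>

text \<open>
  A ringed space is given by a topological space and a sheaf of rings whose sections over \<open>U\<close> are
  functions on \<open>U\<close> (with values in stalks, say); restriction of sections is restriction of
  functions.  Spec and Proj below are built in this form.  Only the values of \<open>sec\<close> at
  open sets matter.
\<close>

record ('p, 'k) ringed_space =
  topo :: "'p topology"
  sec :: "'p set \<Rightarrow> ('p \<Rightarrow> 'k) ring"

definition germ :: "('p, 'k) ringed_space \<Rightarrow> 'p \<Rightarrow> 'p set \<Rightarrow> ('p \<Rightarrow> 'k) \<Rightarrow> ('p set \<times> ('p \<Rightarrow> 'k)) set" where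
  "germ X x U s = {(V, t). openin (topo X) V \<and> x \<in> V \<and> t \<in> carrier (sec X V) \<and>
     (\<exists>W. openin (topo X) W \<and> x \<in> W \<and> W \<subseteq> U \<inter> V \<and> restrict s W = restrict t W)}"

text \<open>In the ring operations, the union runs over all choices of representatives; all the classes
  united are equal.\<close>

definition stalk :: "('p, 'k) ringed_space \<Rightarrow> 'p \<Rightarrow> ('p set \<times> ('p \<Rightarrow> 'k)) set ring" where
  "stalk X x =
    \<lparr>carrier = {germ X x U s | U s. openin (topo X) U \<and> x \<in> U \<and> s \<in> carrier (sec X U)},
     monoid.mult = (\<lambda>a b. \<Union>(U, s)\<in>a. \<Union>(V, t)\<in>b.
       germ X x (U \<inter> V) (restrict s (U \<inter> V) \<otimes>\<^bsub>sec X (U \<inter> V)\<^esub> restrict t (U \<inter> V))),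
     one = germ X x (topspace (topo X)) \<one>\<^bsub>sec X (topspace (topo X))\<^esub>,
     zero = germ X x (topspace (topo X)) \<zero>\<^bsub>sec X (topspace (topo X))\<^esub>,
     add = (\<lambda>a b. \<Union>(U, s)\<in>a. \<Union>(V, t)\<in>b.
       germ X x (U \<inter> V) (restrict s (U \<inter> V) \<oplus>\<^bsub>sec X (U \<inter> V)\<^esub> restrict t (U \<inter> V)))\<rparr>"

text \<open>Sheaves of ideals.  The value at sets that are not open is fixed, so that equality of ideal
  sheaves is equality of functions.\<close>

definition ideal_sheaf :: "('p, 'k) ringed_space \<Rightarrow> ('p set \<Rightarrow> ('p \<Rightarrow> 'k) set) \<Rightarrow> bool" where
  "ideal_sheaf X J \<longleftrightarrow>
     (\<forall>U. openin (topo X) U \<longrightarrow> ideal (J U) (sec X U)) \<and>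
     (\<forall>U V s. openin (topo X) U \<and> openin (topo X) V \<and> V \<subseteq> U \<and> s \<in> J U \<longrightarrow> restrict s V \<in> J V) \<and>
     (\<forall>U s. openin (topo X) U \<and> s \<in> carrier (sec X U) \<and>
        (\<forall>x\<in>U. \<exists>W. openin (topo X) W \<and> x \<in> W \<and> W \<subseteq> U \<and> restrict s W \<in> J W) \<longrightarrow> s \<in> J U) \<and>
     (\<forall>U. \<not> openin (topo X) U \<longrightarrow> J U = {})"

text \<open>The ideal sheaf generated by a set \<open>G\<close> of pairs \<open>(V, g)\<close>, \<open>g\<close> a section over the open set \<open>V\<close>.\<close>

definition gen_ideal_sheaf ::
  "('p, 'k) ringed_space \<Rightarrow> ('p set \<times> ('p \<Rightarrow> 'k)) set \<Rightarrow> 'p set \<Rightarrow> ('p \<Rightarrow> 'k) set" where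
  "gen_ideal_sheaf X G U =
    (if openin (topo X) U
     then {s \<in> carrier (sec X U). \<forall>x\<in>U. \<exists>W. openin (topo X) W \<and> x \<in> W \<and> W \<subseteq> U \<and>
             restrict s W \<in> Idl\<^bsub>sec X W\<^esub> {restrict g W | V g. (V, g) \<in> G \<and> W \<subseteq> V}}
     else {})"

text \<open>
  A closed subspace is given by an ideal sheaf that is locally generated by sections.  This is
  the notion used for arbitrary locally ringed spaces (Stacks Project, Tags 01HJ, 01HN); on a scheme
  these ideal sheaves are the quasi-coherent ones, and closed subspaces are closed subschemes.
  A closed subspace is contained in another one iff the reverse inclusion of ideal sheaves holds.
\<close>

definition closed_subscheme :: "('p, 'k) ringed_space \<Rightarrow> ('p set \<Rightarrow> ('p \<Rightarrow> 'k) set) \<Rightarrow> bool" where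
  "closed_subscheme X J \<longleftrightarrow> ideal_sheaf X J \<and>
     (\<forall>x\<in>topspace (topo X). \<exists>U. openin (topo X) U \<and> x \<in> U \<and>
        (\<forall>V. openin (topo X) V \<and> V \<subseteq> U \<longrightarrow> J V = gen_ideal_sheaf X {(U, g) | g. g \<in> J U} V))"

definition stalk_ideal ::
  "('p, 'k) ringed_space \<Rightarrow> ('p set \<Rightarrow> ('p \<Rightarrow> 'k) set) \<Rightarrow> 'p \<Rightarrow> ('p set \<times> ('p \<Rightarrow> 'k)) set set" where
  "stalk_ideal X J x = {germ X x U s | U s. openin (topo X) U \<and> x \<in> U \<and> s \<in> J U}"

definition subscheme_supp :: "('p, 'k) ringed_space \<Rightarrow> ('p set \<Rightarrow> ('p \<Rightarrow> 'k) set) \<Rightarrow> 'p set" where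
  "subscheme_supp X J = {x \<in> topspace (topo X). stalk_ideal X J x \<noteq> carrier (stalk X x)}"

definition assoc_primes :: "('a, 'm) ring_scheme \<Rightarrow> ('a, 'b, 'n) module_scheme \<Rightarrow> 'a set set" where
  "assoc_primes A M =
    {P. primeideal P A \<and> (\<exists>m\<in>carrier M. P = {a \<in> carrier A. a \<odot>\<^bsub>M\<^esub> m = \<zero>\<^bsub>M\<^esub>})}"

definition quot_module :: "('a, 'm) ring_scheme \<Rightarrow> 'a set \<Rightarrow> ('a, 'a set) module" where
  "quot_module A J =
    ring.extend (A Quot J) (module.fields (\<lambda>a z. (J +>\<^bsub>A\<^esub> a) \<otimes>\<^bsub>A Quot J\<^esub> z))"

text \<open>
  Associated points of the structure sheaf of the closed subscheme \<open>Z\<close> with ideal sheaf \<open>J\<close>: those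
  \<open>x\<close> for which the maximal ideal of the local ring of \<open>X\<close> at \<open>x\<close> (its set of nonunits) is
  associated to the stalk of \<open>\<O>\<^sub>Z\<close>, which is the stalk of \<open>\<O>\<^sub>X\<close> modulo that of \<open>J\<close>.
\<close>

definition assoc_points :: "('p, 'k) ringed_space \<Rightarrow> ('p set \<Rightarrow> ('p \<Rightarrow> 'k) set) \<Rightarrow> 'p set" where
  "assoc_points X J = {x \<in> topspace (topo X).
     carrier (stalk X x) - Units (stalk X x)
       \<in> assoc_primes (stalk X x) (quot_module (stalk X x) (stalk_ideal X J x))}"

text \<open>
  Let \<open>L\<close> be an ideal sheaf and \<open>W\<close> an open set; they determine the locally closed subscheme
  of \<open>X\<close> that is closed in \<open>W\<close> with ideal sheaf \<open>L|W\<close>.  It is contained in a closed subscheme \<open>K\<close> iff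
  \<open>K|W \<subseteq> L|W\<close>; its scheme-theoretic closure is the smallest such \<open>K\<close>.
\<close>

definition contains_locally_closed ::
  "('p, 'k) ringed_space \<Rightarrow> ('p set \<Rightarrow> ('p \<Rightarrow> 'k) set) \<Rightarrow> 'p set \<Rightarrow> ('p set \<Rightarrow> ('p \<Rightarrow> 'k) set) \<Rightarrow> bool" where
  "contains_locally_closed X K W L \<longleftrightarrow> (\<forall>V. openin (topo X) V \<and> V \<subseteq> W \<longrightarrow> K V \<subseteq> L V)"

definition scheme_closure ::
  "('p, 'k) ringed_space \<Rightarrow> 'p set \<Rightarrow> ('p set \<Rightarrow> ('p \<Rightarrow> 'k) set) \<Rightarrow> 'p set \<Rightarrow> ('p \<Rightarrow> 'k) set" where
  "scheme_closure X W L = (THE K. closed_subscheme X K \<and> contains_locally_closed X K W L \<and>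
     (\<forall>K'. closed_subscheme X K' \<and> contains_locally_closed X K' W L \<longrightarrow> (\<forall>V. K' V \<subseteq> K V)))"

text \<open>A morphism from \<open>X\<close> to \<open>Y\<close>: \<open>pull V\<close> maps sections over \<open>V\<close> to sections over
  the inverse image of \<open>V\<close>.\<close>

record ('p, 'k, 'q, 'l) ringed_map =
  pt :: "'p \<Rightarrow> 'q"
  pull :: "'q set \<Rightarrow> ('q \<Rightarrow> 'l) \<Rightarrow> ('p \<Rightarrow> 'k)"

definition preimage :: "('p, 'k) ringed_space \<Rightarrow> ('p, 'k, 'q, 'l) ringed_map \<Rightarrow> 'q set \<Rightarrow> 'p set" where
  "preimage X \<phi> V = {x \<in> topspace (topo X). pt \<phi> x \<in> V}"

text \<open>The scheme-theoretic inverse image of the closed subscheme with ideal sheaf \<open>J\<close>: its ideal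
  sheaf is generated by the pulled back sections of \<open>J\<close>.\<close>

definition inverse_image_subscheme ::
  "('p, 'k) ringed_space \<Rightarrow> ('p, 'k, 'q, 'l) ringed_map \<Rightarrow> ('q, 'l) ringed_space
    \<Rightarrow> ('q set \<Rightarrow> ('q \<Rightarrow> 'l) set) \<Rightarrow> 'p set \<Rightarrow> ('p \<Rightarrow> 'k) set" where
  "inverse_image_subscheme X \<phi> Y J =
    gen_ideal_sheaf X {(preimage X \<phi> V, pull \<phi> V t) | V t. openin (topo Y) V \<and> t \<in> J V}"


section \<open>Localization\<close>

text \<open>The fraction \<open>a/b\<close> in the localization of \<open>A\<close> at the multiplicative set \<open>S\<close>, as the class of
  all pairs equivalent to \<open>(a, b)\<close>.\<close>

definition fract_cls :: "('a, 'm) ring_scheme \<Rightarrow> 'a set \<Rightarrow> 'a \<Rightarrow> 'a \<Rightarrow> ('a \<times> 'a) set" where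
  "fract_cls A S a b = {(c, d). c \<in> carrier A \<and> d \<in> S \<and>
     (\<exists>u\<in>S. u \<otimes>\<^bsub>A\<^esub> (a \<otimes>\<^bsub>A\<^esub> d \<ominus>\<^bsub>A\<^esub> c \<otimes>\<^bsub>A\<^esub> b) = \<zero>\<^bsub>A\<^esub>)}"

definition localization :: "('a, 'm) ring_scheme \<Rightarrow> 'a set \<Rightarrow> ('a \<times> 'a) set ring" where
  "localization A S =
    \<lparr>carrier = {fract_cls A S a b | a b. a \<in> carrier A \<and> b \<in> S},
     monoid.mult = (\<lambda>x y. \<Union>(a, b)\<in>x. \<Union>(c, d)\<in>y. fract_cls A S (a \<otimes>\<^bsub>A\<^esub> c) (b \<otimes>\<^bsub>A\<^esub> d)),
     one = fract_cls A S \<one>\<^bsub>A\<^esub> \<one>\<^bsub>A\<^esub>,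
     zero = fract_cls A S \<zero>\<^bsub>A\<^esub> \<one>\<^bsub>A\<^esub>,
     add = (\<lambda>x y. \<Union>(a, b)\<in>x. \<Union>(c, d)\<in>y.
        fract_cls A S (a \<otimes>\<^bsub>A\<^esub> d \<oplus>\<^bsub>A\<^esub> c \<otimes>\<^bsub>A\<^esub> b) (b \<otimes>\<^bsub>A\<^esub> d))\<rparr>"


section \<open>Spec and Proj\<close>

text \<open>
  The structure sheaves of Spec and Proj follow Hartshorne, II.2: a section over \<open>V\<close> assigns to each
  prime \<open>p\<close> in \<open>V\<close> a fraction in the localization at \<open>S p\<close>, and is locally given by one fraction
  \<open>a/b\<close> with \<open>(a, b)\<close> in the set \<open>D\<close> of admissible pairs.  For Proj, \<open>D\<close> consists of the pairs of
  homogeneous elements of equal degree, so the values lie in the degree zero part of the localization.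
\<close>

definition local_fract ::
  "('a, 'm) ring_scheme \<Rightarrow> 'a set topology \<Rightarrow> ('a set \<Rightarrow> 'a set) \<Rightarrow> ('a \<times> 'a) set
    \<Rightarrow> 'a set set \<Rightarrow> ('a set \<Rightarrow> ('a \<times> 'a) set) \<Rightarrow> bool" where
  "local_fract A T S D V s \<longleftrightarrow> (\<forall>p\<in>V. \<exists>W. openin T W \<and> p \<in> W \<and> W \<subseteq> V \<and>
     (\<exists>(a, b)\<in>D. \<forall>q\<in>W. b \<in> S q \<and> s q = fract_cls A (S q) a b))"

definition fract_space ::
  "('a, 'm) ring_scheme \<Rightarrow> 'a set topology \<Rightarrow> ('a set \<Rightarrow> 'a set) \<Rightarrow> ('a \<times> 'a) set
    \<Rightarrow> ('a set, ('a \<times> 'a) set) ringed_space" where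
  "fract_space A T S D =
    \<lparr>topo = T,
     sec = (\<lambda>V.
       \<lparr>carrier = {s \<in> (\<Pi>\<^sub>E p\<in>V. carrier (localization A (S p))). local_fract A T S D V s},
        monoid.mult = (\<lambda>s t. \<lambda>p\<in>V. s p \<otimes>\<^bsub>localization A (S p)\<^esub> t p),
        one = (\<lambda>p\<in>V. \<one>\<^bsub>localization A (S p)\<^esub>),
        zero = (\<lambda>p\<in>V. \<zero>\<^bsub>localization A (S p)\<^esub>),
        add = (\<lambda>s t. \<lambda>p\<in>V. s p \<oplus>\<^bsub>localization A (S p)\<^esub> t p)\<rparr>)\<rparr>"

text \<open>The ideal sheaf associated to an ideal \<open>H\<close>: sections that are locally fractions with numerator
  in \<open>H\<close>.\<close>

definition fract_ideal_sheaf ::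
  "('a, 'm) ring_scheme \<Rightarrow> 'a set topology \<Rightarrow> ('a set \<Rightarrow> 'a set) \<Rightarrow> ('a \<times> 'a) set
    \<Rightarrow> 'a set \<Rightarrow> 'a set set \<Rightarrow> ('a set \<Rightarrow> ('a \<times> 'a) set) set" where
  "fract_ideal_sheaf A T S D H V =
    (if openin T V
     then {s \<in> carrier (sec (fract_space A T S D) V). local_fract A T S {(a, b) \<in> D. a \<in> H} V s}
     else {})"


subsection \<open>The spectrum of a ring\<close>

definition zariski_spec :: "('a, 'm) ring_scheme \<Rightarrow> 'a set topology" where
  "zariski_spec A = topology (\<lambda>U. \<exists>E\<subseteq>carrier A. U = {P. primeideal P A \<and> \<not> E \<subseteq> P})"

definition Spec :: "('a, 'm) ring_scheme \<Rightarrow> ('a set, ('a \<times> 'a) set) ringed_space" where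
  "Spec A = fract_space A (zariski_spec A) (\<lambda>P. carrier A - P) (carrier A \<times> carrier A)"

definition Spec_subscheme ::
  "('a, 'm) ring_scheme \<Rightarrow> 'a set \<Rightarrow> 'a set set \<Rightarrow> ('a set \<Rightarrow> ('a \<times> 'a) set) set" where
  "Spec_subscheme A H =
    fract_ideal_sheaf A (zariski_spec A) (\<lambda>P. carrier A - P) (carrier A \<times> carrier A) H"


subsection \<open>Proj of a graded ring\<close>

text \<open>A graded ring is given by a ring \<open>B\<close> and its homogeneous components \<open>G n\<close>.\<close>

definition homog :: "(nat \<Rightarrow> 'b set) \<Rightarrow> 'b set" where
  "homog G = (\<Union>n. G n)"

definition homogeneous_ideal :: "('b, 'm) ring_scheme \<Rightarrow> (nat \<Rightarrow> 'b set) \<Rightarrow> 'b set \<Rightarrow> bool" where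
  "homogeneous_ideal B G H \<longleftrightarrow> ideal H B \<and> H = Idl\<^bsub>B\<^esub> (H \<inter> homog G)"

definition proj_points :: "('b, 'm) ring_scheme \<Rightarrow> (nat \<Rightarrow> 'b set) \<Rightarrow> 'b set set" where
  "proj_points B G =
    {P. primeideal P B \<and> homogeneous_ideal B G P \<and> \<not> (\<Union>n\<in>{0<..}. G n) \<subseteq> P}"

definition zariski_proj :: "('b, 'm) ring_scheme \<Rightarrow> (nat \<Rightarrow> 'b set) \<Rightarrow> 'b set topology" where
  "zariski_proj B G = topology (\<lambda>U. \<exists>E\<subseteq>homog G. U = {P \<in> proj_points B G. \<not> E \<subseteq> P})"

definition same_degree_pairs :: "(nat \<Rightarrow> 'b set) \<Rightarrow> ('b \<times> 'b) set" where
  "same_degree_pairs G = (\<Union>n. G n \<times> G n)"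

definition Proj ::
  "('b, 'm) ring_scheme \<Rightarrow> (nat \<Rightarrow> 'b set) \<Rightarrow> ('b set, ('b \<times> 'b) set) ringed_space" where
  "Proj B G = fract_space B (zariski_proj B G) (\<lambda>P. homog G - P) (same_degree_pairs G)"

text \<open>The closed subscheme of Proj defined by a homogeneous ideal \<open>H\<close>.\<close>

definition Proj_subscheme ::
  "('b, 'm) ring_scheme \<Rightarrow> (nat \<Rightarrow> 'b set) \<Rightarrow> 'b set \<Rightarrow> 'b set set \<Rightarrow> ('b set \<Rightarrow> ('b \<times> 'b) set) set" where
  "Proj_subscheme B G H =
    fract_ideal_sheaf B (zariski_proj B G) (\<lambda>P. homog G - P) (same_degree_pairs G) H"


section \<open>Blowups\<close>

abbreviation ideal_power :: "('a, 'm) ring_scheme \<Rightarrow> 'a set \<Rightarrow> nat \<Rightarrow> 'a set" where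
  "ideal_power R I n \<equiv> I [^]\<^bsub>ideals_set R\<^esub> n"

definition rees :: "('a, 'm) ring_scheme \<Rightarrow> 'a set \<Rightarrow> ('a, nat \<Rightarrow> 'a) up_ring" where
  "rees R I =
    (UP R)\<lparr>carrier := {p \<in> carrier (UP R). \<forall>n. coeff (UP R) p n \<in> ideal_power R I n}\<rparr>"

definition rees_grading :: "('a, 'm) ring_scheme \<Rightarrow> 'a set \<Rightarrow> nat \<Rightarrow> (nat \<Rightarrow> 'a) set" where
  "rees_grading R I n = {monom (UP R) a n | a. a \<in> ideal_power R I n}"

definition blowup ::
  "('a, 'm) ring_scheme \<Rightarrow> 'a set \<Rightarrow> ((nat \<Rightarrow> 'a) set, ((nat \<Rightarrow> 'a) \<times> (nat \<Rightarrow> 'a)) set) ringed_space" where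
  "blowup R I = Proj (rees R I) (rees_grading R I)"

text \<open>The blowup morphism sends a prime \<open>q\<close> of the Rees algebra to \<open>q \<inter> R\<close>, and on sections it is
  induced by the maps of localizations \<open>a/b \<mapsto> (a t\<^sup>0)/(b t\<^sup>0)\<close>.\<close>

definition blowup_map :: "('a, 'm) ring_scheme \<Rightarrow> 'a set \<Rightarrow>
    ((nat \<Rightarrow> 'a) set, ((nat \<Rightarrow> 'a) \<times> (nat \<Rightarrow> 'a)) set, 'a set, ('a \<times> 'a) set) ringed_map" where
  "blowup_map R I =
    (let contr = (\<lambda>Q. {a \<in> carrier R. monom (UP R) a 0 \<in> Q})
     in \<lparr>pt = contr,
         pull = (\<lambda>V s. \<lambda>Q\<in>{Q \<in> topspace (topo (blowup R I)). contr Q \<in> V}.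
           \<Union>(a, b)\<in>s (contr Q).
             fract_cls (rees R I) (homog (rees_grading R I) - Q) (monom (UP R) a 0) (monom (UP R) b 0))\<rparr>)"

definition exceptional_divisor :: "('a, 'm) ring_scheme \<Rightarrow> 'a set
    \<Rightarrow> (nat \<Rightarrow> 'a) set set \<Rightarrow> ((nat \<Rightarrow> 'a) set \<Rightarrow> ((nat \<Rightarrow> 'a) \<times> (nat \<Rightarrow> 'a)) set) set" where
  "exceptional_divisor R I = Proj_subscheme (rees R I) (rees_grading R I)
     (Idl\<^bsub>rees R I\<^esub> {monom (UP R) a 0 | a. a \<in> I})"

definition weak_transform :: "('a, 'm) ring_scheme \<Rightarrow> 'a set \<Rightarrow> 'a \<Rightarrow> nat
    \<Rightarrow> (nat \<Rightarrow> 'a) set set \<Rightarrow> ((nat \<Rightarrow> 'a) set \<Rightarrow> ((nat \<Rightarrow> 'a) \<times> (nat \<Rightarrow> 'a)) set) set" where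
  "weak_transform R I f s = Proj_subscheme (rees R I) (rees_grading R I)
     (PIdl\<^bsub>rees R I\<^esub> (monom (UP R) f s))"

text \<open>The strict transform of a closed subscheme \<open>Y\<close> of Spec \<open>R\<close>, given by its ideal sheaf.\<close>

definition strict_transform ::
  "('a, 'm) ring_scheme \<Rightarrow> 'a set \<Rightarrow> ('a set set \<Rightarrow> ('a set \<Rightarrow> ('a \<times> 'a) set) set)
    \<Rightarrow> (nat \<Rightarrow> 'a) set set \<Rightarrow> ((nat \<Rightarrow> 'a) set \<Rightarrow> ((nat \<Rightarrow> 'a) \<times> (nat \<Rightarrow> 'a)) set) set" where
  "strict_transform R I Y =
    scheme_closure (blowup R I)
      (preimage (blowup R I) (blowup_map R I) {P. primeideal P R \<and> \<not> I \<subseteq> P})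
      (inverse_image_subscheme (blowup R I) (blowup_map R I) (Spec R) Y)"

end

theory Submission
  imports Defs "HOL-Algebra.Subrings"
begin

text \<open>
  Let \<open>B\<close> be the Rees algebra, \<open>H = f t\<^sup>s B\<close>, and \<open>W\<close>
  the complement of the exceptional divisor in \<open>Proj B\<close>. For \<open>h \<in> I\<close>
  the identity \<open>(h t)\<^sup>s f = h\<^sup>s (f t\<^sup>s)\<close> shows that the inverse
  image of \<open>Spec R/(f)\<close> contains the weak transform everywhere, and that the two
  agree on \<open>W\<close>, where some \<open>h\<close> is a unit
  (\<open>pull_in_weak_transform\<close>, \<open>inverse_image_eq_weak_transform\<close>). Hence
  the strict transform is the closure of the restriction of the weak transform to
  \<open>W\<close>.

  The ideal sheaf of that closure consists of the sections that lie in the ideal sheaf of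
  \<open>H\<close> on \<open>W\<close>. It comes from an ideal of \<open>B\<close>, namely the
  saturation, the set of all \<open>x\<close> such that each generator \<open>h\<close> of
  \<open>I\<close> has a power with \<open>h\<^sup>n x \<in> H\<close>
  (\<open>section_in_saturation\<close>, \<open>scheme_closure_eq\<close>): if \<open>a/b\<close>
  lies in the sheaf of \<open>H\<close> on \<open>D\<^sub>+(g) \<inter> D\<^sub>+(h)\<close>, then
  \<open>(g h)\<^sup>k a \<in> H\<close> for some \<open>k\<close>, and there are only finitely
  many generators.

  So the question is when \<open>H\<close> and its saturation agree locally
  (\<open>saturated_iff_no_associated_point\<close>). At an associated point on the exceptional
  divisor there is an element outside \<open>H\<close> killed modulo \<open>H\<close> by the
  maximal ideal, in particular by \<open>I\<close>, so it lies in the saturation. Conversely, if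
  \<open>a\<close> is in the saturation but not in \<open>H\<close> near some point, then a
  maximal one among the annihilators modulo \<open>H\<close> of the multiples of \<open>a\<close>
  that are nonzero near that point is a homogeneous prime, hence an associated point, and it
  contains \<open>I\<close> (\<open>exists_annihilator_prime\<close>). The maximal annihilator
  exists because \<open>B\<close> is noetherian, by Hilbert's basis theorem
  (\<open>noetherian_adjoin\<close>, \<open>rees_noetherian\<close>).

  What makes the sheaves tractable is that sections of a structure sheaf are functions into
  localizations and that an equation between fractions at a point persists on a neighbourhood.
  Germs are thus the values at the point (\<open>germ_eq\<close>), and membership in the ideal
  sheaf of \<open>H\<close> is a condition on values (\<open>J_iff\<close>), which turns
  associated points and supports into statements about numerators and denominators
  (\<open>assoc_points_iff\<close>, \<open>subscheme_supp_iff\<close>).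
\<close>

section \<open>Localization at a multiplicative set\<close>

locale mult_set = cring A for A (structure) +
  fixes S
  assumes S_carrier: "S \<subseteq> carrier A"
    and S_one: "\<one> \<in> S"
    and S_mult: "\<lbrakk>u \<in> S; v \<in> S\<rbrakk> \<Longrightarrow> u \<otimes> v \<in> S"
begin

abbreviation fr where "fr \<equiv> fract_cls A S"

lemma S_closed [simp, intro]: "u \<in> S \<Longrightarrow> u \<in> carrier A"
  using S_carrier by blast

lemma frac_rel_sym:
  assumes "a \<in> carrier A" "b \<in> S" "c \<in> carrier A" "d \<in> S"
    and "u \<in> S" "u \<otimes> (a \<otimes> d \<ominus> c \<otimes> b) = \<zero>"
  shows "u \<otimes> (c \<otimes> b \<ominus> a \<otimes> d) = \<zero>"
proof -
  have [simp]: "b \<in> carrier A" "d \<in> carrier A" "u \<in> carrier A" using assms by auto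
  have "u \<otimes> (c \<otimes> b \<ominus> a \<otimes> d) = \<ominus> (u \<otimes> (a \<otimes> d \<ominus> c \<otimes> b))"
    using assms(1,3) \<open>b \<in> carrier A\<close> \<open>d \<in> carrier A\<close> \<open>u \<in> carrier A\<close> by algebra
  then show ?thesis using assms by simp
qed

lemma frac_rel_trans:
  assumes "a \<in> carrier A" "b \<in> S" "c \<in> carrier A" "d \<in> S" "e \<in> carrier A" "k \<in> S"
    and "u \<in> S" "u \<otimes> (a \<otimes> d \<ominus> c \<otimes> b) = \<zero>"
    and "v \<in> S" "v \<otimes> (c \<otimes> k \<ominus> e \<otimes> d) = \<zero>"
  shows "(u \<otimes> v \<otimes> d) \<otimes> (a \<otimes> k \<ominus> e \<otimes> b) = \<zero>"
proof -
  have cl: "b \<in> carrier A" "d \<in> carrier A" "k \<in> carrier A" "u \<in> carrier A" "v \<in> carrier A"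
    using assms by auto
  have "(u \<otimes> v \<otimes> d) \<otimes> (a \<otimes> k \<ominus> e \<otimes> b)
      = v \<otimes> k \<otimes> (u \<otimes> (a \<otimes> d \<ominus> c \<otimes> b)) \<oplus> u \<otimes> b \<otimes> (v \<otimes> (c \<otimes> k \<ominus> e \<otimes> d))"
    using assms(1,3,5) cl by algebra
  then show ?thesis using assms cl by simp
qed

lemma frac_eq_iff:
  assumes "a \<in> carrier A" "b \<in> S" "c \<in> carrier A" "d \<in> S"
  shows "fr a b = fr c d \<longleftrightarrow> (\<exists>u\<in>S. u \<otimes> (a \<otimes> d \<ominus> c \<otimes> b) = \<zero>)"
proof
  assume eq: "fr a b = fr c d"
  have "(c, d) \<in> fr c d"
    using assms S_one by (auto simp: fract_cls_def intro!: bexI[of _ \<one>])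
  with eq have "(c, d) \<in> fr a b" by simp
  then show "\<exists>u\<in>S. u \<otimes> (a \<otimes> d \<ominus> c \<otimes> b) = \<zero>" by (auto simp: fract_cls_def)
next
  assume "\<exists>u\<in>S. u \<otimes> (a \<otimes> d \<ominus> c \<otimes> b) = \<zero>"
  then obtain u where u: "u \<in> S" "u \<otimes> (a \<otimes> d \<ominus> c \<otimes> b) = \<zero>" by blast
  then have u': "u \<otimes> (c \<otimes> b \<ominus> a \<otimes> d) = \<zero>" using frac_rel_sym assms by blast
  show "fr a b = fr c d"
  proof (intro equalityI subsetI)
    fix x assume "x \<in> fr a b"
    then obtain e k v where x: "x = (e, k)" "e \<in> carrier A" "k \<in> S" "v \<in> S" "v \<otimes> (a \<otimes> k \<ominus> e \<otimes> b) = \<zero>"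
      by (auto simp: fract_cls_def)
    have "(u \<otimes> v \<otimes> b) \<otimes> (c \<otimes> k \<ominus> e \<otimes> d) = \<zero>"
      by (rule frac_rel_trans[OF _ _ _ _ _ _ u(1) u']) (use assms x in auto)
    moreover have "u \<otimes> v \<otimes> b \<in> S" using S_mult u x assms by blast
    ultimately show "x \<in> fr c d" using x by (auto simp: fract_cls_def)
  next
    fix x assume "x \<in> fr c d"
    then obtain e k v where x: "x = (e, k)" "e \<in> carrier A" "k \<in> S" "v \<in> S" "v \<otimes> (c \<otimes> k \<ominus> e \<otimes> d) = \<zero>"
      by (auto simp: fract_cls_def)
    have "(u \<otimes> v \<otimes> d) \<otimes> (a \<otimes> k \<ominus> e \<otimes> b) = \<zero>"
      by (rule frac_rel_trans[OF _ _ _ _ _ _ u]) (use assms x in auto)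
    moreover have "u \<otimes> v \<otimes> d \<in> S" using S_mult u x assms by blast
    ultimately show "x \<in> fr a b" using x by (auto simp: fract_cls_def)
  qed
qed

lemma frac_self: "\<lbrakk>a \<in> carrier A; b \<in> S\<rbrakk> \<Longrightarrow> (a, b) \<in> fr a b"
  using S_one by (auto simp: fract_cls_def intro!: bexI[of _ \<one>])

lemma frac_memD:
  assumes "a \<in> carrier A" "b \<in> S" "(c, d) \<in> fr a b"
  shows "c \<in> carrier A" "d \<in> S" "fr c d = fr a b"
  using assms frac_eq_iff[of a b c d] by (auto simp: fract_cls_def)

text \<open>The operations of the localization are unions over all representatives; this computes such a
  union from one representative once its members are known to agree.\<close>

lemma frac_UN_eq:
  assumes "a \<in> carrier A" "b \<in> S" "c \<in> carrier A" "d \<in> S"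
    and "\<And>a' b' c' d'. \<lbrakk>a' \<in> carrier A; b' \<in> S; c' \<in> carrier A; d' \<in> S;
        fr a' b' = fr a b; fr c' d' = fr c d\<rbrakk>
      \<Longrightarrow> F a' b' c' d' = X"
  shows "(\<Union>(a', b')\<in>fr a b. \<Union>(c', d')\<in>fr c d. F a' b' c' d') = X"
proof -
  have "F a' b' c' d' = X" if "(a', b') \<in> fr a b" "(c', d') \<in> fr c d"
    for a' b' c' d'
    using assms(5) frac_memD[OF assms(1,2) that(1)] frac_memD[OF assms(3,4) that(2)] by blast
  moreover have "(a, b) \<in> fr a b" "(c, d) \<in> fr c d"
    using frac_self assms by auto
  ultimately show ?thesis by fast
qed

lemma frac_mult:
  assumes "a \<in> carrier A" "b \<in> S" "c \<in> carrier A" "d \<in> S"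
  shows "fr a b \<otimes>\<^bsub>localization A S\<^esub> fr c d = fr (a \<otimes> c) (b \<otimes> d)"
proof -
  have "(\<Union>(a', b')\<in>fr a b. \<Union>(c', d')\<in>fr c d. fr (a' \<otimes> c') (b' \<otimes> d'))
      = fr (a \<otimes> c) (b \<otimes> d)"
  proof (rule frac_UN_eq[OF assms])
    fix a' b' c' d'
    assume m: "a' \<in> carrier A" "b' \<in> S" "c' \<in> carrier A" "d' \<in> S"
      and eq: "fr a' b' = fr a b" "fr c' d' = fr c d"
    obtain u where u: "u \<in> S" "u \<otimes> (a' \<otimes> b \<ominus> a \<otimes> b') = \<zero>"
      using eq(1) frac_eq_iff[OF m(1,2) assms(1,2)] by blast
    obtain v where v: "v \<in> S" "v \<otimes> (c' \<otimes> d \<ominus> c \<otimes> d') = \<zero>"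
      using eq(2) frac_eq_iff[OF m(3,4) assms(3,4)] by blast
    have cl: "b \<in> carrier A" "d \<in> carrier A" "b' \<in> carrier A" "d' \<in> carrier A" "u \<in> carrier A" "v \<in> carrier A"
      using assms m u v by auto
    have "(u \<otimes> v) \<otimes> ((a' \<otimes> c') \<otimes> (b \<otimes> d) \<ominus> (a \<otimes> c) \<otimes> (b' \<otimes> d'))
        = v \<otimes> c' \<otimes> d \<otimes> (u \<otimes> (a' \<otimes> b \<ominus> a \<otimes> b')) \<oplus> u \<otimes> a \<otimes> b' \<otimes> (v \<otimes> (c' \<otimes> d \<ominus> c \<otimes> d'))"
      using assms(1,3) m(1,3) cl by algebra
    also have "\<dots> = \<zero>" using u v assms m cl by simp
    finally show "fr (a' \<otimes> c') (b' \<otimes> d') = fr (a \<otimes> c) (b \<otimes> d)"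
      using assms m u v S_mult by (subst frac_eq_iff) blast+
  qed
  then show ?thesis by (simp add: localization_def)
qed

lemma frac_add:
  assumes "a \<in> carrier A" "b \<in> S" "c \<in> carrier A" "d \<in> S"
  shows "fr a b \<oplus>\<^bsub>localization A S\<^esub> fr c d
    = fr (a \<otimes> d \<oplus> c \<otimes> b) (b \<otimes> d)"
proof -
  have "(\<Union>(a', b')\<in>fr a b. \<Union>(c', d')\<in>fr c d.
        fr (a' \<otimes> d' \<oplus> c' \<otimes> b') (b' \<otimes> d'))
      = fr (a \<otimes> d \<oplus> c \<otimes> b) (b \<otimes> d)"
  proof (rule frac_UN_eq[OF assms])
    fix a' b' c' d'
    assume m: "a' \<in> carrier A" "b' \<in> S" "c' \<in> carrier A" "d' \<in> S"
      and eq: "fr a' b' = fr a b" "fr c' d' = fr c d"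
    obtain u where u: "u \<in> S" "u \<otimes> (a' \<otimes> b \<ominus> a \<otimes> b') = \<zero>"
      using eq(1) frac_eq_iff[OF m(1,2) assms(1,2)] by blast
    obtain v where v: "v \<in> S" "v \<otimes> (c' \<otimes> d \<ominus> c \<otimes> d') = \<zero>"
      using eq(2) frac_eq_iff[OF m(3,4) assms(3,4)] by blast
    have cl: "b \<in> carrier A" "d \<in> carrier A" "b' \<in> carrier A" "d' \<in> carrier A" "u \<in> carrier A" "v \<in> carrier A"
      using assms m u v by auto
    have "(u \<otimes> v) \<otimes> ((a' \<otimes> d' \<oplus> c' \<otimes> b') \<otimes> (b \<otimes> d) \<ominus> (a \<otimes> d \<oplus> c \<otimes> b) \<otimes> (b' \<otimes> d'))
        = v \<otimes> d \<otimes> d' \<otimes> (u \<otimes> (a' \<otimes> b \<ominus> a \<otimes> b')) \<oplus> u \<otimes> b \<otimes> b' \<otimes> (v \<otimes> (c' \<otimes> d \<ominus> c \<otimes> d'))"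
      using assms(1,3) m(1,3) cl by algebra
    also have "\<dots> = \<zero>" using u v assms m cl by simp
    finally show "fr (a' \<otimes> d' \<oplus> c' \<otimes> b') (b' \<otimes> d') = fr (a \<otimes> d \<oplus> c \<otimes> b) (b \<otimes> d)"
      using assms m cl u v S_mult by (subst frac_eq_iff) (blast intro: m_closed a_closed)+
  qed
  then show ?thesis by (simp add: localization_def)
qed

lemma frac_cancel:
  assumes "a \<in> carrier A" "b \<in> S" "c \<in> S"
  shows "fr (c \<otimes> a) (c \<otimes> b) = fr a b"
proof -
  have cl: "b \<in> carrier A" "c \<in> carrier A" using assms by auto
  have "\<one> \<otimes> (c \<otimes> a \<otimes> b \<ominus> a \<otimes> (c \<otimes> b)) = \<zero>" using assms(1) cl by algebra
  then show ?thesis using assms S_one S_mult cl by (subst frac_eq_iff) blast+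
qed

lemma frac_eqI:
  assumes "a \<in> carrier A" "b \<in> S" "c \<in> carrier A" "d \<in> S" "a \<otimes> d = c \<otimes> b"
  shows "fr a b = fr c d"
proof -
  have "\<one> \<otimes> (a \<otimes> d \<ominus> c \<otimes> b) = \<zero>"
    using assms by (simp add: S_closed)
  then show ?thesis using assms S_one by (subst frac_eq_iff) blast+
qed

lemma localization_simps:
  "carrier (localization A S) = {fr a b | a b. a \<in> carrier A \<and> b \<in> S}"
  "\<one>\<^bsub>localization A S\<^esub> = fr \<one> \<one>"
  "\<zero>\<^bsub>localization A S\<^esub> = fr \<zero> \<one>"
  by (auto simp: localization_def)

lemma localization_cring: "cring (localization A S)"
proof -
  let ?L = "localization A S"
  have E: "\<exists>a\<in>carrier A. \<exists>b\<in>S. x = fr a b" if "x \<in> carrier ?L" for x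
    using that by (auto simp: localization_simps)
  have C: "fr a b \<in> carrier ?L" if "a \<in> carrier A" "b \<in> S" for a b
    using that by (auto simp: localization_simps)
  show ?thesis
  proof (intro cringI abelian_groupI comm_monoidI)
    fix x y assume "x \<in> carrier ?L" "y \<in> carrier ?L"
    then obtain a b c d where [simp]: "x = fr a b" "y = fr c d"
      and m: "a \<in> carrier A" "b \<in> S" "c \<in> carrier A" "d \<in> S" using E by metis
    show "x \<oplus>\<^bsub>?L\<^esub> y \<in> carrier ?L" "x \<otimes>\<^bsub>?L\<^esub> y \<in> carrier ?L"
      using m by (simp_all add: frac_add frac_mult C S_mult)
    have "b \<otimes> d = d \<otimes> b" "a \<otimes> c = c \<otimes> a" "a \<otimes> d \<oplus> c \<otimes> b = c \<otimes> b \<oplus> a \<otimes> d"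
      using m by (auto simp: m_comm a_comm S_closed)
    then show "x \<oplus>\<^bsub>?L\<^esub> y = y \<oplus>\<^bsub>?L\<^esub> x" "x \<otimes>\<^bsub>?L\<^esub> y = y \<otimes>\<^bsub>?L\<^esub> x"
      using m by (simp_all add: frac_add frac_mult)
  next
    fix x y z assume "x \<in> carrier ?L" "y \<in> carrier ?L" "z \<in> carrier ?L"
    then obtain a b c d e k where [simp]: "x = fr a b" "y = fr c d" "z = fr e k"
      and m: "a \<in> carrier A" "b \<in> S" "c \<in> carrier A" "d \<in> S" "e \<in> carrier A" "k \<in> S" using E by metis
    have cl: "b \<in> carrier A" "d \<in> carrier A" "k \<in> carrier A" using m by auto
    have "(a \<otimes> d \<oplus> c \<otimes> b) \<otimes> k \<oplus> e \<otimes> (b \<otimes> d) = a \<otimes> (d \<otimes> k) \<oplus> (c \<otimes> k \<oplus> e \<otimes> d) \<otimes> b"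
      using m(1,3,5) cl by algebra
    then show "x \<oplus>\<^bsub>?L\<^esub> y \<oplus>\<^bsub>?L\<^esub> z = x \<oplus>\<^bsub>?L\<^esub> (y \<oplus>\<^bsub>?L\<^esub> z)"
      using m cl by (simp add: frac_add S_mult m_assoc)
    show "x \<otimes>\<^bsub>?L\<^esub> y \<otimes>\<^bsub>?L\<^esub> z = x \<otimes>\<^bsub>?L\<^esub> (y \<otimes>\<^bsub>?L\<^esub> z)"
      using m cl by (simp add: frac_mult S_mult m_assoc)
    have "(a \<otimes> d \<oplus> c \<otimes> b) \<otimes> e \<otimes> (b \<otimes> k \<otimes> (d \<otimes> k)) = ((a \<otimes> e) \<otimes> (d \<otimes> k) \<oplus> (c \<otimes> e) \<otimes> (b \<otimes> k)) \<otimes> (b \<otimes> d \<otimes> k)"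
      using m(1,3,5) cl by algebra
    then show "(x \<oplus>\<^bsub>?L\<^esub> y) \<otimes>\<^bsub>?L\<^esub> z = x \<otimes>\<^bsub>?L\<^esub> z \<oplus>\<^bsub>?L\<^esub> y \<otimes>\<^bsub>?L\<^esub> z"
      using m cl by (simp add: frac_mult frac_add S_mult) (intro frac_eqI; simp add: S_mult)
  next
    fix x assume "x \<in> carrier ?L"
    then obtain a b where [simp]: "x = fr a b" and m: "a \<in> carrier A" "b \<in> S" using E by metis
    have cl: "b \<in> carrier A" using m by auto
    show "\<zero>\<^bsub>?L\<^esub> \<oplus>\<^bsub>?L\<^esub> x = x" "\<one>\<^bsub>?L\<^esub> \<otimes>\<^bsub>?L\<^esub> x = x"
      using m cl by (simp_all add: localization_simps frac_add frac_mult S_one)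
    have "\<ominus> a \<otimes> b \<oplus> a \<otimes> b = \<zero>" using m(1) cl by algebra
    then have "fr (\<ominus> a) b \<oplus>\<^bsub>?L\<^esub> x = \<zero>\<^bsub>?L\<^esub>"
      using m cl by (simp add: localization_simps frac_add) (intro frac_eqI; simp add: S_one S_mult)
    then show "\<exists>y\<in>carrier ?L. y \<oplus>\<^bsub>?L\<^esub> x = \<zero>\<^bsub>?L\<^esub>" using C m by blast
  qed (use S_one in \<open>auto simp: localization_simps\<close>)
qed

lemma frac_uminus:
  assumes "a \<in> carrier A" "b \<in> S"
  shows "\<ominus>\<^bsub>localization A S\<^esub> fr a b = fr (\<ominus> a) b"
proof -
  interpret L: cring "localization A S" by (rule localization_cring)
  have cl: "b \<in> carrier A" using assms by auto
  have "\<ominus> a \<otimes> b \<oplus> a \<otimes> b = \<zero>" using assms(1) cl by algebra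
  then have "fr (\<ominus> a) b \<oplus>\<^bsub>localization A S\<^esub> fr a b = \<zero>\<^bsub>localization A S\<^esub>"
    using assms cl by (simp add: localization_simps frac_add) (intro frac_eqI; simp add: S_one S_mult)
  then show ?thesis
    using assms by (intro L.minus_equality) (auto simp: localization_simps)
qed

end

section \<open>Ideals and associated primes in commutative rings\<close>

lemma (in cring) ideal_criterion:
  assumes "J \<subseteq> carrier R" "\<zero> \<in> J" "\<And>x y. \<lbrakk>x \<in> J; y \<in> J\<rbrakk> \<Longrightarrow> x \<oplus> y \<in> J"
    and "\<And>r x. \<lbrakk>r \<in> carrier R; x \<in> J\<rbrakk> \<Longrightarrow> r \<otimes> x \<in> J"
  shows "ideal J R"
proof (rule idealI)
  show "subgroup J (add_monoid R)"
  proof (rule group.subgroupI)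
    fix a assume a: "a \<in> J"
    have "\<ominus> a = (\<ominus> \<one>) \<otimes> a" using a assms(1) by (simp add: l_minus subset_iff)
    then show "inv\<^bsub>add_monoid R\<^esub> a \<in> J" using assms(4)[OF _ a, of "\<ominus> \<one>"] by (simp add: a_inv_def)
  qed (use assms add.group_axioms in auto)
  show "x \<otimes> a \<in> J" "a \<otimes> x \<in> J" if "a \<in> J" "x \<in> carrier R" for a x
    using assms(4)[OF that(2,1)] m_comm[of a x] that assms(1) by auto
qed (rule ring_axioms)

lemma (in cring) quot_module_smult:
  assumes "ideal J R" "a \<in> carrier R" "m \<in> carrier R"
  shows "a \<odot>\<^bsub>quot_module R J\<^esub> (J +> m) = \<zero>\<^bsub>quot_module R J\<^esub> \<longleftrightarrow> a \<otimes> m \<in> J"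
proof -
  interpret J: ideal J R by fact
  have "a \<odot>\<^bsub>quot_module R J\<^esub> (J +> m) = J +> (a \<otimes> m)"
    using assms by (simp add: quot_module_def ring.defs module.defs FactRing_def J.rcoset_mult_add)
  moreover have "\<zero>\<^bsub>quot_module R J\<^esub> = J"
    by (simp add: quot_module_def ring.defs module.defs FactRing_def)
  moreover have "J +> (a \<otimes> m) = J \<longleftrightarrow> a \<otimes> m \<in> J"
    using J.a_rcos_const J.a_rcos_self assms by (metis m_closed)
  ultimately show ?thesis by simp
qed

text \<open>Primality comes for free: if the set of nonunits is an annihilator modulo \<open>J\<close>, then it is an
  ideal, and a proper ideal consisting of all nonunits is prime because units are closed under
  products.\<close>

lemma (in cring) nonunits_assoc_iff:
  assumes J: "ideal J R"
  shows "carrier R - Units R \<in> assoc_primes R (quot_module R J)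
    \<longleftrightarrow> (\<exists>m\<in>carrier R. carrier R - Units R = {a \<in> carrier R. a \<otimes> m \<in> J})"
proof -
  interpret J: ideal J R by fact
  have C: "carrier (quot_module R J) = (\<lambda>m. J +> m) ` carrier R"
    by (auto simp: quot_module_def ring.defs module.defs FactRing_simps)
  have "primeideal (carrier R - Units R) R"
    if m: "m \<in> carrier R" and eq: "carrier R - Units R = {a \<in> carrier R. a \<otimes> m \<in> J}" for m
  proof (rule primeidealI)
    have "ideal {a \<in> carrier R. a \<otimes> m \<in> J} R"
    proof (rule ideal_criterion)
      fix x y assume "x \<in> {a \<in> carrier R. a \<otimes> m \<in> J}" "y \<in> {a \<in> carrier R. a \<otimes> m \<in> J}"
      then show "x \<oplus> y \<in> {a \<in> carrier R. a \<otimes> m \<in> J}" using m by (simp add: l_distr)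
    next
      fix r x assume "r \<in> carrier R" "x \<in> {a \<in> carrier R. a \<otimes> m \<in> J}"
      then show "r \<otimes> x \<in> {a \<in> carrier R. a \<otimes> m \<in> J}" using m J.I_l_closed by (simp add: m_assoc)
    qed (use m in auto)
    then show "ideal (carrier R - Units R) R" using eq by simp
    have "\<one> \<in> Units R" by simp
    then show "carrier R \<noteq> carrier R - Units R" using one_closed by blast
    show "a \<in> carrier R - Units R \<or> b \<in> carrier R - Units R"
      if "a \<in> carrier R" "b \<in> carrier R" "a \<otimes> b \<in> carrier R - Units R" for a b
      using that Units_m_closed[of a b] by auto
  qed (rule is_cring)
  then show ?thesis
    unfolding assoc_primes_def using C quot_module_smult[OF J]
    by (auto cong: conj_cong)
qed

section \<open>Sheaves of fractions\<close>

text \<open>The common part of the constructions of Spec and Proj. Openness of the sets where \<open>u\<close> is a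
  denominator makes equations between fractions spread to neighbourhoods; the closure properties
  of \<open>D\<close> make the fractions with admissible pairs a ring; and saturation says that a factor of
  a denominator is a denominator, so that \<open>a/b\<close> is a unit only if \<open>b/a\<close> is a fraction.\<close>

locale fract_site = cring A for A :: "('a, 'm) ring_scheme" (structure) +
  fixes T :: "'a set topology" and S :: "'a set \<Rightarrow> 'a set" and D :: "('a \<times> 'a) set"
  assumes S_mult_set: "p \<in> topspace T \<Longrightarrow> mult_set A (S p)"
    and S_open: "openin T {q \<in> topspace T. u \<in> S q}"
    and D_carrier: "D \<subseteq> carrier A \<times> carrier A"
    and D_one: "(\<one>, \<one>) \<in> D"
    and D_zero: "(\<zero>, \<one>) \<in> D"
    and D_mult: "\<lbrakk>(a, b) \<in> D; (c, d) \<in> D\<rbrakk> \<Longrightarrow> (a \<otimes> c, b \<otimes> d) \<in> D"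
    and D_add: "\<lbrakk>(a, b) \<in> D; (c, d) \<in> D\<rbrakk> \<Longrightarrow> (a \<otimes> d \<oplus> c \<otimes> b, b \<otimes> d) \<in> D"
    and D_uminus: "(a, b) \<in> D \<Longrightarrow> (\<ominus> a, b) \<in> D"
    and D_sym: "(a, b) \<in> D \<Longrightarrow> (b, a) \<in> D"
    and D_diag: "p \<in> topspace T \<Longrightarrow> u \<in> S p \<Longrightarrow> (u, u) \<in> D"
    and S_saturated: "\<lbrakk>p \<in> topspace T; (a, b) \<in> D; c \<in> carrier A; a \<otimes> c \<in> S p\<rbrakk> \<Longrightarrow> a \<in> S p"
begin

abbreviation X where "X \<equiv> fract_space A T S D"

abbreviation frac where "frac p \<equiv> fract_cls A (S p)"

abbreviation Loc where "Loc p \<equiv> localization A (S p)"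

lemma D_closed: "(a, b) \<in> D \<Longrightarrow> a \<in> carrier A" "(a, b) \<in> D \<Longrightarrow> b \<in> carrier A"
  using D_carrier by auto

lemma topo_X [simp]: "topo X = T"
  by (simp add: fract_space_def)

lemma sec_simps:
  "s \<otimes>\<^bsub>sec X V\<^esub> t = (\<lambda>p\<in>V. s p \<otimes>\<^bsub>Loc p\<^esub> t p)"
  "s \<oplus>\<^bsub>sec X V\<^esub> t = (\<lambda>p\<in>V. s p \<oplus>\<^bsub>Loc p\<^esub> t p)"
  "\<one>\<^bsub>sec X V\<^esub> = (\<lambda>p\<in>V. \<one>\<^bsub>Loc p\<^esub>)"
  "\<zero>\<^bsub>sec X V\<^esub> = (\<lambda>p\<in>V. \<zero>\<^bsub>Loc p\<^esub>)"
  by (simp_all add: fract_space_def)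

lemma open_point: "openin T V \<Longrightarrow> p \<in> V \<Longrightarrow> p \<in> topspace T"
  using openin_subset by blast

lemma Loc_cring: "p \<in> topspace T \<Longrightarrow> cring (Loc p)"
  by (rule mult_set.localization_cring[OF S_mult_set])

lemma S_carr: "p \<in> topspace T \<Longrightarrow> u \<in> S p \<Longrightarrow> u \<in> carrier A"
  by (rule mult_set.S_closed[OF S_mult_set])

lemma S_times: "p \<in> topspace T \<Longrightarrow> u \<in> S p \<Longrightarrow> v \<in> S p \<Longrightarrow> u \<otimes> v \<in> S p"
  by (rule mult_set.S_mult[OF S_mult_set])

lemma S_1: "p \<in> topspace T \<Longrightarrow> \<one> \<in> S p"
  by (rule mult_set.S_one[OF S_mult_set])

lemma Loc_mult:
  assumes "p \<in> topspace T" "(a, b) \<in> D" "b \<in> S p" "(c, d) \<in> D" "d \<in> S p"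
  shows "frac p a b \<otimes>\<^bsub>Loc p\<^esub> frac p c d = frac p (a \<otimes> c) (b \<otimes> d)"
  by (rule mult_set.frac_mult[OF S_mult_set]) (use assms D_closed in auto)

lemma Loc_add:
  assumes "p \<in> topspace T" "(a, b) \<in> D" "b \<in> S p" "(c, d) \<in> D" "d \<in> S p"
  shows "frac p a b \<oplus>\<^bsub>Loc p\<^esub> frac p c d = frac p (a \<otimes> d \<oplus> c \<otimes> b) (b \<otimes> d)"
  by (rule mult_set.frac_add[OF S_mult_set]) (use assms D_closed in auto)

lemma Loc_uminus:
  assumes "p \<in> topspace T" "(a, b) \<in> D" "b \<in> S p"
  shows "\<ominus>\<^bsub>Loc p\<^esub> frac p a b = frac p (\<ominus> a) b"
  by (rule mult_set.frac_uminus[OF S_mult_set]) (use assms D_closed in auto)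

lemma Loc_const:
  assumes "p \<in> topspace T"
  shows "\<one>\<^bsub>Loc p\<^esub> = frac p \<one> \<one>" "\<zero>\<^bsub>Loc p\<^esub> = frac p \<zero> \<one>"
  using mult_set.localization_simps[OF S_mult_set[OF assms]] by auto

lemma frac_eq_iff:
  assumes "p \<in> topspace T" "(a, b) \<in> D" "b \<in> S p" "(c, d) \<in> D" "d \<in> S p"
  shows "frac p a b = frac p c d \<longleftrightarrow> (\<exists>u\<in>S p. u \<otimes> (a \<otimes> d \<ominus> c \<otimes> b) = \<zero>)"
  by (rule mult_set.frac_eq_iff[OF S_mult_set]) (use assms D_closed in auto)

lemma frac_cancel:
  assumes "p \<in> topspace T" "(a, b) \<in> D" "b \<in> S p" "u \<in> S p"
  shows "frac p (u \<otimes> a) (u \<otimes> b) = frac p a b"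
  by (rule mult_set.frac_cancel[OF S_mult_set]) (use assms D_closed in auto)

subsection \<open>Local rings\<close>

text \<open>Numerators in \<open>H\<close> serve both for the extension of an ideal \<open>H\<close> to the local ring at \<open>p\<close>
  and, with \<open>H = carrier A\<close>, for the local ring itself.\<close>

definition numer :: "'a set \<Rightarrow> 'a set \<Rightarrow> ('a \<times> 'a) set set" where
  "numer p H = {frac p a b | a b. (a, b) \<in> D \<and> b \<in> S p \<and> a \<in> H}"

definition local_ring where
  "local_ring p = (Loc p)\<lparr>carrier := numer p (carrier A)\<rparr>"

lemma local_ring_simps [simp]:
  "carrier (local_ring p) = numer p (carrier A)"
  "z \<otimes>\<^bsub>local_ring p\<^esub> w = z \<otimes>\<^bsub>Loc p\<^esub> w"
  "z \<oplus>\<^bsub>local_ring p\<^esub> w = z \<oplus>\<^bsub>Loc p\<^esub> w"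
  "\<one>\<^bsub>local_ring p\<^esub> = \<one>\<^bsub>Loc p\<^esub>"
  "\<zero>\<^bsub>local_ring p\<^esub> = \<zero>\<^bsub>Loc p\<^esub>"
  by (auto simp: local_ring_def)

lemma numerI: "(a, b) \<in> D \<Longrightarrow> b \<in> S p \<Longrightarrow> a \<in> H \<Longrightarrow> frac p a b \<in> numer p H"
  by (auto simp: numer_def)

lemma numerE:
  assumes "z \<in> numer p H"
  obtains a b where "z = frac p a b" "(a, b) \<in> D" "b \<in> S p" "a \<in> H"
  using assms by (auto simp: numer_def)

lemma frac_in_local: "(a, b) \<in> D \<Longrightarrow> b \<in> S p \<Longrightarrow> frac p a b \<in> numer p (carrier A)"
  using D_closed by (auto intro: numerI)

lemma numer_carrier: "z \<in> numer p H \<Longrightarrow> z \<in> numer p (carrier A)"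
  by (auto elim!: numerE intro: frac_in_local)

lemma numer_frac_iff:
  assumes "p \<in> topspace T" "(a, b) \<in> D" "b \<in> S p" "ideal H A"
  shows "frac p a b \<in> numer p H \<longleftrightarrow> (\<exists>u\<in>S p. u \<otimes> a \<in> H)"
proof -
  interpret H: ideal H A by fact
  have cl: "a \<in> carrier A" "b \<in> carrier A" using assms D_closed by auto
  show ?thesis
  proof
    assume "frac p a b \<in> numer p H"
    then obtain c d where eq: "frac p a b = frac p c d" and cd: "(c, d) \<in> D" "d \<in> S p" "c \<in> H"
      by (auto elim: numerE)
    then obtain u where u: "u \<in> S p" "u \<otimes> (a \<otimes> d \<ominus> c \<otimes> b) = \<zero>"
      using frac_eq_iff[of p a b c d] assms by blast
    have uc: "u \<in> carrier A" "d \<in> carrier A" "c \<in> carrier A" using u cd D_closed S_carr assms by auto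
    then have "(u \<otimes> d) \<otimes> a = u \<otimes> b \<otimes> c \<oplus> u \<otimes> (a \<otimes> d \<ominus> c \<otimes> b)" using cl by algebra
    then have "(u \<otimes> d) \<otimes> a = u \<otimes> b \<otimes> c" using u uc cl by simp
    moreover have "u \<otimes> b \<otimes> c \<in> H" using H.I_l_closed cd uc cl by simp
    ultimately show "\<exists>u\<in>S p. u \<otimes> a \<in> H"
      using S_times[OF assms(1) u(1) cd(2)] by (intro bexI[of _ "u \<otimes> d"]) auto
  next
    assume "\<exists>u\<in>S p. u \<otimes> a \<in> H"
    then obtain u where u: "u \<in> S p" "u \<otimes> a \<in> H" by blast
    have "frac p a b = frac p (u \<otimes> a) (u \<otimes> b)"
      using frac_cancel assms u by simp
    then show "frac p a b \<in> numer p H"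
      using u assms D_mult D_diag S_times by (auto intro!: numerI)
  qed
qed

lemma numer_add:
  assumes "p \<in> topspace T" "ideal H A" "z \<in> numer p H" "w \<in> numer p H"
  shows "z \<oplus>\<^bsub>Loc p\<^esub> w \<in> numer p H"
proof -
  interpret H: ideal H A by fact
  obtain a b c d where *: "z = frac p a b" "(a, b) \<in> D" "b \<in> S p" "a \<in> H"
    "w = frac p c d" "(c, d) \<in> D" "d \<in> S p" "c \<in> H" using assms by (meson numerE)
  then have "a \<otimes> d \<oplus> c \<otimes> b \<in> H" using D_closed H.I_r_closed by simp
  with * show ?thesis using assms Loc_add D_add S_times by (auto intro!: numerI)
qed

lemma numer_mult:
  assumes "p \<in> topspace T" "ideal H A" "z \<in> numer p (carrier A)" "w \<in> numer p H"
  shows "z \<otimes>\<^bsub>Loc p\<^esub> w \<in> numer p H"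
proof -
  interpret H: ideal H A by fact
  obtain a b c d where *: "z = frac p a b" "(a, b) \<in> D" "b \<in> S p" "a \<in> carrier A"
    "w = frac p c d" "(c, d) \<in> D" "d \<in> S p" "c \<in> H" using assms by (meson numerE)
  then have "a \<otimes> c \<in> H" using D_closed H.I_l_closed by simp
  with * show ?thesis using assms Loc_mult D_mult S_times by (auto intro!: numerI)
qed

lemma numer_zero: "p \<in> topspace T \<Longrightarrow> ideal H A \<Longrightarrow> \<zero>\<^bsub>Loc p\<^esub> \<in> numer p H"
  using D_zero S_1 Loc_const additive_subgroup.zero_closed ideal.axioms(1) by (fastforce intro!: numerI)

lemma numer_one: "p \<in> topspace T \<Longrightarrow> \<one>\<^bsub>Loc p\<^esub> \<in> numer p (carrier A)"
  using D_one S_1 Loc_const by (auto intro!: numerI)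

lemma local_subring: "p \<in> topspace T \<Longrightarrow> subring (numer p (carrier A)) (Loc p)"
proof (rule ring.subringI)
  assume p: "p \<in> topspace T"
  interpret L: cring "Loc p" using Loc_cring p .
  show "ring (Loc p)" by (rule L.ring_axioms)
  have oi: "ideal (carrier A) A" by (rule oneideal)
  show "numer p (carrier A) \<subseteq> carrier (Loc p)"
    using mult_set.localization_simps(1)[OF S_mult_set[OF p]] by (auto simp: numer_def)
  show "\<one>\<^bsub>Loc p\<^esub> \<in> numer p (carrier A)" using numer_one p .
  show "z \<otimes>\<^bsub>Loc p\<^esub> w \<in> numer p (carrier A)" "z \<oplus>\<^bsub>Loc p\<^esub> w \<in> numer p (carrier A)"
    if "z \<in> numer p (carrier A)" "w \<in> numer p (carrier A)" for z w
    using numer_add numer_mult p oi that by auto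
  show "\<ominus>\<^bsub>Loc p\<^esub> z \<in> numer p (carrier A)" if "z \<in> numer p (carrier A)" for z
    using that p D_uminus by (auto elim!: numerE simp: Loc_uminus intro!: numerI)
qed

lemma local_cring: "p \<in> topspace T \<Longrightarrow> cring (local_ring p)"
  using local_subring[of p] cring.subcringI'[OF Loc_cring] ring.subcring_iff[OF cring.axioms(1)[OF Loc_cring]]
    subringE(1) unfolding local_ring_def by blast

lemma numer_ideal:
  assumes "p \<in> topspace T" "ideal H A"
  shows "ideal (numer p H) (local_ring p)"
proof (rule cring.ideal_criterion[OF local_cring])
  show "p \<in> topspace T" by fact
  show "numer p H \<subseteq> carrier (local_ring p)" using numer_carrier by auto
qed (use assms numer_zero numer_add numer_mult in auto)

lemma frac_unit_iff:
  assumes "p \<in> topspace T" "(a, b) \<in> D" "b \<in> S p"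
  shows "frac p a b \<in> Units (local_ring p) \<longleftrightarrow> a \<in> S p"
proof
  have cl: "a \<in> carrier A" "b \<in> carrier A" using assms D_closed by auto
  assume "frac p a b \<in> Units (local_ring p)"
  then obtain z where z: "z \<in> numer p (carrier A)" "frac p a b \<otimes>\<^bsub>Loc p\<^esub> z = \<one>\<^bsub>Loc p\<^esub>"
    by (auto simp: Units_def)
  obtain c d where cd: "z = frac p c d" "(c, d) \<in> D" "d \<in> S p" using z by (auto elim: numerE)
  have "frac p (a \<otimes> c) (b \<otimes> d) = frac p \<one> \<one>" using z cd assms Loc_mult Loc_const by simp
  then obtain u where u: "u \<in> S p" "u \<otimes> ((a \<otimes> c) \<otimes> \<one> \<ominus> \<one> \<otimes> (b \<otimes> d)) = \<zero>"
    using frac_eq_iff[of p "a \<otimes> c" "b \<otimes> d" \<one> \<one>] assms cd D_mult S_times S_1 D_one by auto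
  have cl': "u \<in> carrier A" "c \<in> carrier A" "d \<in> carrier A" using u cd D_closed S_carr assms by auto
  have "a \<otimes> (c \<otimes> u) = u \<otimes> ((a \<otimes> c) \<otimes> \<one> \<ominus> \<one> \<otimes> (b \<otimes> d)) \<oplus> u \<otimes> (b \<otimes> d)"
    using cl cl' by algebra
  then have "a \<otimes> (c \<otimes> u) = u \<otimes> (b \<otimes> d)" using u cl cl' by simp
  moreover have "u \<otimes> (b \<otimes> d) \<in> S p" using S_times assms u cd by simp
  ultimately show "a \<in> S p" using S_saturated[OF assms(1,2), of "c \<otimes> u"] cl' by simp
next
  assume a: "a \<in> S p"
  interpret L: cring "local_ring p" using local_cring assms by blast
  have cl: "a \<in> carrier A" "b \<in> carrier A" using assms D_closed by auto
  have "frac p a b \<otimes>\<^bsub>Loc p\<^esub> frac p b a = frac p ((a \<otimes> b) \<otimes> \<one>) ((a \<otimes> b) \<otimes> \<one>)"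
    using assms a D_sym Loc_mult cl by (simp add: m_comm)
  also have "\<dots> = \<one>\<^bsub>Loc p\<^esub>"
    using frac_cancel[of p \<one> \<one> "a \<otimes> b"] assms a D_one S_1 S_times Loc_const by simp
  finally have 1: "frac p a b \<otimes>\<^bsub>local_ring p\<^esub> frac p b a = \<one>\<^bsub>local_ring p\<^esub>" by simp
  have 2: "frac p a b \<in> carrier (local_ring p)" "frac p b a \<in> carrier (local_ring p)"
    using assms a D_sym frac_in_local by auto
  have 3: "frac p b a \<otimes>\<^bsub>local_ring p\<^esub> frac p a b = \<one>\<^bsub>local_ring p\<^esub>"
    using 1 L.m_comm[OF 2] by metis
  show "frac p a b \<in> Units (local_ring p)" unfolding Units_def using 1 2 3 by blast
qed

end

lemma local_fract_iff:
  "local_fract A T S D V s \<longleftrightarrow> (\<forall>p\<in>V. \<exists>W a b. openin T W \<and> p \<in> W \<and> W \<subseteq> V \<and> (a, b) \<in> D \<and>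
     (\<forall>q\<in>W. b \<in> S q \<and> s q = fract_cls A (S q) a b))"
proof -
  have "(\<exists>(a, b)\<in>D. P a b) \<longleftrightarrow> (\<exists>a b. (a, b) \<in> D \<and> P a b)" for P :: "'a \<Rightarrow> 'a \<Rightarrow> bool"
    by auto
  then show ?thesis by (simp add: local_fract_def)
qed

context fract_site
begin

subsection \<open>Sections\<close>

lemma sec_carrier_iff:
  assumes "openin T V"
  shows "s \<in> carrier (sec X V) \<longleftrightarrow> s \<in> extensional V \<and> local_fract A T S D V s"
proof -
  have "s p \<in> carrier (Loc p)" if "local_fract A T S D V s" "p \<in> V" for p
  proof -
    obtain W a b where "p \<in> W" "(a, b) \<in> D" "\<forall>q\<in>W. b \<in> S q \<and> s q = frac q a b"
      using \<open>local_fract A T S D V s\<close> \<open>p \<in> V\<close> unfolding local_fract_iff by meson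
    then have "s p \<in> numer p (carrier A)" using frac_in_local[of a b p] by simp
    then show ?thesis using subringE(1)[OF local_subring[OF open_point[OF assms that(2)]]] by blast
  qed
  then show ?thesis by (auto simp: fract_space_def PiE_def)
qed

lemma secI:
  assumes "openin T V" "s \<in> extensional V"
    and "\<And>p. p \<in> V \<Longrightarrow> \<exists>W a b. openin T W \<and> p \<in> W \<and> (a, b) \<in> D \<and> (\<forall>q\<in>W \<inter> V. b \<in> S q \<and> s q = frac q a b)"
  shows "s \<in> carrier (sec X V)"
proof -
  have "local_fract A T S D V s"
    unfolding local_fract_iff
  proof
    fix p assume "p \<in> V"
    then obtain W a b where W: "openin T W" "p \<in> W" "(a, b) \<in> D" "\<forall>q\<in>W \<inter> V. b \<in> S q \<and> s q = frac q a b"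
      using assms(3)[OF \<open>p \<in> V\<close>] by metis
    then have "openin T (W \<inter> V)" "p \<in> W \<inter> V" using assms(1) \<open>p \<in> V\<close> by auto
    then show "\<exists>W a b. openin T W \<and> p \<in> W \<and> W \<subseteq> V \<and> (a, b) \<in> D \<and> (\<forall>q\<in>W. b \<in> S q \<and> s q = frac q a b)"
      using W by (intro exI[of _ "W \<inter> V"] exI[of _ a] exI[of _ b]) simp
  qed
  then show ?thesis using sec_carrier_iff[OF assms(1)] assms(2) by simp
qed

lemma secE:
  assumes "openin T V" "s \<in> carrier (sec X V)" "p \<in> V"
  obtains W a b where "openin T W" "p \<in> W" "W \<subseteq> V" "(a, b) \<in> D" "\<And>q. q \<in> W \<Longrightarrow> b \<in> S q"
    "\<And>q. q \<in> W \<Longrightarrow> s q = frac q a b"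
  using assms sec_carrier_iff[of V s] unfolding local_fract_iff by meson

lemma sec_extensional: "s \<in> carrier (sec X V) \<Longrightarrow> s \<in> extensional V"
  by (simp add: fract_space_def PiE_def)

lemma sec_value: "openin T V \<Longrightarrow> s \<in> carrier (sec X V) \<Longrightarrow> p \<in> V \<Longrightarrow> s p \<in> numer p (carrier A)"
  by (erule (2) secE) (simp add: frac_in_local)

lemma sec_eqI:
  assumes "s \<in> carrier (sec X V)" "t \<in> carrier (sec X V)" "\<And>p. p \<in> V \<Longrightarrow> s p = t p"
  shows "s = t"
  by (rule extensionalityI[OF sec_extensional[OF assms(1)] sec_extensional[OF assms(2)] assms(3)])

lemma sec_closed:
  assumes V: "openin T V" and s: "s \<in> carrier (sec X V)" and t: "t \<in> carrier (sec X V)"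
  shows "s \<otimes>\<^bsub>sec X V\<^esub> t \<in> carrier (sec X V)" "s \<oplus>\<^bsub>sec X V\<^esub> t \<in> carrier (sec X V)"
proof -
  have L: "\<exists>W a b c d. openin T W \<and> p \<in> W \<and> W \<subseteq> V \<and> (a, b) \<in> D \<and> (c, d) \<in> D \<and>
      (\<forall>q\<in>W. b \<in> S q \<and> s q = frac q a b \<and> d \<in> S q \<and> t q = frac q c d \<and> q \<in> topspace T)" if p: "p \<in> V" for p
  proof -
    obtain W a b where W: "openin T W" "p \<in> W" "W \<subseteq> V" "(a, b) \<in> D" "\<And>q. q \<in> W \<Longrightarrow> b \<in> S q" "\<And>q. q \<in> W \<Longrightarrow> s q = frac q a b"
      using secE[OF V s p] by metis
    obtain W' c d where W': "openin T W'" "p \<in> W'" "W' \<subseteq> V" "(c, d) \<in> D" "\<And>q. q \<in> W' \<Longrightarrow> d \<in> S q" "\<And>q. q \<in> W' \<Longrightarrow> t q = frac q c d"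
      using secE[OF V t p] by metis
    have "openin T (W \<inter> W')" "p \<in> W \<inter> W'" using W W' by auto
    with W W' V show ?thesis
      by (intro exI[of _ "W \<inter> W'"] exI[of _ a] exI[of _ b] exI[of _ c] exI[of _ d]) (auto intro: open_point)
  qed
  show "s \<otimes>\<^bsub>sec X V\<^esub> t \<in> carrier (sec X V)"
  proof (rule secI[OF V])
    fix p assume "p \<in> V"
    then obtain W a b c d where W: "openin T W" "p \<in> W" "W \<subseteq> V" "(a, b) \<in> D" "(c, d) \<in> D"
      "\<forall>q\<in>W. b \<in> S q \<and> s q = frac q a b \<and> d \<in> S q \<and> t q = frac q c d \<and> q \<in> topspace T" using L[OF \<open>p \<in> V\<close>] by metis
    then show "\<exists>W a b. openin T W \<and> p \<in> W \<and> (a, b) \<in> D \<and> (\<forall>q\<in>W \<inter> V. b \<in> S q \<and> (s \<otimes>\<^bsub>sec X V\<^esub> t) q = frac q a b)"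
      by (intro exI[of _ W] exI[of _ "a \<otimes> c"] exI[of _ "b \<otimes> d"])
        (simp add: sec_simps Loc_mult D_mult S_times)
  qed (simp add: sec_simps)
  show "s \<oplus>\<^bsub>sec X V\<^esub> t \<in> carrier (sec X V)"
  proof (rule secI[OF V])
    fix p assume "p \<in> V"
    then obtain W a b c d where W: "openin T W" "p \<in> W" "W \<subseteq> V" "(a, b) \<in> D" "(c, d) \<in> D"
      "\<forall>q\<in>W. b \<in> S q \<and> s q = frac q a b \<and> d \<in> S q \<and> t q = frac q c d \<and> q \<in> topspace T" using L[OF \<open>p \<in> V\<close>] by metis
    then show "\<exists>W a b. openin T W \<and> p \<in> W \<and> (a, b) \<in> D \<and> (\<forall>q\<in>W \<inter> V. b \<in> S q \<and> (s \<oplus>\<^bsub>sec X V\<^esub> t) q = frac q a b)"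
      by (intro exI[of _ W] exI[of _ "a \<otimes> d \<oplus> c \<otimes> b"] exI[of _ "b \<otimes> d"])
        (simp add: sec_simps Loc_add D_add S_times)
  qed (simp add: sec_simps)
qed

lemma sec_uminus:
  assumes V: "openin T V" and s: "s \<in> carrier (sec X V)"
  shows "(\<lambda>p\<in>V. \<ominus>\<^bsub>Loc p\<^esub> s p) \<in> carrier (sec X V)"
proof (rule secI[OF V])
  fix p assume p: "p \<in> V"
  obtain W a b where W: "openin T W" "p \<in> W" "W \<subseteq> V" "(a, b) \<in> D" "\<And>q. q \<in> W \<Longrightarrow> b \<in> S q" "\<And>q. q \<in> W \<Longrightarrow> s q = frac q a b"
    using secE[OF V s p] by metis
  then show "\<exists>W a b. openin T W \<and> p \<in> W \<and> (a, b) \<in> D \<and> (\<forall>q\<in>W \<inter> V. b \<in> S q \<and> (\<lambda>p\<in>V. \<ominus>\<^bsub>Loc p\<^esub> s p) q = frac q a b)"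
    by (intro exI[of _ W] exI[of _ "\<ominus> a"] exI[of _ b]) (simp add: Loc_uminus D_uminus open_point[OF V])
qed simp

lemma sec_const:
  assumes V: "openin T V"
  shows "\<one>\<^bsub>sec X V\<^esub> \<in> carrier (sec X V)" "\<zero>\<^bsub>sec X V\<^esub> \<in> carrier (sec X V)"
proof -
  have "\<exists>W a b. openin T W \<and> p \<in> W \<and> (a, b) \<in> D \<and> (\<forall>q\<in>W \<inter> V. b \<in> S q \<and> \<one>\<^bsub>sec X V\<^esub> q = frac q a b)" if "p \<in> V" for p
    using V that by (intro exI[of _ V] exI[of _ \<one>]) (simp add: sec_simps D_one S_1 open_point[OF V] Loc_const)
  then show "\<one>\<^bsub>sec X V\<^esub> \<in> carrier (sec X V)" using secI[OF V] by (simp add: sec_simps)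
  have "\<exists>W a b. openin T W \<and> p \<in> W \<and> (a, b) \<in> D \<and> (\<forall>q\<in>W \<inter> V. b \<in> S q \<and> \<zero>\<^bsub>sec X V\<^esub> q = frac q a b)" if "p \<in> V" for p
    using V that by (intro exI[of _ V] exI[of _ \<zero>] exI[of _ \<one>]) (simp add: sec_simps D_zero S_1 open_point[OF V] Loc_const)
  then show "\<zero>\<^bsub>sec X V\<^esub> \<in> carrier (sec X V)" using secI[OF V] by (simp add: sec_simps)
qed

lemma sec_cring:
  assumes V: "openin T V"
  shows "cring (sec X V)"
proof -
  have val: "s p \<in> carrier (Loc p)" if "s \<in> carrier (sec X V)" "p \<in> V" for s p
    using sec_value[OF V that] subringE(1)[OF local_subring[OF open_point[OF V that(2)]]] by blast
  have R: "cring (Loc p)" "ring (Loc p)" if "p \<in> V" for p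
    using Loc_cring[OF open_point[OF V that]] cring.axioms(1) by auto
  show ?thesis
  proof (intro cringI abelian_groupI comm_monoidI)
    fix s t assume st: "s \<in> carrier (sec X V)" "t \<in> carrier (sec X V)"
    show "s \<oplus>\<^bsub>sec X V\<^esub> t \<in> carrier (sec X V)" "s \<otimes>\<^bsub>sec X V\<^esub> t \<in> carrier (sec X V)"
      using sec_closed[OF V st] by auto
    have "s p \<oplus>\<^bsub>Loc p\<^esub> t p = t p \<oplus>\<^bsub>Loc p\<^esub> s p" "s p \<otimes>\<^bsub>Loc p\<^esub> t p = t p \<otimes>\<^bsub>Loc p\<^esub> s p"
      if "p \<in> V" for p
    proof -
      interpret L: cring "Loc p" using R that by blast
      show "s p \<oplus>\<^bsub>Loc p\<^esub> t p = t p \<oplus>\<^bsub>Loc p\<^esub> s p" "s p \<otimes>\<^bsub>Loc p\<^esub> t p = t p \<otimes>\<^bsub>Loc p\<^esub> s p"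
        using L.a_comm L.m_comm val[OF st(1) that] val[OF st(2) that] by simp_all
    qed
    then show "s \<oplus>\<^bsub>sec X V\<^esub> t = t \<oplus>\<^bsub>sec X V\<^esub> s" "s \<otimes>\<^bsub>sec X V\<^esub> t = t \<otimes>\<^bsub>sec X V\<^esub> s"
      unfolding sec_simps by (simp_all cong: restrict_cong)
  next
    fix s t u assume st: "s \<in> carrier (sec X V)" "t \<in> carrier (sec X V)" "u \<in> carrier (sec X V)"
    note v = val[OF st(1)] val[OF st(2)] val[OF st(3)]
    have "s p \<oplus>\<^bsub>Loc p\<^esub> t p \<oplus>\<^bsub>Loc p\<^esub> u p = s p \<oplus>\<^bsub>Loc p\<^esub> (t p \<oplus>\<^bsub>Loc p\<^esub> u p)"
      "s p \<otimes>\<^bsub>Loc p\<^esub> t p \<otimes>\<^bsub>Loc p\<^esub> u p = s p \<otimes>\<^bsub>Loc p\<^esub> (t p \<otimes>\<^bsub>Loc p\<^esub> u p)"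
      "(s p \<oplus>\<^bsub>Loc p\<^esub> t p) \<otimes>\<^bsub>Loc p\<^esub> u p = s p \<otimes>\<^bsub>Loc p\<^esub> u p \<oplus>\<^bsub>Loc p\<^esub> t p \<otimes>\<^bsub>Loc p\<^esub> u p" if "p \<in> V" for p
    proof -
      interpret L: cring "Loc p" using R that by blast
      show "s p \<oplus>\<^bsub>Loc p\<^esub> t p \<oplus>\<^bsub>Loc p\<^esub> u p = s p \<oplus>\<^bsub>Loc p\<^esub> (t p \<oplus>\<^bsub>Loc p\<^esub> u p)"
      "s p \<otimes>\<^bsub>Loc p\<^esub> t p \<otimes>\<^bsub>Loc p\<^esub> u p = s p \<otimes>\<^bsub>Loc p\<^esub> (t p \<otimes>\<^bsub>Loc p\<^esub> u p)"
      "(s p \<oplus>\<^bsub>Loc p\<^esub> t p) \<otimes>\<^bsub>Loc p\<^esub> u p = s p \<otimes>\<^bsub>Loc p\<^esub> u p \<oplus>\<^bsub>Loc p\<^esub> t p \<otimes>\<^bsub>Loc p\<^esub> u p"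
        using v that by (simp_all add: L.a_assoc L.m_assoc L.l_distr)
    qed
    then show "s \<oplus>\<^bsub>sec X V\<^esub> t \<oplus>\<^bsub>sec X V\<^esub> u = s \<oplus>\<^bsub>sec X V\<^esub> (t \<oplus>\<^bsub>sec X V\<^esub> u)"
      "s \<otimes>\<^bsub>sec X V\<^esub> t \<otimes>\<^bsub>sec X V\<^esub> u = s \<otimes>\<^bsub>sec X V\<^esub> (t \<otimes>\<^bsub>sec X V\<^esub> u)"
      "(s \<oplus>\<^bsub>sec X V\<^esub> t) \<otimes>\<^bsub>sec X V\<^esub> u = s \<otimes>\<^bsub>sec X V\<^esub> u \<oplus>\<^bsub>sec X V\<^esub> t \<otimes>\<^bsub>sec X V\<^esub> u"
      unfolding sec_simps by (simp_all cong: restrict_cong)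
  next
    fix s assume s: "s \<in> carrier (sec X V)"
    have "\<zero>\<^bsub>Loc p\<^esub> \<oplus>\<^bsub>Loc p\<^esub> s p = s p" "\<one>\<^bsub>Loc p\<^esub> \<otimes>\<^bsub>Loc p\<^esub> s p = s p"
      "\<ominus>\<^bsub>Loc p\<^esub> s p \<oplus>\<^bsub>Loc p\<^esub> s p = \<zero>\<^bsub>Loc p\<^esub>" if "p \<in> V" for p
    proof -
      interpret L: cring "Loc p" using R that by blast
      show "\<zero>\<^bsub>Loc p\<^esub> \<oplus>\<^bsub>Loc p\<^esub> s p = s p" "\<one>\<^bsub>Loc p\<^esub> \<otimes>\<^bsub>Loc p\<^esub> s p = s p"
      "\<ominus>\<^bsub>Loc p\<^esub> s p \<oplus>\<^bsub>Loc p\<^esub> s p = \<zero>\<^bsub>Loc p\<^esub>"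
        using val[OF s that] by (simp_all add: L.l_neg)
    qed
    note pt = this
    show "\<zero>\<^bsub>sec X V\<^esub> \<oplus>\<^bsub>sec X V\<^esub> s = s"
      by (rule sec_eqI[OF sec_closed(2)[OF V sec_const(2)[OF V] s] s]) (simp add: sec_simps pt)
    show "\<one>\<^bsub>sec X V\<^esub> \<otimes>\<^bsub>sec X V\<^esub> s = s"
      by (rule sec_eqI[OF sec_closed(1)[OF V sec_const(1)[OF V] s] s]) (simp add: sec_simps pt)
    have "(\<lambda>p\<in>V. \<ominus>\<^bsub>Loc p\<^esub> s p) \<oplus>\<^bsub>sec X V\<^esub> s = \<zero>\<^bsub>sec X V\<^esub>"
      unfolding sec_simps using pt by (simp cong: restrict_cong)
    then show "\<exists>t\<in>carrier (sec X V). t \<oplus>\<^bsub>sec X V\<^esub> s = \<zero>\<^bsub>sec X V\<^esub>"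
      using sec_uminus[OF V s] by (rule bexI)
  qed (simp_all add: sec_const[OF V])
qed

lemma restrict_sec:
  assumes "openin T U" "s \<in> carrier (sec X U)" "openin T V" "V \<subseteq> U"
  shows "restrict s V \<in> carrier (sec X V)"
proof (rule secI[OF assms(3)])
  fix p assume "p \<in> V"
  with assms(4) have "p \<in> U" by blast
  then obtain W a b where "openin T W" "p \<in> W" "W \<subseteq> U" "(a, b) \<in> D" "\<And>q. q \<in> W \<Longrightarrow> b \<in> S q" "\<And>q. q \<in> W \<Longrightarrow> s q = frac q a b"
    using secE[OF assms(1,2)] by metis
  then show "\<exists>W a b. openin T W \<and> p \<in> W \<and> (a, b) \<in> D \<and> (\<forall>q\<in>W \<inter> V. b \<in> S q \<and> restrict s V q = frac q a b)"
    by (intro exI[of _ W] exI[of _ a] exI[of _ b]) simp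
qed simp

lemma frac_sec:
  assumes "(a, b) \<in> D" "openin T V" "\<And>q. q \<in> V \<Longrightarrow> b \<in> S q"
  shows "(\<lambda>q\<in>V. frac q a b) \<in> carrier (sec X V)"
  using assms by (intro secI exI[of _ V] exI[of _ a] exI[of _ b]) simp_all

end

context fract_site
begin

subsection \<open>Stalks\<close>

definition germs where
  "germs p z = {(V, t). openin T V \<and> p \<in> V \<and> t \<in> carrier (sec X V) \<and> t p = z}"

text \<open>Sections with the same value at \<open>p\<close> have the same germ: the equation between two fractions
  representing them involves finitely many denominators, which remain denominators near \<open>p\<close>.\<close>

lemma germ_eq:
  assumes "openin T U" "p \<in> U" "s \<in> carrier (sec X U)"
  shows "germ X p U s = germs p (s p)"
proof (intro equalityI subsetI)
  fix x assume "x \<in> germ X p U s"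
  then obtain V t W where x: "x = (V, t)" "openin T V" "p \<in> V" "t \<in> carrier (sec X V)" "p \<in> W" "restrict s W = restrict t W"
    unfolding germ_def by auto
  have "s p = t p" using fun_cong[OF x(6), of p] x(5) by simp
  then show "x \<in> germs p (s p)" using x by (simp add: germs_def)
next
  fix x assume "x \<in> germs p (s p)"
  then obtain V t where x: "x = (V, t)" "openin T V" "p \<in> V" "t \<in> carrier (sec X V)" "t p = s p"
    unfolding germs_def by auto
  obtain W a b where W: "openin T W" "p \<in> W" "W \<subseteq> U" "(a, b) \<in> D" "\<And>q. q \<in> W \<Longrightarrow> b \<in> S q" "\<And>q. q \<in> W \<Longrightarrow> s q = frac q a b"
    using secE[OF assms(1,3,2)] by metis
  obtain W' c d where W': "openin T W'" "p \<in> W'" "W' \<subseteq> V" "(c, d) \<in> D" "\<And>q. q \<in> W' \<Longrightarrow> d \<in> S q" "\<And>q. q \<in> W' \<Longrightarrow> t q = frac q c d"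
    using secE[OF x(2,4,3)] by metis
  have pT: "p \<in> topspace T" using open_point[OF assms(1,2)] .
  have "frac p a b = frac p c d" using W(6)[OF W(2)] W'(6)[OF W'(2)] x(5) by simp
  then obtain u where u: "u \<in> S p" "u \<otimes> (a \<otimes> d \<ominus> c \<otimes> b) = \<zero>"
    using frac_eq_iff[OF pT W(4) W(5)[OF W(2)] W'(4) W'(5)[OF W'(2)]] by auto
  define N where "N = W \<inter> W' \<inter> {q \<in> topspace T. u \<in> S q}"
  have N: "openin T N" "p \<in> N" "N \<subseteq> U \<inter> V"
    unfolding N_def using W W' u(1) pT S_open[of u] by auto
  have "s q = t q" if "q \<in> N" for q
  proof -
    have q: "q \<in> W" "q \<in> W'" "q \<in> topspace T" "u \<in> S q" using that by (auto simp: N_def)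
    show ?thesis
      using frac_eq_iff[OF q(3) W(4) W(5)[OF q(1)] W'(4) W'(5)[OF q(2)]] u(2) q W(6) W'(6) by auto
  qed
  then have "restrict s N = restrict t N" by (simp cong: restrict_cong)
  then show "x \<in> germ X p U s" unfolding germ_def using x(1-4) N by auto
qed

lemma germ_repr:
  assumes "p \<in> topspace T" "z \<in> numer p H"
  obtains V t a b where "openin T V" "p \<in> V" "t \<in> carrier (sec X V)" "t p = z" "(a, b) \<in> D" "a \<in> H"
    "\<And>q. q \<in> V \<Longrightarrow> b \<in> S q" "\<And>q. q \<in> V \<Longrightarrow> t q = frac q a b"
proof -
  obtain a b where ab: "z = frac p a b" "(a, b) \<in> D" "b \<in> S p" "a \<in> H" using assms(2) by (rule numerE)
  define V where "V = {q \<in> topspace T. b \<in> S q}"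
  have V: "openin T V" "p \<in> V" "\<And>q. q \<in> V \<Longrightarrow> b \<in> S q" using S_open ab assms(1) by (auto simp: V_def)
  show thesis
    by (rule that[of V "\<lambda>q\<in>V. frac q a b" a b]) (use V ab frac_sec[OF ab(2) V(1,3)] in auto)
qed

lemma germs_inj:
  assumes "p \<in> topspace T" "z \<in> numer p (carrier A)" "germs p z = germs p w"
  shows "z = w"
proof -
  obtain V t where "openin T V" "p \<in> V" "t \<in> carrier (sec X V)" "t p = z" using germ_repr[OF assms(1,2)] by metis
  then have "(V, t) \<in> germs p z" by (simp add: germs_def)
  then have "(V, t) \<in> germs p w" using assms by simp
  then show ?thesis using \<open>t p = z\<close> by (simp add: germs_def)
qed

lemma stalk_carrier:
  assumes "p \<in> topspace T"
  shows "carrier (stalk X p) = germs p ` numer p (carrier A)"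
proof (intro equalityI subsetI)
  fix x assume "x \<in> carrier (stalk X p)"
  then obtain U s where "x = germ X p U s" "openin T U" "p \<in> U" "s \<in> carrier (sec X U)"
    by (auto simp: stalk_def)
  then show "x \<in> germs p ` numer p (carrier A)" using germ_eq[of U p s] sec_value[of U s p] by simp
next
  fix x assume "x \<in> germs p ` numer p (carrier A)"
  then obtain z where z: "x = germs p z" "z \<in> numer p (carrier A)" by auto
  obtain V t where "openin T V" "p \<in> V" "t \<in> carrier (sec X V)" "t p = z" using germ_repr[OF assms z(2)] by metis
  then have "x = germ X p V t" "openin T V" "p \<in> V" "t \<in> carrier (sec X V)" using z germ_eq[of V p t] by auto
  then show "x \<in> carrier (stalk X p)" unfolding stalk_def by auto
qed

lemma stalk_frac:
  assumes "p \<in> topspace T"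
  shows "carrier (stalk X p) = {germs p (frac p c d) | c d. (c, d) \<in> D \<and> d \<in> S p}"
proof -
  have "numer p (carrier A) = {frac p c d | c d. (c, d) \<in> D \<and> d \<in> S p}"
    unfolding numer_def using D_closed(1) by blast
  then show ?thesis unfolding stalk_carrier[OF assms] by auto
qed

lemma germs_UN:
  assumes "p \<in> topspace T" "z \<in> numer p (carrier A)" "w \<in> numer p (carrier A)"
    and "\<And>U s V t. \<lbrakk>openin T U; p \<in> U; s \<in> carrier (sec X U); s p = z; openin T V; p \<in> V; t \<in> carrier (sec X V); t p = w\<rbrakk>
      \<Longrightarrow> F U s V t = Y"
  shows "(\<Union>(U, s)\<in>germs p z. \<Union>(V, t)\<in>germs p w. F U s V t) = Y"
proof -
  obtain V t where "openin T V" "p \<in> V" "t \<in> carrier (sec X V)" "t p = z" using germ_repr[OF assms(1,2)] by metis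
  then have 1: "(V, t) \<in> germs p z" by (simp add: germs_def)
  obtain V' t' where "openin T V'" "p \<in> V'" "t' \<in> carrier (sec X V')" "t' p = w" using germ_repr[OF assms(1,3)] by metis
  then have 2: "(V', t') \<in> germs p w" by (simp add: germs_def)
  have "F U s V t = Y" if "(U, s) \<in> germs p z" "(V, t) \<in> germs p w" for U s V t
    using that assms(4)[of U s V t] by (simp add: germs_def)
  then show ?thesis using 1 2 by fast
qed

lemma stalk_ops:
  assumes "p \<in> topspace T" "z \<in> numer p (carrier A)" "w \<in> numer p (carrier A)"
  shows "germs p z \<otimes>\<^bsub>stalk X p\<^esub> germs p w = germs p (z \<otimes>\<^bsub>Loc p\<^esub> w)"
    and "germs p z \<oplus>\<^bsub>stalk X p\<^esub> germs p w = germs p (z \<oplus>\<^bsub>Loc p\<^esub> w)"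
proof -
  have "germ X p (U \<inter> V) (restrict s (U \<inter> V) \<otimes>\<^bsub>sec X (U \<inter> V)\<^esub> restrict t (U \<inter> V)) = germs p (z \<otimes>\<^bsub>Loc p\<^esub> w) \<and>
     germ X p (U \<inter> V) (restrict s (U \<inter> V) \<oplus>\<^bsub>sec X (U \<inter> V)\<^esub> restrict t (U \<inter> V)) = germs p (z \<oplus>\<^bsub>Loc p\<^esub> w)"
    if "openin T U" "p \<in> U" "s \<in> carrier (sec X U)" "s p = z" "openin T V" "p \<in> V" "t \<in> carrier (sec X V)" "t p = w"
    for U s V t
  proof -
    have o: "openin T (U \<inter> V)" "p \<in> U \<inter> V" using that by auto
    have r: "restrict s (U \<inter> V) \<in> carrier (sec X (U \<inter> V))" "restrict t (U \<inter> V) \<in> carrier (sec X (U \<inter> V))"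
      using restrict_sec[OF that(1,3) o(1)] restrict_sec[OF that(5,7) o(1)] by auto
    show ?thesis
      using germ_eq[OF o sec_closed(1)[OF o(1) r]] germ_eq[OF o sec_closed(2)[OF o(1) r]] o(2) that(4,8)
      by (simp add: sec_simps)
  qed
  note * = this
  show "germs p z \<otimes>\<^bsub>stalk X p\<^esub> germs p w = germs p (z \<otimes>\<^bsub>Loc p\<^esub> w)"
    unfolding stalk_def monoid.simps ring.simps by (rule germs_UN[OF assms]) (use * in blast)
  show "germs p z \<oplus>\<^bsub>stalk X p\<^esub> germs p w = germs p (z \<oplus>\<^bsub>Loc p\<^esub> w)"
    unfolding stalk_def monoid.simps ring.simps by (rule germs_UN[OF assms]) (use * in blast)
qed

lemma stalk_const:
  assumes "p \<in> topspace T"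
  shows "\<one>\<^bsub>stalk X p\<^esub> = germs p \<one>\<^bsub>Loc p\<^esub>" "\<zero>\<^bsub>stalk X p\<^esub> = germs p \<zero>\<^bsub>Loc p\<^esub>"
  using germ_eq[OF openin_topspace assms sec_const(1)[OF openin_topspace]]
    germ_eq[OF openin_topspace assms sec_const(2)[OF openin_topspace]] assms
  by (simp_all add: stalk_def sec_simps)

lemma local_mult:
  "\<lbrakk>p \<in> topspace T; z \<in> numer p (carrier A); w \<in> numer p (carrier A)\<rbrakk> \<Longrightarrow> z \<otimes>\<^bsub>Loc p\<^esub> w \<in> numer p (carrier A)"
  using numer_mult[OF _ oneideal] .

lemma stalk_iso:
  assumes "p \<in> topspace T"
  shows "germs p \<in> ring_iso (local_ring p) (stalk X p)"
proof (rule ring_iso_memI)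
  show "bij_betw (germs p) (carrier (local_ring p)) (carrier (stalk X p))"
    using germs_inj[OF assms] by (auto simp: bij_betw_def stalk_carrier[OF assms] inj_on_def)
qed (use assms in \<open>simp_all add: stalk_carrier stalk_ops stalk_const\<close>)

lemma stalk_cring:
  assumes "p \<in> topspace T"
  shows "cring (stalk X p)"
proof -
  have "cring ((stalk X p)\<lparr>zero := germs p \<zero>\<^bsub>local_ring p\<^esub>\<rparr>)"
    by (rule cring.ring_iso_imp_img_cring[OF local_cring[OF assms] stalk_iso[OF assms]])
  moreover have "(stalk X p)\<lparr>zero := germs p \<zero>\<^bsub>local_ring p\<^esub>\<rparr> = stalk X p"
    using stalk_const(2)[OF assms] by simp
  ultimately show ?thesis by simp
qed

lemma stalk_unit_iff:
  assumes p: "p \<in> topspace T" and z: "z \<in> numer p (carrier A)"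
  shows "germs p z \<in> Units (stalk X p) \<longleftrightarrow> z \<in> Units (local_ring p)"
proof -
  have eq: "germs p w \<otimes>\<^bsub>stalk X p\<^esub> germs p w' = \<one>\<^bsub>stalk X p\<^esub> \<longleftrightarrow> w \<otimes>\<^bsub>Loc p\<^esub> w' = \<one>\<^bsub>Loc p\<^esub>"
    if w: "w \<in> numer p (carrier A)" "w' \<in> numer p (carrier A)" for w w'
    using stalk_ops(1)[OF p w] stalk_const(1)[OF p] germs_inj[OF p local_mult[OF p w]] by auto
  show ?thesis
    unfolding Units_def using z eq[OF z] eq[OF _ z] by (auto simp: stalk_carrier[OF p])
qed

subsection \<open>The ideal sheaf of an ideal\<close>

abbreviation J where "J \<equiv> fract_ideal_sheaf A T S D"

lemma local_fract_numer_iff: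
  "local_fract A T S {(a, b) \<in> D. a \<in> H} V s \<longleftrightarrow> (\<forall>p\<in>V. \<exists>W a b. openin T W \<and> p \<in> W \<and> W \<subseteq> V \<and> (a, b) \<in> D \<and> a \<in> H \<and>
     (\<forall>q\<in>W. b \<in> S q \<and> s q = frac q a b))"
  by (simp add: local_fract_iff)

text \<open>Membership in the ideal sheaf of \<open>H\<close> is a pointwise condition, since a fraction that has a
  numerator in \<open>H\<close> at one point has one on a neighbourhood.\<close>

lemma J_iff:
  assumes H: "ideal H A" and V: "openin T V"
  shows "s \<in> J H V \<longleftrightarrow> s \<in> carrier (sec X V) \<and> (\<forall>p\<in>V. s p \<in> numer p H)"
proof -
  have "s p \<in> numer p H" if "local_fract A T S {(a, b) \<in> D. a \<in> H} V s" "p \<in> V" for p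
  proof -
    obtain W a b where "p \<in> W" "(a, b) \<in> D" "a \<in> H" "\<forall>q\<in>W. b \<in> S q \<and> s q = frac q a b"
      using \<open>local_fract A T S _ V s\<close> \<open>p \<in> V\<close> unfolding local_fract_numer_iff by metis
    then show ?thesis using numerI[of a b p H] by simp
  qed
  moreover have "local_fract A T S {(a, b) \<in> D. a \<in> H} V s"
    if s: "s \<in> carrier (sec X V)" "\<forall>p\<in>V. s p \<in> numer p H"
    unfolding local_fract_numer_iff
  proof
    fix p assume p: "p \<in> V"
    obtain W a b where W: "openin T W" "p \<in> W" "W \<subseteq> V" "(a, b) \<in> D" "\<And>q. q \<in> W \<Longrightarrow> b \<in> S q" "\<And>q. q \<in> W \<Longrightarrow> s q = frac q a b"
      using secE[OF V s(1) p] by metis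
    have pT: "p \<in> topspace T" using open_point[OF V p] .
    have "frac p a b \<in> numer p H" using s(2) p W by auto
    then obtain u where u: "u \<in> S p" "u \<otimes> a \<in> H" using numer_frac_iff[OF pT W(4) W(5)[OF W(2)] H] by auto
    define N where "N = W \<inter> {q \<in> topspace T. u \<in> S q}"
    have N: "openin T N" "p \<in> N" "N \<subseteq> V" using W u pT S_open by (auto simp: N_def)
    have "u \<otimes> b \<in> S q \<and> s q = frac q (u \<otimes> a) (u \<otimes> b)" if "q \<in> N" for q
    proof -
      have q: "q \<in> topspace T" "q \<in> W" "u \<in> S q" using that by (auto simp: N_def)
      show ?thesis using frac_cancel[OF q(1) W(4) W(5)[OF q(2)] q(3)] W(6)[OF q(2)] S_times[OF q(1,3) W(5)[OF q(2)]] by simp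
    qed
    moreover have "(u \<otimes> a, u \<otimes> b) \<in> D" using D_mult[OF D_diag[OF pT u(1)] W(4)] .
    ultimately show "\<exists>W a b. openin T W \<and> p \<in> W \<and> W \<subseteq> V \<and> (a, b) \<in> D \<and> a \<in> H \<and> (\<forall>q\<in>W. b \<in> S q \<and> s q = frac q a b)"
      using N by (intro exI[of _ N] exI[of _ "u \<otimes> a"] exI[of _ "u \<otimes> b"]) (simp add: u)
  qed
  ultimately show ?thesis using V by (auto simp: fract_ideal_sheaf_def)
qed

lemma J_not_open: "\<not> openin T V \<Longrightarrow> J H V = {}"
  by (simp add: fract_ideal_sheaf_def)

lemma J_ideal:
  assumes H: "ideal H A" and V: "openin T V"
  shows "ideal (J H V) (sec X V)"
proof (rule cring.ideal_criterion[OF sec_cring[OF V]])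
  show "J H V \<subseteq> carrier (sec X V)" using J_iff[OF H V] by auto
  show "\<zero>\<^bsub>sec X V\<^esub> \<in> J H V"
    using J_iff[OF H V] sec_const[OF V] numer_zero[OF open_point[OF V] H] by (simp add: sec_simps)
  show "s \<oplus>\<^bsub>sec X V\<^esub> t \<in> J H V" if "s \<in> J H V" "t \<in> J H V" for s t
    using that J_iff[OF H V] sec_closed(2)[OF V, of s t] numer_add[OF open_point[OF V] H] by (simp add: sec_simps)
  show "s \<otimes>\<^bsub>sec X V\<^esub> t \<in> J H V" if "s \<in> carrier (sec X V)" "t \<in> J H V" for s t
    using that J_iff[OF H V] sec_closed(1)[OF V, of s t] numer_mult[OF open_point[OF V] H] sec_value[OF V]
    by (simp add: sec_simps)
qed

lemma J_restrict:
  assumes H: "ideal H A" and "openin T U" "openin T V" "V \<subseteq> U" "s \<in> J H U"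
  shows "restrict s V \<in> J H V"
  using assms J_iff[OF H] restrict_sec[OF assms(2) _ assms(3,4)] by (auto simp: subset_iff)

lemma J_ideal_sheaf:
  assumes H: "ideal H A"
  shows "ideal_sheaf X (J H)"
proof -
  have "s \<in> J H U" if U: "openin T U" and s: "s \<in> carrier (sec X U)"
    and loc: "\<forall>x\<in>U. \<exists>W. openin T W \<and> x \<in> W \<and> W \<subseteq> U \<and> restrict s W \<in> J H W" for U s
  proof -
    have "s p \<in> numer p H" if "p \<in> U" for p
    proof -
      obtain W where W: "openin T W" "p \<in> W" "W \<subseteq> U" "restrict s W \<in> J H W" using loc \<open>p \<in> U\<close> by metis
      then have "restrict s W p \<in> numer p H" using J_iff[OF H W(1)] by blast
      then show ?thesis using W by simp
    qed
    then show ?thesis using J_iff[OF H U] s by simp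
  qed
  note glue = this
  show ?thesis
    unfolding ideal_sheaf_def topo_X
    by (intro conjI allI impI; (elim conjE)?) (rule J_ideal[OF H] J_restrict[OF H] J_not_open glue; assumption)+
qed

lemma J_eq_iff:
  assumes H: "ideal H A" and H': "ideal H' A"
  shows "J H = J H' \<longleftrightarrow> (\<forall>p\<in>topspace T. numer p H = numer p H')"
proof
  have sub: "numer p H \<subseteq> numer p H'" if p: "p \<in> topspace T" and eq: "J H = J H'" and H: "ideal H A" and H': "ideal H' A"
    for p H H'
  proof
    fix z assume z: "z \<in> numer p H"
    obtain V t a b where V: "openin T V" "p \<in> V" "t \<in> carrier (sec X V)" "t p = z" "(a, b) \<in> D" "a \<in> H"
    "\<And>q. q \<in> V \<Longrightarrow> b \<in> S q" "\<And>q. q \<in> V \<Longrightarrow> t q = frac q a b"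
      using germ_repr[OF p z] by metis
    have "t \<in> J H V" using J_iff[OF H V(1)] V by (simp add: numerI)
    then have "t \<in> J H' V" using eq by simp
    then show "z \<in> numer p H'" using J_iff[OF H' V(1)] V by auto
  qed
  show "\<forall>p\<in>topspace T. numer p H = numer p H'" if eq: "J H = J H'"
    using sub[OF _ eq H H'] sub[OF _ eq[symmetric] H' H] by blast
next
  assume eq: "\<forall>p\<in>topspace T. numer p H = numer p H'"
  show "J H = J H'"
  proof
    fix V show "J H V = J H' V"
    proof (cases "openin T V")
      case True
      then show ?thesis using J_iff[OF H True] J_iff[OF H' True] eq open_point[OF True] by blast
    qed (simp add: J_not_open)
  qed
qed

lemma stalk_ideal_eq:
  assumes p: "p \<in> topspace T" and H: "ideal H A"
  shows "stalk_ideal X (J H) p = germs p ` numer p H"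
proof (intro equalityI subsetI)
  fix x assume "x \<in> stalk_ideal X (J H) p"
  then obtain U s where U: "x = germ X p U s" "openin T U" "p \<in> U" "s \<in> J H U"
    by (auto simp: stalk_ideal_def)
  then show "x \<in> germs p ` numer p H" using J_iff[OF H U(2)] germ_eq[of U p s] by simp
next
  fix x assume "x \<in> germs p ` numer p H"
  then obtain z where z: "x = germs p z" "z \<in> numer p H" by auto
  obtain V t a b where V: "openin T V" "p \<in> V" "t \<in> carrier (sec X V)" "t p = z" "(a, b) \<in> D" "a \<in> H"
    "\<And>q. q \<in> V \<Longrightarrow> b \<in> S q" "\<And>q. q \<in> V \<Longrightarrow> t q = frac q a b"
    using germ_repr[OF p z(2)] by metis
  have "t \<in> J H V" using J_iff[OF H V(1)] V by (simp add: numerI)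
  moreover have "x = germ X p V t" using germ_eq[OF V(1-3)] z V(4) by simp
  ultimately show "x \<in> stalk_ideal X (J H) p"
    unfolding stalk_ideal_def topo_X using V(1,2) by blast
qed

lemma germs_mem_iff:
  assumes p: "p \<in> topspace T" and z: "z \<in> numer p (carrier A)" 
  shows "germs p z \<in> germs p ` numer p H \<longleftrightarrow> z \<in> numer p H"
  using germs_inj[OF p z] by auto

lemma stalk_ideal_ideal:
  assumes p: "p \<in> topspace T" and H: "ideal H A"
  shows "ideal (germs p ` numer p H) (stalk X p)"
proof (rule cring.ideal_criterion[OF stalk_cring[OF p]])
  show "germs p ` numer p H \<subseteq> carrier (stalk X p)" using stalk_carrier[OF p] numer_carrier by auto
  show "\<zero>\<^bsub>stalk X p\<^esub> \<in> germs p ` numer p H" using stalk_const[OF p] numer_zero[OF p H] by simp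
  show "x \<oplus>\<^bsub>stalk X p\<^esub> y \<in> germs p ` numer p H" if "x \<in> germs p ` numer p H" "y \<in> germs p ` numer p H" for x y
    using that stalk_ops(2)[OF p] numer_add[OF p H] numer_carrier by force
  show "x \<otimes>\<^bsub>stalk X p\<^esub> y \<in> germs p ` numer p H" if "x \<in> carrier (stalk X p)" "y \<in> germs p ` numer p H" for x y
    using that stalk_ops(1)[OF p] numer_mult[OF p H] numer_carrier stalk_carrier[OF p] by force
qed

text \<open>The nonunits \<open>c/d\<close> of the local ring are those with \<open>c \<notin> S p\<close>, and \<open>(c/d) (a/b)\<close> lies in the
  extension of \<open>H\<close> iff a denominator multiplies \<open>c a\<close> into \<open>H\<close>. So \<open>p\<close> is associated iff these
  two conditions on \<open>c\<close> agree for some \<open>a/b\<close>.\<close>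

lemma assoc_points_iff:
  assumes H: "ideal H A"
  shows "p \<in> assoc_points X (J H) \<longleftrightarrow> p \<in> topspace T \<and>
    (\<exists>a b. (a, b) \<in> D \<and> b \<in> S p \<and> (\<forall>c d. (c, d) \<in> D \<and> d \<in> S p \<longrightarrow> (c \<notin> S p \<longleftrightarrow> (\<exists>u\<in>S p. u \<otimes> (c \<otimes> a) \<in> H))))"
proof (cases "p \<in> topspace T")
  case p: True
  let ?R = "stalk X p"
  interpret R: cring ?R using stalk_cring[OF p] .
  let ?I = "germs p ` numer p H"
  have key: "germs p (frac p c d) \<notin> Units ?R \<longleftrightarrow> c \<notin> S p"
      "germs p (frac p c d) \<otimes>\<^bsub>?R\<^esub> germs p (frac p a b) \<in> ?I \<longleftrightarrow> (\<exists>u\<in>S p. u \<otimes> (c \<otimes> a) \<in> H)"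
    if ab: "(a, b) \<in> D" "b \<in> S p" and cd: "(c, d) \<in> D" "d \<in> S p" for a b c d
  proof -
    note l = frac_in_local[OF ab] frac_in_local[OF cd]
    show "germs p (frac p c d) \<notin> Units ?R \<longleftrightarrow> c \<notin> S p"
      using stalk_unit_iff[OF p l(2)] frac_unit_iff[OF p cd] by simp
    have "germs p (frac p c d) \<otimes>\<^bsub>?R\<^esub> germs p (frac p a b) = germs p (frac p (c \<otimes> a) (d \<otimes> b))"
      using stalk_ops(1)[OF p l(2,1)] Loc_mult[OF p cd ab] by simp
    then show "germs p (frac p c d) \<otimes>\<^bsub>?R\<^esub> germs p (frac p a b) \<in> ?I \<longleftrightarrow> (\<exists>u\<in>S p. u \<otimes> (c \<otimes> a) \<in> H)"
      using germs_mem_iff[OF p frac_in_local[OF D_mult[OF cd(1) ab(1)] S_times[OF p cd(2) ab(2)]], of H]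
        numer_frac_iff[OF p D_mult[OF cd(1) ab(1)] S_times[OF p cd(2) ab(2)] H] by simp
  qed
  have eq: "carrier ?R - Units ?R = {x \<in> carrier ?R. x \<otimes>\<^bsub>?R\<^esub> germs p (frac p a b) \<in> ?I} \<longleftrightarrow>
      (\<forall>c d. (c, d) \<in> D \<and> d \<in> S p \<longrightarrow> (c \<notin> S p \<longleftrightarrow> (\<exists>u\<in>S p. u \<otimes> (c \<otimes> a) \<in> H)))"
    if ab: "(a, b) \<in> D" "b \<in> S p" for a b
  proof -
    have "carrier ?R - Units ?R = {x \<in> carrier ?R. x \<otimes>\<^bsub>?R\<^esub> germs p (frac p a b) \<in> ?I} \<longleftrightarrow>
       (\<forall>x\<in>carrier ?R. x \<notin> Units ?R \<longleftrightarrow> x \<otimes>\<^bsub>?R\<^esub> germs p (frac p a b) \<in> ?I)" by blast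
    also have "\<dots> \<longleftrightarrow> (\<forall>c d. (c, d) \<in> D \<and> d \<in> S p \<longrightarrow> (germs p (frac p c d) \<notin> Units ?R \<longleftrightarrow>
         germs p (frac p c d) \<otimes>\<^bsub>?R\<^esub> germs p (frac p a b) \<in> ?I))"
    proof -
      have *: "(\<forall>x\<in>carrier ?R. P x) \<longleftrightarrow> (\<forall>c d. (c, d) \<in> D \<and> d \<in> S p \<longrightarrow> P (germs p (frac p c d)))" for P
        unfolding stalk_frac[OF p] by blast
      show ?thesis by (rule *)
    qed
    also have "\<dots> \<longleftrightarrow> (\<forall>c d. (c, d) \<in> D \<and> d \<in> S p \<longrightarrow> (c \<notin> S p \<longleftrightarrow> (\<exists>u\<in>S p. u \<otimes> (c \<otimes> a) \<in> H)))"
      using key[OF ab] by (metis (no_types, lifting))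
    finally show ?thesis .
  qed
  have "p \<in> assoc_points X (J H) \<longleftrightarrow>
      (\<exists>m\<in>carrier ?R. carrier ?R - Units ?R = {x \<in> carrier ?R. x \<otimes>\<^bsub>?R\<^esub> m \<in> ?I})"
    unfolding assoc_points_def using p R.nonunits_assoc_iff[OF stalk_ideal_ideal[OF p H]] stalk_ideal_eq[OF p H] by simp
  also have "\<dots> \<longleftrightarrow> (\<exists>a b. (a, b) \<in> D \<and> b \<in> S p \<and>
     carrier ?R - Units ?R = {x \<in> carrier ?R. x \<otimes>\<^bsub>?R\<^esub> germs p (frac p a b) \<in> ?I})"
  proof -
    have *: "(\<exists>x\<in>carrier ?R. P x) \<longleftrightarrow> (\<exists>a b. (a, b) \<in> D \<and> b \<in> S p \<and> P (germs p (frac p a b)))" for P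
      unfolding stalk_frac[OF p] by blast
    show ?thesis by (rule *)
  qed
  also have "\<dots> \<longleftrightarrow> (\<exists>a b. (a, b) \<in> D \<and> b \<in> S p \<and>
      (\<forall>c d. (c, d) \<in> D \<and> d \<in> S p \<longrightarrow> (c \<notin> S p \<longleftrightarrow> (\<exists>u\<in>S p. u \<otimes> (c \<otimes> a) \<in> H))))"
    using eq by (metis (no_types, lifting))
  finally show ?thesis using p by simp
qed (simp add: assoc_points_def)

text \<open>The stalk of the ideal sheaf is the whole local ring iff it contains \<open>1\<close>, that is, iff some
  denominator lies in \<open>H\<close>.\<close>

lemma subscheme_supp_iff:
  assumes H: "ideal H A"
  shows "p \<in> subscheme_supp X (J H) \<longleftrightarrow> p \<in> topspace T \<and> H \<inter> S p = {}"
proof (cases "p \<in> topspace T")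
  case p: True
  interpret L: cring "local_ring p" using local_cring[OF p] .
  interpret I: ideal "numer p H" "local_ring p" using numer_ideal[OF p H] .
  have inj: "inj_on (germs p) (numer p (carrier A))"
    by (rule inj_onI) (rule germs_inj[OF p])
  have sub: "numer p H \<subseteq> numer p (carrier A)" using numer_carrier by (rule subsetI)
  have "stalk_ideal X (J H) p = carrier (stalk X p) \<longleftrightarrow> numer p H = numer p (carrier A)"
    unfolding stalk_ideal_eq[OF p H] stalk_carrier[OF p] by (rule inj_on_image_eq_iff[OF inj sub subset_refl])
  also have "\<dots> \<longleftrightarrow> frac p \<one> \<one> \<in> numer p H"
    using I.one_imp_carrier numer_one[OF p] Loc_const[OF p] by auto
  also have "\<dots> \<longleftrightarrow> (\<exists>u\<in>S p. u \<otimes> \<one> \<in> H)"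
    using numer_frac_iff[OF p D_one S_1[OF p] H] .
  also have "\<dots> \<longleftrightarrow> H \<inter> S p \<noteq> {}"
    using S_carr[OF p] by (auto simp: disjoint_iff)
  finally show ?thesis using p by (simp add: subscheme_supp_def)
qed (simp add: subscheme_supp_def)

subsection \<open>Generated ideal sheaves and closed subschemes\<close>

lemma gen_ideal_sheaf_subset:
  assumes H: "ideal H A"
    and gen: "\<And>V g W. \<lbrakk>(V, g) \<in> E; openin T W; W \<subseteq> V\<rbrakk> \<Longrightarrow> restrict g W \<in> J H W"
  shows "gen_ideal_sheaf X E U \<subseteq> J H U"
proof (cases "openin T U")
  case U: True
  show ?thesis
  proof
    fix s assume s: "s \<in> gen_ideal_sheaf X E U"
    then have sU: "s \<in> carrier (sec X U)" using U by (simp add: gen_ideal_sheaf_def)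
    have "s p \<in> numer p H" if "p \<in> U" for p
    proof -
      obtain W where W: "openin T W" "p \<in> W" "W \<subseteq> U"
        "restrict s W \<in> Idl\<^bsub>sec X W\<^esub> {restrict g W | V g. (V, g) \<in> E \<and> W \<subseteq> V}"
        using s U \<open>p \<in> U\<close> unfolding gen_ideal_sheaf_def by auto
      interpret C: cring "sec X W" using sec_cring[OF W(1)] .
      have "{restrict g W | V g. (V, g) \<in> E \<and> W \<subseteq> V} \<subseteq> J H W" using gen W(1) by blast
      then have "restrict s W \<in> J H W" using C.genideal_minimal[OF J_ideal[OF H W(1)]] W(4) by blast
      then have "restrict s W p \<in> numer p H" using J_iff[OF H W(1)] W(2) by blast
      then show ?thesis using W(2) by simp
    qed
    then show "s \<in> J H U" using J_iff[OF H U] sU by simp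
  qed
qed (simp add: gen_ideal_sheaf_def)

lemma gen_ideal_sheafI:
  assumes U: "openin T U" and s: "s \<in> carrier (sec X U)"
    and gen: "\<And>V g W. \<lbrakk>(V, g) \<in> E; openin T W; W \<subseteq> V\<rbrakk> \<Longrightarrow> restrict g W \<in> carrier (sec X W)"
    and loc: "\<And>p. p \<in> U \<Longrightarrow> \<exists>W V g e. openin T W \<and> p \<in> W \<and> W \<subseteq> U \<inter> V \<and> (V, g) \<in> E \<and>
       e \<in> carrier (sec X W) \<and> (\<forall>q\<in>W. s q = e q \<otimes>\<^bsub>Loc q\<^esub> g q)"
  shows "s \<in> gen_ideal_sheaf X E U"
proof -
  have "\<exists>W. openin T W \<and> p \<in> W \<and> W \<subseteq> U \<and>
     restrict s W \<in> Idl\<^bsub>sec X W\<^esub> {restrict g W | V g. (V, g) \<in> E \<and> W \<subseteq> V}" if "p \<in> U" for p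
  proof -
    obtain W V g e where W: "openin T W" "p \<in> W" "W \<subseteq> U \<inter> V" "(V, g) \<in> E"
       "e \<in> carrier (sec X W)" "\<forall>q\<in>W. s q = e q \<otimes>\<^bsub>Loc q\<^esub> g q" using loc[OF \<open>p \<in> U\<close>] by metis
    interpret C: cring "sec X W" using sec_cring[OF W(1)] .
    let ?E = "{restrict g W | V g. (V, g) \<in> E \<and> W \<subseteq> V}"
    have E: "?E \<subseteq> carrier (sec X W)" using gen W(1) by blast
    interpret I: ideal "Idl\<^bsub>sec X W\<^esub> ?E" "sec X W" using C.genideal_ideal[OF E] .
    have "restrict g W \<in> ?E" using W by blast
    then have "restrict g W \<in> Idl\<^bsub>sec X W\<^esub> ?E" using C.genideal_self[OF E] by blast
    then have "e \<otimes>\<^bsub>sec X W\<^esub> restrict g W \<in> Idl\<^bsub>sec X W\<^esub> ?E" using I.I_l_closed W(5) by blast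
    moreover have "e \<otimes>\<^bsub>sec X W\<^esub> restrict g W = restrict s W"
      using W(6) by (simp add: sec_simps cong: restrict_cong)
    ultimately show ?thesis using W by auto
  qed
  then show ?thesis using U s by (simp add: gen_ideal_sheaf_def)
qed

text \<open>On an open set \<open>U\<close> as in the assumption, the sections \<open>a/d\<close> generate the ideal sheaf, because
  \<open>a/b = (d/b) (a/d)\<close>.\<close>

lemma J_closed_subscheme:
  assumes H: "ideal H A"
    and cover: "\<And>p. p \<in> topspace T \<Longrightarrow> \<exists>U. openin T U \<and> p \<in> U \<and>
      (\<forall>a b. (a, b) \<in> D \<and> a \<in> H \<longrightarrow> (\<exists>d. (a, d) \<in> D \<and> (d, b) \<in> D \<and> (\<forall>q\<in>U. d \<in> S q)))"
  shows "closed_subscheme X (J H)"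
proof -
  have "\<exists>U. openin T U \<and> p \<in> U \<and>
      (\<forall>V. openin T V \<and> V \<subseteq> U \<longrightarrow> J H V = gen_ideal_sheaf X {(U, g) | g. g \<in> J H U} V)" if "p \<in> topspace T" for p
  proof -
    obtain U where U: "openin T U" "p \<in> U"
      and D: "\<forall>a b. (a, b) \<in> D \<and> a \<in> H \<longrightarrow> (\<exists>d. (a, d) \<in> D \<and> (d, b) \<in> D \<and> (\<forall>q\<in>U. d \<in> S q))"
      using cover[OF \<open>p \<in> topspace T\<close>] by metis
    let ?E = "{(U, g) | g. g \<in> J H U}"
    have E: "restrict g W \<in> J H W" if "(V, g) \<in> ?E" "openin T W" "W \<subseteq> V" for V g W
      using J_restrict[OF H U(1)] that by auto
    have "J H V \<subseteq> gen_ideal_sheaf X ?E V" if V: "openin T V" "V \<subseteq> U" for V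
    proof
      fix s assume s: "s \<in> J H V"
      then have sV: "s \<in> carrier (sec X V)" using J_iff[OF H V(1)] by blast
      have lf: "local_fract A T S {(a, b) \<in> D. a \<in> H} V s" using s V by (simp add: fract_ideal_sheaf_def)
      show "s \<in> gen_ideal_sheaf X ?E V"
      proof (rule gen_ideal_sheafI[OF V(1) sV])
        show "restrict g W \<in> carrier (sec X W)" if "(V, g) \<in> ?E" "openin T W" "W \<subseteq> V" for V g W
          using E[OF that] J_iff[OF H that(2)] by blast
        fix p assume "p \<in> V"
        then obtain W a b where W: "openin T W" "p \<in> W" "W \<subseteq> V" "(a, b) \<in> D" "a \<in> H" "\<forall>q\<in>W. b \<in> S q \<and> s q = frac q a b"
          using lf unfolding local_fract_numer_iff by metis
        note ab = W(4,5)
        obtain d where d: "(a, d) \<in> D" "(d, b) \<in> D" "\<And>q. q \<in> U \<Longrightarrow> d \<in> S q" using D ab by metis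
        let ?g = "\<lambda>q\<in>U. frac q a d" and ?e = "\<lambda>q\<in>W. frac q d b"
        have g: "?g \<in> J H U" using frac_sec[OF d(1) U(1) d(3)] J_iff[OF H U(1)] d ab by (simp add: numerI)
        have e: "?e \<in> carrier (sec X W)" using frac_sec[OF d(2) W(1)] W(6) by simp
        have "s q = ?e q \<otimes>\<^bsub>Loc q\<^esub> ?g q" if q: "q \<in> W" for q
        proof -
          have q': "q \<in> U" "q \<in> topspace T" "b \<in> S q" "d \<in> S q" using q W V d open_point by auto
          have cl: "a \<in> carrier A" "b \<in> carrier A" "d \<in> carrier A" using D_closed[OF d(1)] D_closed[OF d(2)] by auto
          have "frac q d b \<otimes>\<^bsub>Loc q\<^esub> frac q a d = frac q (d \<otimes> a) (d \<otimes> b)"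
            using Loc_mult[OF q'(2) d(2) q'(3) d(1) q'(4)] m_comm[OF cl(2,3)] by simp
          also have "\<dots> = frac q a b" using frac_cancel[OF q'(2) ab(1) q'(3,4)] .
          finally show ?thesis using q q' W by simp
        qed
        then show "\<exists>W Va g e. openin T W \<and> p \<in> W \<and> W \<subseteq> V \<inter> Va \<and> (Va, g) \<in> ?E \<and> e \<in> carrier (sec X W) \<and>
            (\<forall>q\<in>W. s q = e q \<otimes>\<^bsub>Loc q\<^esub> g q)"
          using W V g e by (intro exI[of _ W] exI[of _ U] exI[of _ ?g] exI[of _ ?e]) auto
      qed
    qed
    moreover have "gen_ideal_sheaf X ?E V \<subseteq> J H V" for V
      by (rule gen_ideal_sheaf_subset[OF H E])
    ultimately have "\<forall>V. openin T V \<and> V \<subseteq> U \<longrightarrow> J H V = gen_ideal_sheaf X ?E V"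
      by (intro allI impI equalityI) simp_all
    with U show ?thesis by (intro exI[of _ U] conjI)
  qed
  then show ?thesis unfolding closed_subscheme_def topo_X using J_ideal_sheaf[OF H] by simp
qed

end

section \<open>Graded rings and the Zariski topology\<close>

lemma (in cring) prime_mult_iff:
  assumes "primeideal P R" "x \<in> carrier R" "y \<in> carrier R"
  shows "x \<otimes> y \<in> P \<longleftrightarrow> x \<in> P \<or> y \<in> P"
proof -
  interpret P: primeideal P R by fact
  show ?thesis using P.I_prime P.I_l_closed P.I_r_closed assms by blast
qed

text \<open>Spec is the case of all primes and all elements, Proj that of the relevant homogeneous primes
  and the homogeneous elements.\<close>

lemma (in cring) istopology_zariski:
  assumes prime: "\<And>P. P \<in> Q \<Longrightarrow> primeideal P R"
    and M: "\<And>x. x \<in> M \<Longrightarrow> x \<in> carrier R" "\<And>x y. x \<in> M \<Longrightarrow> y \<in> M \<Longrightarrow> x \<otimes> y \<in> M"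
  shows "istopology (\<lambda>U. \<exists>E\<subseteq>M. U = {P \<in> Q. \<not> E \<subseteq> P})"
  unfolding istopology_def
proof (intro conjI allI impI)
  fix U V assume U: "\<exists>E\<subseteq>M. U = {P \<in> Q. \<not> E \<subseteq> P}" and V: "\<exists>E\<subseteq>M. V = {P \<in> Q. \<not> E \<subseteq> P}"
  obtain E where "E \<subseteq> M \<and> U = {P \<in> Q. \<not> E \<subseteq> P}" using U by (rule exE)
  then have E: "E \<subseteq> M" "U = {P \<in> Q. \<not> E \<subseteq> P}" by simp_all
  obtain F where "F \<subseteq> M \<and> V = {P \<in> Q. \<not> F \<subseteq> P}" using V by (rule exE)
  then have F: "F \<subseteq> M" "V = {P \<in> Q. \<not> F \<subseteq> P}" by simp_all
  let ?EF = "{e \<otimes> f | e f. e \<in> E \<and> f \<in> F}"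
  have "\<not> ?EF \<subseteq> P \<longleftrightarrow> \<not> E \<subseteq> P \<and> \<not> F \<subseteq> P" if P: "P \<in> Q" for P
  proof -
    have "e \<otimes> f \<in> P \<longleftrightarrow> e \<in> P \<or> f \<in> P" if "e \<in> E" "f \<in> F" for e f
      by (rule prime_mult_iff[OF prime[OF P]]) (use that E(1) F(1) M(1) in auto)
    then show ?thesis by blast
  qed
  then have "U \<inter> V = {P \<in> Q. \<not> ?EF \<subseteq> P}" unfolding E(2) F(2) by blast
  moreover have "?EF \<subseteq> M" using M(2) E(1) F(1) by blast
  ultimately show "\<exists>E\<subseteq>M. U \<inter> V = {P \<in> Q. \<not> E \<subseteq> P}" by (intro exI[of _ ?EF] conjI)
next
  fix K assume K: "\<forall>U\<in>K. \<exists>E\<subseteq>M. U = {P \<in> Q. \<not> E \<subseteq> P}"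
  let ?E = "\<Union>{E. E \<subseteq> M \<and> {P \<in> Q. \<not> E \<subseteq> P} \<in> K}"
  have "\<Union>K = {P \<in> Q. \<not> ?E \<subseteq> P}"
  proof (intro equalityI subsetI)
    fix P assume "P \<in> \<Union>K"
    then obtain U where U: "U \<in> K" "P \<in> U" by (rule UnionE)
    have "\<exists>E\<subseteq>M. U = {P \<in> Q. \<not> E \<subseteq> P}" using K U(1) by (rule bspec)
    then obtain E where "E \<subseteq> M \<and> U = {P \<in> Q. \<not> E \<subseteq> P}" by (rule exE)
    then show "P \<in> {P \<in> Q. \<not> ?E \<subseteq> P}" using U by blast
  next
    fix P assume "P \<in> {P \<in> Q. \<not> ?E \<subseteq> P}"
    then obtain E where "E \<subseteq> M" "{P \<in> Q. \<not> E \<subseteq> P} \<in> K" "\<not> E \<subseteq> P" "P \<in> Q" by blast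
    then show "P \<in> \<Union>K" by blast
  qed
  moreover have "?E \<subseteq> M" by blast
  ultimately show "\<exists>E\<subseteq>M. \<Union>K = {P \<in> Q. \<not> E \<subseteq> P}" by (intro exI[of _ ?E] conjI)
qed

text \<open>The component maps are part of the data. That every element is the sum of its components is
  expressed by an induction principle (\<open>cmp_span\<close>) instead of a finite sum: whatever contains the
  components and is closed under addition contains the element.\<close>

locale graded_ring = cring B for B :: "('b, 'm) ring_scheme" (structure) +
  fixes G :: "nat \<Rightarrow> 'b set" and cmp :: "nat \<Rightarrow> 'b \<Rightarrow> 'b"
  assumes G_carrier: "x \<in> G n \<Longrightarrow> x \<in> carrier B"
    and cmp_in: "x \<in> carrier B \<Longrightarrow> cmp n x \<in> G n"
    and cmp_same: "x \<in> G n \<Longrightarrow> cmp n x = x"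
    and cmp_other: "\<lbrakk>x \<in> G n; m \<noteq> n\<rbrakk> \<Longrightarrow> cmp m x = \<zero>"
    and cmp_add: "\<lbrakk>x \<in> carrier B; y \<in> carrier B\<rbrakk> \<Longrightarrow> cmp n (x \<oplus> y) = cmp n x \<oplus> cmp n y"
    and cmp_mult: "\<lbrakk>r \<in> carrier B; y \<in> G j\<rbrakk> \<Longrightarrow> cmp k (r \<otimes> y) = (if j \<le> k then cmp (k - j) r \<otimes> y else \<zero>)"
    and cmp_span: "\<lbrakk>x \<in> carrier B; \<zero> \<in> M; \<And>a b. \<lbrakk>a \<in> M; b \<in> M\<rbrakk> \<Longrightarrow> a \<oplus> b \<in> M; \<And>n. cmp n x \<in> M\<rbrakk> \<Longrightarrow> x \<in> M"
    and one_G: "\<one> \<in> G 0"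
begin

abbreviation D where "D \<equiv> same_degree_pairs G"

lemma cmp_closed [simp]: "x \<in> carrier B \<Longrightarrow> cmp n x \<in> carrier B"
  using cmp_in G_carrier by blast

lemma cmp_zero [simp]: "cmp n \<zero> = \<zero>"
proof -
  have "cmp n \<zero> \<oplus> cmp n \<zero> = cmp n \<zero>" using cmp_add[of \<zero> \<zero> n] by simp
  then show ?thesis using add.l_cancel_one[of "cmp n \<zero>" "cmp n \<zero>"] by simp
qed

lemma zero_G: "\<zero> \<in> G n"
  using cmp_in[of \<zero> n] by simp

lemma add_G: "x \<in> G n \<Longrightarrow> y \<in> G n \<Longrightarrow> x \<oplus> y \<in> G n"
  using cmp_in[of "x \<oplus> y" n] cmp_add[of x y n] cmp_same G_carrier by simp

lemma uminus_G:
  assumes "x \<in> G n" shows "\<ominus> x \<in> G n"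
proof -
  have x: "x \<in> carrier B" using assms G_carrier by blast
  have "cmp n (\<ominus> x) \<oplus> x = \<zero>" using cmp_add[of "\<ominus> x" x n] cmp_same[OF assms] x by (simp add: l_neg)
  then have "\<ominus> x = cmp n (\<ominus> x)" using x by (intro minus_equality) simp_all
  then show ?thesis using cmp_in[of "\<ominus> x" n] x by simp
qed

lemma mult_G:
  assumes "x \<in> G m" "y \<in> G n" shows "x \<otimes> y \<in> G (m + n)"
proof -
  have "cmp (m + n) (x \<otimes> y) = x \<otimes> y" using cmp_mult[of x y n "m + n"] assms G_carrier cmp_same by simp
  then show ?thesis using cmp_in[of "x \<otimes> y" "m + n"] assms G_carrier by simp
qed

lemma pow_G: "x \<in> G n \<Longrightarrow> x [^] (k::nat) \<in> G (k * n)"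
proof (induction k)
  case (Suc k)
  then have "x [^] k \<otimes> x \<in> G (k * n + n)" using mult_G by blast
  then show ?case by (simp add: add.commute)
qed (simp add: one_G)

lemma homogI: "x \<in> G n \<Longrightarrow> x \<in> homog G"
  by (auto simp: homog_def)

lemma homogE:
  assumes "x \<in> homog G" obtains n where "x \<in> G n"
  using assms by (auto simp: homog_def)

lemma homog_carrier: "x \<in> homog G \<Longrightarrow> x \<in> carrier B"
  using G_carrier by (auto simp: homog_def)

lemma homog_mult: "x \<in> homog G \<Longrightarrow> y \<in> homog G \<Longrightarrow> x \<otimes> y \<in> homog G"
  by (metis homogE homogI mult_G)

lemma homogeneous_ideal_iff:
  "homogeneous_ideal B G H \<longleftrightarrow> ideal H B \<and> (\<forall>x\<in>H. \<forall>n. cmp n x \<in> H)"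
proof
  assume hom: "homogeneous_ideal B G H"
  then have H: "ideal H B" and eq: "H = Idl (H \<inter> homog G)" by (auto simp: homogeneous_ideal_def)
  interpret H: ideal H B by fact
  let ?K = "{x \<in> carrier B. \<forall>n. cmp n x \<in> H}"
  have "ideal ?K B"
  proof (rule ideal_criterion)
    fix r x assume r: "r \<in> carrier B" and x: "x \<in> ?K"
    have "\<forall>k. cmp k (x \<otimes> r) \<in> H"
    proof (rule cmp_span[of r "{r \<in> carrier B. \<forall>k. cmp k (x \<otimes> r) \<in> H}", THEN CollectD, THEN conjunct2])
      show "cmp n r \<in> {r \<in> carrier B. \<forall>k. cmp k (x \<otimes> r) \<in> H}" for n
      proof (intro CollectI conjI allI)
        fix k
        have "cmp (k - n) x \<otimes> cmp n r \<in> H" using H.I_r_closed x r by auto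
        then show "cmp k (x \<otimes> cmp n r) \<in> H"
          using cmp_mult[OF _ cmp_in[OF r], of x k n] x H.zero_closed by auto
      qed (use r in auto)
    qed (use r x in \<open>auto simp: r_distr cmp_add H.a_closed\<close>)
    then show "r \<otimes> x \<in> ?K" using r x m_comm[of x r] by auto
  qed (auto simp: cmp_add H.a_closed)
  moreover have "H \<inter> homog G \<subseteq> ?K"
  proof
    fix x assume x: "x \<in> H \<inter> homog G"
    then obtain n where n: "x \<in> G n" by (auto elim: homogE)
    then have "cmp m x \<in> H" for m using x cmp_same[OF n] cmp_other[OF n, of m] H.zero_closed by (cases "m = n") auto
    then show "x \<in> ?K" using n G_carrier by auto
  qed
  ultimately have "H \<subseteq> ?K" using genideal_minimal[of ?K "H \<inter> homog G"] eq by simp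
  then show "ideal H B \<and> (\<forall>x\<in>H. \<forall>n. cmp n x \<in> H)" using H by auto
next
  assume *: "ideal H B \<and> (\<forall>x\<in>H. \<forall>n. cmp n x \<in> H)"
  then interpret H: ideal H B by blast
  have sub: "H \<inter> homog G \<subseteq> carrier B" using H.Icarr by auto
  interpret I: ideal "Idl (H \<inter> homog G)" B using genideal_ideal[OF sub] .
  have "x \<in> Idl (H \<inter> homog G)" if x: "x \<in> H" for x
  proof (rule cmp_span[of x])
    show "cmp n x \<in> Idl (H \<inter> homog G)" for n
      using genideal_self[OF sub] * x cmp_in[OF H.Icarr[OF x]] homogI by blast
  qed (use x H.Icarr in auto)
  moreover have "Idl (H \<inter> homog G) \<subseteq> H" using genideal_minimal[of H] * by blast
  ultimately show "homogeneous_ideal B G H" using * by (auto simp: homogeneous_ideal_def)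
qed

text \<open>If \<open>r, s \<notin> P\<close>, compare the product of their lowest components outside \<open>P\<close> with the
  component of \<open>r s\<close> in that degree: the other contributions to it lie in \<open>P\<close>.\<close>

lemma homogeneous_primeI:
  assumes P: "ideal P B" "\<And>x n. x \<in> P \<Longrightarrow> cmp n x \<in> P" "P \<noteq> carrier B"
    and prime: "\<And>r s. \<lbrakk>r \<in> homog G; s \<in> homog G; r \<otimes> s \<in> P\<rbrakk> \<Longrightarrow> r \<in> P \<or> s \<in> P"
  shows "primeideal P B"
proof (rule primeidealI)
  show "carrier B \<noteq> P" using P(3) by simp
  interpret P: ideal P B by fact
  fix r s assume r: "r \<in> carrier B" and s: "s \<in> carrier B" and rs: "r \<otimes> s \<in> P"
  show "r \<in> P \<or> s \<in> P"
  proof (rule ccontr)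
    assume "\<not> (r \<in> P \<or> s \<in> P)"
    then have "\<exists>i. cmp i r \<notin> P" "\<exists>i. cmp i s \<notin> P"
      using cmp_span[OF r, of P] cmp_span[OF s, of P] by auto
    define m where "m = (LEAST i. cmp i r \<notin> P)"
    define n where "n = (LEAST i. cmp i s \<notin> P)"
    have m: "cmp m r \<notin> P" "\<And>i. i < m \<Longrightarrow> cmp i r \<in> P"
      unfolding m_def using LeastI_ex[OF \<open>\<exists>i. cmp i r \<notin> P\<close>] not_less_Least by blast+
    have n: "cmp n s \<notin> P" "\<And>i. i < n \<Longrightarrow> cmp i s \<in> P"
      unfolding n_def using LeastI_ex[OF \<open>\<exists>i. cmp i s \<notin> P\<close>] not_less_Least by blast+
    let ?f = "\<lambda>y. cmp (m + n) (r \<otimes> y) \<ominus> cmp m r \<otimes> cmp n y"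
    have "s \<in> {y \<in> carrier B. ?f y \<in> P}"
    proof (rule cmp_span[OF s])
      show "\<zero> \<in> {y \<in> carrier B. ?f y \<in> P}" using r by (simp add: minus_eq)
      show "a \<oplus> b \<in> {y \<in> carrier B. ?f y \<in> P}"
        if "a \<in> {y \<in> carrier B. ?f y \<in> P}" "b \<in> {y \<in> carrier B. ?f y \<in> P}" for a b
      proof -
        have c: "cmp (m + n) (r \<otimes> a) \<in> carrier B" "cmp (m + n) (r \<otimes> b) \<in> carrier B" "cmp m r \<in> carrier B"
          "cmp n a \<in> carrier B" "cmp n b \<in> carrier B" using that r by auto
        have "?f (a \<oplus> b) = (cmp (m + n) (r \<otimes> a) \<oplus> cmp (m + n) (r \<otimes> b)) \<ominus> cmp m r \<otimes> (cmp n a \<oplus> cmp n b)"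
          using that r by (simp add: r_distr cmp_add)
        also have "\<dots> = ?f a \<oplus> ?f b" using c by algebra
        finally show ?thesis using that P.a_closed by simp
      qed
      fix j
      have sj: "cmp j s \<in> G j" "cmp j s \<in> carrier B" using cmp_in[OF s] s by auto
      have "?f (cmp j s) \<in> P"
      proof (cases j n rule: linorder_cases)
        case less
        have "r \<otimes> cmp j s \<in> P" using P.I_l_closed[OF n(2)[OF less] r] .
        then show ?thesis using cmp_other[OF sj(1), of n] less P(2) r by (simp add: minus_eq P.Icarr)
      next
        case equal
        then have "?f (cmp j s) = \<zero>" using cmp_mult[OF r sj(1), of "m + n"] cmp_same[OF sj(1)] r s by (simp add: r_neg minus_eq)
        then show ?thesis by simp
      next
        case greater
        have "cmp (m + n) (r \<otimes> cmp j s) \<in> P"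
          using cmp_mult[OF r sj(1), of "m + n"] m(2)[of "m + n - j"] greater P.I_r_closed sj(2) by auto
        then show ?thesis using cmp_other[OF sj(1), of n] greater r by (simp add: minus_eq P.Icarr)
      qed
      then show "cmp j s \<in> {y \<in> carrier B. ?f y \<in> P}" using sj by simp
    qed
    then have f: "?f s \<in> P" by simp
    have c: "cmp (m + n) (r \<otimes> s) \<in> carrier B" "cmp m r \<in> carrier B" "cmp n s \<in> carrier B" using r s by auto
    have "cmp m r \<otimes> cmp n s = cmp (m + n) (r \<otimes> s) \<oplus> \<ominus> (?f s)" using c by algebra
    also have "\<dots> \<in> P" using P.a_closed P.a_inv_closed f P(2)[OF rs] by blast
    finally have "cmp m r \<in> P \<or> cmp n s \<in> P" using prime homogI[OF cmp_in[OF r]] homogI[OF cmp_in[OF s]] by blast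
    then show False using m n by blast
  qed
qed (use P is_cring in auto)

subsection \<open>The Zariski topology on Proj\<close>

lemma proj_prime: "P \<in> proj_points B G \<Longrightarrow> primeideal P B"
  by (simp add: proj_points_def)

lemma proj_mult_iff:
  "\<lbrakk>P \<in> proj_points B G; x \<in> carrier B; y \<in> carrier B\<rbrakk> \<Longrightarrow> x \<otimes> y \<in> P \<longleftrightarrow> x \<in> P \<or> y \<in> P"
  by (rule prime_mult_iff[OF proj_prime])

lemma proj_one: "P \<in> proj_points B G \<Longrightarrow> \<one> \<notin> P"
  using proj_prime ideal.one_imp_carrier primeideal.axioms(1) primeideal.I_notcarr by metis

lemma proj_pow_notin:
  assumes "P \<in> proj_points B G" "x \<in> carrier B" "x \<notin> P"
  shows "x [^] (n::nat) \<notin> P"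
  using assms by (induction n) (auto simp: proj_one proj_mult_iff)

lemma openin_proj_iff:
  "openin (zariski_proj B G) U \<longleftrightarrow> (\<exists>E\<subseteq>homog G. U = {P \<in> proj_points B G. \<not> E \<subseteq> P})"
proof -
  have "istopology (\<lambda>U. \<exists>E\<subseteq>homog G. U = {P \<in> proj_points B G. \<not> E \<subseteq> P})"
    by (rule istopology_zariski) (use proj_prime homog_carrier homog_mult in auto)
  then show ?thesis unfolding zariski_proj_def by (simp add: topology_inverse')
qed

lemma topspace_proj [simp]: "topspace (zariski_proj B G) = proj_points B G"
proof
  show "topspace (zariski_proj B G) \<subseteq> proj_points B G"
    using openin_topspace[of "zariski_proj B G"] unfolding openin_proj_iff by blast
  have "proj_points B G = {P \<in> proj_points B G. \<not> {\<one>} \<subseteq> P}" using proj_one by blast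
  moreover have "{\<one>} \<subseteq> homog G" using homogI[OF one_G] by simp
  ultimately have "openin (zariski_proj B G) (proj_points B G)" unfolding openin_proj_iff by blast
  then show "proj_points B G \<subseteq> topspace (zariski_proj B G)" by (rule openin_subset)
qed

lemma openin_proj_basic: "g \<in> homog G \<Longrightarrow> openin (zariski_proj B G) {q \<in> proj_points B G. g \<notin> q}"
  unfolding openin_proj_iff by (intro exI[of _ "{g}"]) auto

lemma proj_basis:
  assumes "openin (zariski_proj B G) U" "p \<in> U"
  obtains g where "g \<in> homog G" "g \<notin> p" "{q \<in> proj_points B G. g \<notin> q} \<subseteq> U"
proof -
  obtain E where E: "E \<subseteq> homog G" "U = {P \<in> proj_points B G. \<not> E \<subseteq> P}"
    using assms(1) unfolding openin_proj_iff by (elim exE conjE) (rule that)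
  then obtain g where g: "g \<in> E" "g \<notin> p" using assms(2) by blast
  show thesis by (rule that[of g]) (use E g in auto)
qed

end

sublocale graded_ring \<subseteq> proj: fract_site B "zariski_proj B G" "\<lambda>P. homog G - P" D
proof (intro fract_site.intro is_cring fract_site_axioms.intro)
  fix p assume "p \<in> topspace (zariski_proj B G)"
  then have p: "p \<in> proj_points B G" by simp
  show "mult_set B (homog G - p)"
  proof unfold_locales
    show "homog G - p \<subseteq> carrier B" using homog_carrier by auto
    show "\<one> \<in> homog G - p" using proj_one[OF p] homogI[OF one_G] by simp
    show "u \<otimes> v \<in> homog G - p" if "u \<in> homog G - p" "v \<in> homog G - p" for u v
      using that proj_mult_iff[OF p, of u v] homog_mult[of u v] homog_carrier by auto
  qed
  show "(u, u) \<in> D" if "u \<in> homog G - p" for u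
    using that by (auto simp: homog_def same_degree_pairs_def)
  show "a \<in> homog G - p" if "(a, b) \<in> D" "c \<in> carrier B" "a \<otimes> c \<in> homog G - p" for a b c
    using that proj_mult_iff[OF p, of a c] G_carrier by (auto simp: homog_def same_degree_pairs_def)
next
  fix u
  show "openin (zariski_proj B G) {q \<in> topspace (zariski_proj B G). u \<in> homog G - q}"
    using openin_proj_basic[of u] by (cases "u \<in> homog G") auto
next
  fix a b c d assume "(a, b) \<in> D" "(c, d) \<in> D"
  then obtain m n where m: "a \<in> G m" "b \<in> G m" "c \<in> G n" "d \<in> G n" by (auto simp: same_degree_pairs_def)
  show "(a \<otimes> c, b \<otimes> d) \<in> D"
    using mult_G[OF m(1,3)] mult_G[OF m(2,4)] unfolding same_degree_pairs_def by blast
  have "c \<otimes> b \<in> G (m + n)" using mult_G[OF m(3,2)] by (simp add: add.commute)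
  then show "(a \<otimes> d \<oplus> c \<otimes> b, b \<otimes> d) \<in> D"
    using add_G[OF mult_G[OF m(1,4)]] mult_G[OF m(2,4)] unfolding same_degree_pairs_def by blast
qed (use one_G zero_G uminus_G G_carrier in \<open>auto simp: same_degree_pairs_def\<close>)

section \<open>Saturation and scheme-theoretic closure in Proj\<close>

lemma ideal_sheafD:
  assumes "ideal_sheaf X J"
  shows "openin (topo X) U \<Longrightarrow> ideal (J U) (sec X U)"
    and "\<lbrakk>openin (topo X) U; openin (topo X) V; V \<subseteq> U; s \<in> J U\<rbrakk> \<Longrightarrow> restrict s V \<in> J V"
    and "\<not> openin (topo X) U \<Longrightarrow> J U = {}"
proof -
  note * = assms[unfolded ideal_sheaf_def]
  show "openin (topo X) U \<Longrightarrow> ideal (J U) (sec X U)"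
    by (rule *[THEN conjunct1, rule_format])
  show "\<lbrakk>openin (topo X) U; openin (topo X) V; V \<subseteq> U; s \<in> J U\<rbrakk> \<Longrightarrow> restrict s V \<in> J V"
    by (rule *[THEN conjunct2, THEN conjunct1, rule_format]) (intro conjI; assumption)+
  show "\<not> openin (topo X) U \<Longrightarrow> J U = {}"
    by (rule *[THEN conjunct2, THEN conjunct2, THEN conjunct2, rule_format])
qed

context graded_ring
begin

definition saturation where
  "saturation H E = {x \<in> carrier B. \<forall>h\<in>E. \<exists>n::nat. h [^] n \<otimes> x \<in> H}"

lemma saturation_ideal:
  assumes H: "ideal H B" and E: "E \<subseteq> carrier B"
  shows "ideal (saturation H E) B"
proof (rule ideal_criterion)
  interpret H: ideal H B by fact
  show "saturation H E \<subseteq> carrier B" by (auto simp: saturation_def)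
  show "\<zero> \<in> saturation H E" using E by (auto simp: saturation_def)
  show "x \<oplus> y \<in> saturation H E" if x: "x \<in> saturation H E" and y: "y \<in> saturation H E" for x y
  proof -
    have c: "x \<in> carrier B" "y \<in> carrier B" using x y by (auto simp: saturation_def)
    have "\<exists>n::nat. h [^] n \<otimes> (x \<oplus> y) \<in> H" if h: "h \<in> E" for h
    proof -
      obtain m n :: nat where mn: "h [^] m \<otimes> x \<in> H" "h [^] n \<otimes> y \<in> H"
        using x y h unfolding saturation_def by blast
      have p: "h [^] m \<in> carrier B" "h [^] n \<in> carrier B" using h E by auto
      have "h [^] (m + n) \<otimes> (x \<oplus> y) = (h [^] m \<otimes> h [^] n) \<otimes> (x \<oplus> y)" using h E by (simp add: nat_pow_mult subset_iff)
      also have "\<dots> = h [^] n \<otimes> (h [^] m \<otimes> x) \<oplus> h [^] m \<otimes> (h [^] n \<otimes> y)" using c p by algebra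
      also have "\<dots> \<in> H" by (intro H.a_closed H.I_l_closed mn p)
      finally show ?thesis by blast
    qed
    then show ?thesis using c by (simp add: saturation_def)
  qed
  show "r \<otimes> x \<in> saturation H E" if r: "r \<in> carrier B" and x: "x \<in> saturation H E" for r x
  proof -
    have c: "x \<in> carrier B" using x by (auto simp: saturation_def)
    have "\<exists>n::nat. h [^] n \<otimes> (r \<otimes> x) \<in> H" if h: "h \<in> E" for h
    proof -
      obtain n :: nat where n: "h [^] n \<otimes> x \<in> H" using x h unfolding saturation_def by blast
      have "h [^] n \<in> carrier B" using h E by auto
      then have "h [^] n \<otimes> (r \<otimes> x) = r \<otimes> (h [^] n \<otimes> x)" using c r by algebra
      then show ?thesis using H.I_l_closed[OF n r] by (intro exI[of _ n]) simp
    qed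
    then show ?thesis using c r by (simp add: saturation_def)
  qed
qed

text \<open>Maximal annihilators are prime. Here they are the annihilators of the elements \<open>c a\<close>, \<open>c\<close>
  homogeneous, in the module \<open>B/H\<close> with \<open>g\<close> inverted, and the assumption says that \<open>a\<close> is not zero in this
  module. The result serves both to find a point where a fraction fails to lie in the
  sheaf of \<open>H\<close> and to produce associated points.\<close>

lemma exists_annihilator_prime:
  assumes noeth: "noetherian_ring B" and H: "ideal H B" "\<And>x n. x \<in> H \<Longrightarrow> cmp n x \<in> H"
    and a: "a \<in> homog G" and g: "g \<in> G d" "0 < d" and notin: "\<And>k::nat. g [^] k \<otimes> a \<notin> H"
  obtains c where "c \<in> homog G" "{r \<in> carrier B. \<exists>k::nat. g [^] k \<otimes> (r \<otimes> (c \<otimes> a)) \<in> H} \<in> proj_points B G"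
    "\<And>k::nat. g [^] k \<otimes> (c \<otimes> a) \<notin> H"
proof -
  interpret H: ideal H B by fact
  have gc: "g \<in> carrier B" and ac: "a \<in> carrier B" using G_carrier g a homog_carrier by auto
  have gk: "g [^] (k::nat) \<in> carrier B" for k using gc by simp
  define Ann where "Ann c = {r \<in> carrier B. \<exists>k::nat. g [^] k \<otimes> (r \<otimes> (c \<otimes> a)) \<in> H}" for c
  have AnnI: "r \<in> Ann c" if "r \<in> carrier B" "g [^] k \<otimes> (r \<otimes> (c \<otimes> a)) \<in> H" for r c and k :: nat
    using that by (auto simp: Ann_def)
  have Ann_ideal: "ideal (Ann c) B" if c: "c \<in> homog G" for c
  proof (rule ideal_criterion)
    have cc: "c \<in> carrier B" using c homog_carrier by blast
    show "Ann c \<subseteq> carrier B" by (auto simp: Ann_def)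
    show "\<zero> \<in> Ann c" using AnnI[of \<zero> 0 c] cc ac by simp
    fix x y assume "x \<in> Ann c" "y \<in> Ann c"
    then obtain m n :: nat where mn: "x \<in> carrier B" "y \<in> carrier B"
      "g [^] m \<otimes> (x \<otimes> (c \<otimes> a)) \<in> H" "g [^] n \<otimes> (y \<otimes> (c \<otimes> a)) \<in> H" by (auto simp: Ann_def)
    have "g [^] (m + n) \<otimes> ((x \<oplus> y) \<otimes> (c \<otimes> a)) = (g [^] m \<otimes> g [^] n) \<otimes> ((x \<oplus> y) \<otimes> (c \<otimes> a))"
      using gc by (simp add: nat_pow_mult)
    also have "\<dots> = g [^] n \<otimes> (g [^] m \<otimes> (x \<otimes> (c \<otimes> a))) \<oplus> g [^] m \<otimes> (g [^] n \<otimes> (y \<otimes> (c \<otimes> a)))"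
      using cc ac mn(1,2) gk[of m] gk[of n] by algebra
    also have "\<dots> \<in> H" by (intro H.a_closed H.I_l_closed mn gk)
    finally show "x \<oplus> y \<in> Ann c" using AnnI[of "x \<oplus> y"] mn by blast
  next
    have cc: "c \<in> carrier B" using c homog_carrier by blast
    fix r x assume r: "r \<in> carrier B" and "x \<in> Ann c"
    then obtain n :: nat where n: "x \<in> carrier B" "g [^] n \<otimes> (x \<otimes> (c \<otimes> a)) \<in> H" by (auto simp: Ann_def)
    have "g [^] n \<otimes> ((r \<otimes> x) \<otimes> (c \<otimes> a)) = r \<otimes> (g [^] n \<otimes> (x \<otimes> (c \<otimes> a)))"
      using cc ac n(1) r gk[of n] by algebra
    then show "r \<otimes> x \<in> Ann c" using AnnI[of "r \<otimes> x" n c] H.I_l_closed[OF n(2) r] r n(1) by simp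
  qed
  let ?F = "{Ann c | c. c \<in> homog G \<and> \<one> \<notin> Ann c}"
  have "\<one> \<notin> Ann \<one>" using notin ac by (simp add: Ann_def)
  then have ne: "?F \<noteq> {}" using homogI[OF one_G] by blast
  have ch: "\<Union>C \<in> ?F" if C: "C \<noteq> {}" "subset.chain ?F C" for C
  proof -
    have CF: "C \<subseteq> ?F" using C(2) by (simp add: pred_on.chain_def)
    have "?F \<subseteq> {I. ideal I B}" using Ann_ideal by blast
    with CF have "C \<subseteq> {I. ideal I B}" by (rule subset_trans)
    then have "subset.chain {I. ideal I B} C" using C(2) by (simp add: pred_on.chain_def)
    then have "\<Union>C \<in> C" by (rule noetherian_ring.ideal_chain_is_trivial[OF noeth C(1)])
    with CF show ?thesis by (rule subsetD)
  qed
  have "\<exists>M\<in>?F. \<forall>X\<in>?F. M \<subseteq> X \<longrightarrow> X = M" by (rule subset_Zorn_nonempty[OF ne ch])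
  then obtain P where PF: "P \<in> ?F" and mx: "\<forall>X\<in>?F. P \<subseteq> X \<longrightarrow> X = P" by (rule bexE)
  have max: "Q = P" if "Q \<in> ?F" "P \<subseteq> Q" for Q using bspec[OF mx that(1)] that(2) by (rule mp)
  from PF obtain c where c: "c \<in> homog G" "\<one> \<notin> Ann c" and P: "P = Ann c" by blast
  have cc: "c \<in> carrier B" using c homog_carrier by blast
  have nk: "g [^] k \<otimes> (c \<otimes> a) \<notin> H" for k :: nat using c(2) cc ac unfolding Ann_def by simp
  have Ph: "cmp n r \<in> P" if "r \<in> P" for n r
  proof -
    obtain k :: nat where k: "r \<in> carrier B" "g [^] k \<otimes> (r \<otimes> (c \<otimes> a)) \<in> H" using \<open>r \<in> P\<close> by (auto simp: P Ann_def)
    have "g [^] k \<otimes> (c \<otimes> a) \<in> homog G" using homog_mult[OF homogI[OF pow_G[OF g(1)]] homog_mult[OF c(1) a]] .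
    then obtain j where j: "g [^] k \<otimes> (c \<otimes> a) \<in> G j" by (rule homogE)
    have "g [^] k \<otimes> (r \<otimes> (c \<otimes> a)) = r \<otimes> (g [^] k \<otimes> (c \<otimes> a))" using cc ac k(1) gk[of k] by algebra
    then have "cmp (n + j) (r \<otimes> (g [^] k \<otimes> (c \<otimes> a))) \<in> H" using H(2)[OF k(2)] by simp
    then have "cmp n r \<otimes> (g [^] k \<otimes> (c \<otimes> a)) \<in> H" using cmp_mult[OF k(1) j, of "n + j"] by simp
    moreover have "cmp n r \<in> carrier B" using k by simp
    then have "cmp n r \<otimes> (g [^] k \<otimes> (c \<otimes> a)) = g [^] k \<otimes> (cmp n r \<otimes> (c \<otimes> a))" using cc ac gk[of k] by algebra
    ultimately show ?thesis using AnnI[of "cmp n r" k c] \<open>cmp n r \<in> carrier B\<close> by (simp add: P)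
  qed
  have prime: "primeideal P B"
  proof (rule homogeneous_primeI)
    show "ideal P B" using Ann_ideal[OF c(1)] P by simp
    show "P \<noteq> carrier B" using c(2) P one_closed by blast
    fix r s assume r: "r \<in> homog G" and s: "s \<in> homog G" and rs: "r \<otimes> s \<in> P"
    have rc: "r \<in> carrier B" "s \<in> carrier B" using r s homog_carrier by auto
    show "r \<in> P \<or> s \<in> P"
    proof (rule disjCI)
      assume "s \<notin> P"
      have sc: "s \<otimes> c \<in> homog G" using homog_mult s c by blast
      have "\<one> \<notin> Ann (s \<otimes> c)"
      proof
        assume "\<one> \<in> Ann (s \<otimes> c)"
        then obtain k :: nat where "g [^] k \<otimes> (s \<otimes> c \<otimes> a) \<in> H" using rc cc ac by (auto simp: Ann_def)
        then have "s \<in> P" using AnnI[of s k c] rc cc ac by (simp add: P m_assoc)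
        with \<open>s \<notin> P\<close> show False ..
      qed
      moreover have "P \<subseteq> Ann (s \<otimes> c)"
      proof
        fix x assume "x \<in> P"
        then obtain k :: nat where k: "x \<in> carrier B" "g [^] k \<otimes> (x \<otimes> (c \<otimes> a)) \<in> H" by (auto simp: P Ann_def)
        have "g [^] k \<otimes> (x \<otimes> (s \<otimes> c \<otimes> a)) = s \<otimes> (g [^] k \<otimes> (x \<otimes> (c \<otimes> a)))"
          using rc cc ac k(1) gk[of k] by algebra
        then show "x \<in> Ann (s \<otimes> c)" using AnnI[of x k "s \<otimes> c"] H.I_l_closed[OF k(2) rc(2)] k(1) by simp
      qed
      ultimately have "Ann (s \<otimes> c) = P" using max[of "Ann (s \<otimes> c)"] sc by blast
      moreover obtain k :: nat where "g [^] k \<otimes> (r \<otimes> s \<otimes> (c \<otimes> a)) \<in> H" using rs by (auto simp: P Ann_def)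
      then have "r \<in> Ann (s \<otimes> c)" using AnnI[of r k "s \<otimes> c"] rc cc ac by (simp add: m_assoc)
      ultimately show "r \<in> P" by simp
    qed
  qed (rule Ph)
  have "g \<notin> P"
  proof
    assume "g \<in> P"
    then obtain k :: nat where "g [^] k \<otimes> (g \<otimes> (c \<otimes> a)) \<in> H" by (auto simp: P Ann_def)
    then have "g [^] Suc k \<otimes> (c \<otimes> a) \<in> H" using gc cc ac by (simp add: m_assoc)
    with nk[of "Suc k"] show False by simp
  qed
  then have "\<not> (\<Union>n\<in>{0<..}. G n) \<subseteq> P" using g by blast
  moreover have "homogeneous_ideal B G P" unfolding homogeneous_ideal_iff using Ann_ideal[OF c(1)] P Ph by blast
  ultimately have "P \<in> proj_points B G" using prime by (simp add: proj_points_def)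
  then show thesis using that[OF c(1)] nk by (simp add: P Ann_def)
qed

lemma numer_saturation:
  assumes q: "q \<in> proj_points B G" and H: "ideal H B" and E: "E \<subseteq> homog G" "\<not> E \<subseteq> q"
  shows "proj.numer q (saturation H E) = proj.numer q H"
proof (intro equalityI subsetI)
  interpret H: ideal H B by fact
  have qT: "q \<in> topspace (zariski_proj B G)" using q by simp
  obtain h where h: "h \<in> E" "h \<notin> q" using E by blast
  then have hc: "h \<in> homog G" "h \<in> carrier B" using E homog_carrier by auto
  {
    fix z assume "z \<in> proj.numer q (saturation H E)"
    then obtain a b where z: "z = proj.frac q a b" "(a, b) \<in> D" "b \<in> homog G - q" "a \<in> saturation H E"
      by (rule proj.numerE)
    then obtain n :: nat where n: "h [^] n \<otimes> a \<in> H" using h unfolding saturation_def by blast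
    obtain d where "h \<in> G d" using hc by (meson homogE)
    then have "h [^] n \<in> homog G - q" using homogI[OF pow_G[of h d n]] proj_pow_notin[OF q hc(2) h(2)] by simp
    then show "z \<in> proj.numer q H" using proj.numer_frac_iff[OF qT z(2,3) H] n z(1) by blast
  next
    fix z assume "z \<in> proj.numer q H"
    then obtain a b where z: "z = proj.frac q a b" "(a, b) \<in> D" "b \<in> homog G - q" "a \<in> H"
      by (rule proj.numerE)
    have "h [^] (0::nat) \<otimes> a \<in> H" if "h \<in> E" for h using z(4) H.Icarr by simp
    then have "a \<in> saturation H E" unfolding saturation_def using z(4) H.Icarr by blast
    then show "z \<in> proj.numer q (saturation H E)" using z proj.numerI by blast
  }
qed

end

text \<open>Noetherian graded rings for which the elements of degree one do not vanish simultaneously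
  anywhere on Proj, such as those generated in degrees zero and one.\<close>

locale standard_graded_ring = graded_ring +
  assumes noetherian: "noetherian_ring B"
    and degree_one: "p \<in> proj_points B G \<Longrightarrow> \<exists>g\<in>G 1. g \<notin> p"
begin

lemma closed_subscheme_of_ideal:
  assumes H: "ideal H B"
  shows "closed_subscheme proj.X (proj.J H)"
proof (rule proj.J_closed_subscheme[OF H])
  fix p assume "p \<in> topspace (zariski_proj B G)"
  then obtain g where g: "g \<in> G 1" "g \<notin> p" using degree_one by auto
  let ?U = "{q \<in> proj_points B G. g \<notin> q}"
  have U: "openin (zariski_proj B G) ?U" using openin_proj_basic[OF homogI[OF g(1)]] .
  have "\<exists>d. (a, d) \<in> D \<and> (d, b) \<in> D \<and> (\<forall>q\<in>?U. d \<in> homog G - q)"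
    if "(a, b) \<in> D" for a b
  proof -
    obtain n where n: "a \<in> G n" "b \<in> G n"
      using \<open>(a, b) \<in> D\<close> by (auto simp: same_degree_pairs_def)
    have "g [^] n \<in> G n" using pow_G[OF g(1), of n] by simp
    then show ?thesis using n proj_pow_notin[OF _ G_carrier[OF g(1)]] homogI
      by (intro exI[of _ "g [^] n"]) (auto simp: same_degree_pairs_def)
  qed
  then show "\<exists>U. openin (zariski_proj B G) U \<and> p \<in> U \<and>
      (\<forall>a b. (a, b) \<in> D \<and> a \<in> H \<longrightarrow>
        (\<exists>d. (a, d) \<in> D \<and> (d, b) \<in> D \<and> (\<forall>q\<in>U. d \<in> homog G - q)))"
    using U g(2) \<open>p \<in> topspace (zariski_proj B G)\<close> by (intro exI[of _ ?U]) simp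
qed

text \<open>Let the section be \<open>a/b\<close> on \<open>D\<^sub>+(g)\<close> and let \<open>h \<in> E\<close>. If \<open>(g h)\<^sup>k a \<notin> H\<close> for all \<open>k\<close>,
  then some point of \<open>D\<^sub>+(g h)\<close> contains the annihilator of \<open>a\<close> modulo \<open>H\<close>, so \<open>a/b\<close> does not lie in
  the sheaf of \<open>H\<close> there. Hence \<open>(g h)\<^sup>k a \<in> H\<close> for some \<open>k\<close>, which can be chosen for all
  \<open>h\<close> at once since \<open>E\<close> is finite; then \<open>g\<^sup>k a\<close> is in the saturation and \<open>a/b = g\<^sup>k a / (g\<^sup>k b)\<close>.\<close>

lemma section_in_saturation:
  assumes H: "homogeneous_ideal B G H" and E: "finite E" "E \<subseteq> homog G"
    and V: "openin (zariski_proj B G) V" and s: "s \<in> carrier (sec proj.X V)"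
    and away: "\<And>q. q \<in> V \<Longrightarrow> \<not> E \<subseteq> q \<Longrightarrow> s q \<in> proj.numer q H"
  shows "s \<in> proj.J (saturation H E) V"
proof -
  have Hi: "ideal H B" and Hh: "\<And>x n. x \<in> H \<Longrightarrow> cmp n x \<in> H" using H unfolding homogeneous_ideal_iff by auto
  interpret H: ideal H B by fact
  have Ec: "E \<subseteq> carrier B" using E homog_carrier by blast
  have "s p \<in> proj.numer p (saturation H E)" if p: "p \<in> V" for p
  proof -
    obtain W a b where W: "openin (zariski_proj B G) W" "p \<in> W" "W \<subseteq> V" "(a, b) \<in> D"
      "\<And>q. q \<in> W \<Longrightarrow> b \<in> homog G - q" "\<And>q. q \<in> W \<Longrightarrow> s q = proj.frac q a b"
      using proj.secE[OF V s p] by metis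
    have pT: "p \<in> topspace (zariski_proj B G)" "p \<in> proj_points B G" using proj.open_point[OF W(1,2)] by auto
    obtain g0 where g0: "g0 \<in> homog G" "g0 \<notin> p" "{q \<in> proj_points B G. g0 \<notin> q} \<subseteq> W"
      using proj_basis[OF W(1,2)] .
    obtain e where e: "e \<in> G 1" "e \<notin> p" using degree_one pT by blast
    \<comment> \<open>The factor \<open>e\<close> makes the degree positive, as needed to get a point of Proj below.\<close>
    define g where "g = e \<otimes> g0"
    have gc: "g0 \<in> carrier B" "e \<in> carrier B" "g \<in> carrier B" using g0 e homog_carrier G_carrier by (auto simp: g_def)
    obtain d0 where "g0 \<in> G d0" using g0(1) by (rule homogE)
    then have g: "g \<in> G (1 + d0)" unfolding g_def using mult_G e(1) by blast
    have gp: "g \<notin> p" using proj_mult_iff[OF pT(2)] e g0 gc unfolding g_def by blast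
    have ah: "a \<in> homog G" "a \<in> carrier B" "b \<in> carrier B" using W(4) G_carrier homogI by (auto simp: same_degree_pairs_def)
    have "\<exists>k::nat. (g \<otimes> h) [^] k \<otimes> a \<in> H" if h: "h \<in> E" for h
    proof (rule ccontr)
      assume "\<nexists>k::nat. (g \<otimes> h) [^] k \<otimes> a \<in> H"
      then have nk: "\<And>k::nat. (g \<otimes> h) [^] k \<otimes> a \<notin> H" by blast
      have hc: "h \<in> homog G" "h \<in> carrier B" using h E Ec by auto
      then obtain dh where dh: "h \<in> G dh" by (meson homogE)
      have gh: "g \<otimes> h \<in> G (1 + d0 + dh)" using mult_G[OF g dh] .
      obtain c where c: "c \<in> homog G" "{r \<in> carrier B. \<exists>k::nat. (g \<otimes> h) [^] k \<otimes> (r \<otimes> (c \<otimes> a)) \<in> H} \<in> proj_points B G"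
          (is "?Q \<in> _") "\<And>k::nat. (g \<otimes> h) [^] k \<otimes> (c \<otimes> a) \<notin> H"
        using exists_annihilator_prime[OF noetherian Hi Hh ah(1) gh _ nk] by auto
      have cc: "c \<in> carrier B" using c homog_carrier by blast
      have "g \<otimes> h \<notin> ?Q"
      proof
        assume "g \<otimes> h \<in> ?Q"
        then obtain k :: nat where "(g \<otimes> h) [^] k \<otimes> ((g \<otimes> h) \<otimes> (c \<otimes> a)) \<in> H" by blast
        then have "(g \<otimes> h) [^] Suc k \<otimes> (c \<otimes> a) \<in> H" using gc hc cc ah by (simp add: m_assoc)
        with c(3)[of "Suc k"] show False by simp
      qed
      then have gQ: "g \<notin> ?Q" "h \<notin> ?Q" using proj_mult_iff[OF c(2) gc(3) hc(2)] by blast+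
      then have "g0 \<notin> ?Q" using proj_mult_iff[OF c(2) gc(2,1)] unfolding g_def by blast
      then have QW: "?Q \<in> W" using g0(3) c(2) by blast
      then have "s ?Q \<in> proj.numer ?Q H" using away[of ?Q] W(3) gQ(2) h by blast
      then have "proj.frac ?Q a b \<in> proj.numer ?Q H" using W(6)[OF QW] by simp
      then obtain u where u: "u \<in> homog G - ?Q" "u \<otimes> a \<in> H"
        using proj.numer_frac_iff[OF _ W(4) W(5)[OF QW] Hi] c(2) by auto
      have uc: "u \<in> carrier B" using u homog_carrier by blast
      have "(g \<otimes> h) [^] (0::nat) \<otimes> (u \<otimes> (c \<otimes> a)) = c \<otimes> (u \<otimes> a)" using uc cc ah by (simp add: m_ac)
      also have "\<dots> \<in> H" using H.I_l_closed[OF u(2) cc] .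
      finally have "u \<in> ?Q" using uc by blast
      with u show False by blast
    qed
    then obtain \<kappa> :: "'a \<Rightarrow> nat" where \<kappa>: "\<And>h. h \<in> E \<Longrightarrow> (g \<otimes> h) [^] \<kappa> h \<otimes> a \<in> H" by metis
    define k where "k = (\<Sum>h\<in>E. \<kappa> h)"
    have "g [^] k \<otimes> a \<in> saturation H E"
      unfolding saturation_def
    proof (intro CollectI conjI ballI)
      show "g [^] k \<otimes> a \<in> carrier B" using gc ah by simp
      fix h assume h: "h \<in> E"
      have hc: "h \<in> carrier B" using h Ec by blast
      have "\<kappa> h \<le> k" unfolding k_def using member_le_sum[OF h, of \<kappa>] E(1) by simp
      then have "g [^] k = g [^] (k - \<kappa> h) \<otimes> g [^] \<kappa> h" using nat_pow_mult[OF gc(3), of "k - \<kappa> h" "\<kappa> h"] by simp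
      moreover have "(g \<otimes> h) [^] \<kappa> h = g [^] \<kappa> h \<otimes> h [^] \<kappa> h" using nat_pow_distrib[OF gc(3) hc] .
      moreover have "g [^] (k - \<kappa> h) \<in> carrier B" "g [^] \<kappa> h \<in> carrier B" "h [^] \<kappa> h \<in> carrier B" using gc hc by auto
      ultimately have "h [^] \<kappa> h \<otimes> (g [^] k \<otimes> a) = g [^] (k - \<kappa> h) \<otimes> ((g \<otimes> h) [^] \<kappa> h \<otimes> a)"
        using ah by (simp add: m_ac)
      also have "\<dots> \<in> H" using H.I_l_closed[OF \<kappa>[OF h]] gc by simp
      finally show "\<exists>n::nat. h [^] n \<otimes> (g [^] k \<otimes> a) \<in> H" by blast
    qed
    moreover have "g [^] k \<in> homog G - p"
      using homogI[OF pow_G[OF g, of k]] proj_pow_notin[OF pT(2) gc(3) gp] by simp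
    ultimately have "proj.frac p a b \<in> proj.numer p (saturation H E)"
      using proj.numer_frac_iff[OF pT(1) W(4) W(5)[OF W(2)] saturation_ideal[OF Hi Ec]] by blast
    then show ?thesis using W(6)[OF W(2)] by simp
  qed
  then show ?thesis using proj.J_iff[OF saturation_ideal[OF Hi Ec] V] s by blast
qed

text \<open>Every ideal sheaf contained in that of \<open>H\<close> on \<open>W0\<close> consists of sections as in the
  preceding lemma, so the sheaf of the saturation is the largest one.\<close>

lemma scheme_closure_eq:
  assumes H: "homogeneous_ideal B G H" and E: "finite E" "E \<subseteq> homog G"
    and W0: "W0 = {q \<in> proj_points B G. \<not> E \<subseteq> q}"
    and L: "\<And>V. openin (zariski_proj B G) V \<Longrightarrow> V \<subseteq> W0 \<Longrightarrow> L V = proj.J H V"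
  shows "scheme_closure proj.X W0 L = proj.J (saturation H E)"
proof -
  have Hi: "ideal H B" using H unfolding homogeneous_ideal_iff by auto
  have Ec: "E \<subseteq> carrier B" using E homog_carrier by blast
  note sat = saturation_ideal[OF Hi Ec]
  let ?T = "zariski_proj B G"
  let ?K = "proj.J (saturation H E)"
  have cl: "closed_subscheme proj.X ?K" using closed_subscheme_of_ideal[OF sat] .
  have ct: "contains_locally_closed proj.X ?K W0 L"
    unfolding contains_locally_closed_def proj.topo_X
  proof (intro allI impI subsetI)
    fix V s assume V: "openin ?T V \<and> V \<subseteq> W0" and s: "s \<in> ?K V"
    have "s p \<in> proj.numer p H" if "p \<in> V" for p
    proof -
      have "p \<in> proj_points B G" "\<not> E \<subseteq> p" using V that W0 by auto
      then show ?thesis using numer_saturation[OF _ Hi E(2), of p] s proj.J_iff[OF sat, of V s] V that by blast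
    qed
    then have "s \<in> proj.J H V" using proj.J_iff[OF Hi, of V s] proj.J_iff[OF sat, of V s] V s by blast
    then show "s \<in> L V" using L V by blast
  qed
  have max: "K' V \<subseteq> ?K V" if K': "closed_subscheme proj.X K'" "contains_locally_closed proj.X K' W0 L" for K' V
  proof (cases "openin ?T V")
    case V: True
    have sh: "ideal_sheaf proj.X K'" using K'(1) by (simp add: closed_subscheme_def)
    have W0o: "openin ?T W0" unfolding openin_proj_iff W0 using E by blast
    show ?thesis
    proof
      fix s assume s: "s \<in> K' V"
      have "ideal (K' V) (sec proj.X V)" using ideal_sheafD(1)[OF sh, of V] V by simp
      then have sV: "s \<in> carrier (sec proj.X V)" using s by (rule ideal.Icarr)
      have VW: "openin ?T (V \<inter> W0)" using V W0o by (rule openin_Int)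
      have "restrict s (V \<inter> W0) \<in> K' (V \<inter> W0)"
        using ideal_sheafD(2)[OF sh, of V "V \<inter> W0" s] V VW s by simp
      moreover have "K' (V \<inter> W0) \<subseteq> L (V \<inter> W0)"
        using K'(2) VW by (simp add: contains_locally_closed_def)
      ultimately have "restrict s (V \<inter> W0) \<in> proj.J H (V \<inter> W0)" using L[OF VW] by auto
      then have val: "\<forall>q\<in>V \<inter> W0. restrict s (V \<inter> W0) q \<in> proj.numer q H" using proj.J_iff[OF Hi VW] by simp
      have "s q \<in> proj.numer q H" if "q \<in> V" "\<not> E \<subseteq> q" for q
      proof -
        have "q \<in> V \<inter> W0" using that proj.open_point[OF V that(1)] W0 by simp
        with val have "restrict s (V \<inter> W0) q \<in> proj.numer q H" by (rule bspec)
        then show ?thesis using \<open>q \<in> V \<inter> W0\<close> by simp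
      qed
      then show "s \<in> ?K V" by (rule section_in_saturation[OF H E V sV])
    qed
  next
    case False
    moreover have "ideal_sheaf proj.X K'" using K'(1) by (simp add: closed_subscheme_def)
    ultimately show ?thesis using ideal_sheafD(3)[of proj.X K' V] by simp
  qed
  show ?thesis
    unfolding scheme_closure_def
  proof (rule the_equality)
    show "closed_subscheme proj.X ?K \<and> contains_locally_closed proj.X ?K W0 L \<and>
       (\<forall>K'. closed_subscheme proj.X K' \<and> contains_locally_closed proj.X K' W0 L \<longrightarrow> (\<forall>V. K' V \<subseteq> ?K V))"
      using cl ct max by blast
    fix K assume K: "closed_subscheme proj.X K \<and> contains_locally_closed proj.X K W0 L \<and>
       (\<forall>K'. closed_subscheme proj.X K' \<and> contains_locally_closed proj.X K' W0 L \<longrightarrow> (\<forall>V. K' V \<subseteq> K V))"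
    show "K = ?K"
    proof
      fix V
      have "K V \<subseteq> ?K V" using max K by blast
      moreover have "?K V \<subseteq> K V" using K cl ct by blast
      ultimately show "K V = ?K V" by blast
    qed
  qed
qed

text \<open>The maximal ideal of the local ring at \<open>p\<close> is the annihilator modulo \<open>H\<close> of some \<open>a/b\<close>
  outside \<open>H\<close>. As \<open>p\<close> contains \<open>E\<close>, a multiple of \<open>a\<close> by a denominator lies in the saturation.\<close>

lemma associated_point_not_saturated:
  assumes H: "homogeneous_ideal B G H" and E: "finite E" "E \<subseteq> homog G"
    and pa: "p \<in> assoc_points proj.X (proj.J H)" and Ep: "E \<subseteq> p"
  shows "proj.J H \<noteq> proj.J (saturation H E)"
proof
  assume eq: "proj.J H = proj.J (saturation H E)"
  have Hi: "ideal H B" using H unfolding homogeneous_ideal_iff by auto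
  interpret H: ideal H B by fact
  have Ec: "E \<subseteq> carrier B" using E homog_carrier by blast
  note sat = saturation_ideal[OF Hi Ec]
  have pT: "p \<in> topspace (zariski_proj B G)" "p \<in> proj_points B G" using pa proj.assoc_points_iff[OF Hi] by auto
  obtain a b where ab: "(a, b) \<in> D" "b \<in> homog G - p"
    and ann: "\<And>c d. (c, d) \<in> D \<Longrightarrow> d \<in> homog G - p \<Longrightarrow>
      (c \<notin> homog G - p \<longleftrightarrow> (\<exists>u\<in>homog G - p. u \<otimes> (c \<otimes> a) \<in> H))"
    using pa proj.assoc_points_iff[OF Hi, of p] by blast
  have ac: "a \<in> carrier B" using proj.D_closed ab by blast
  obtain g where g: "g \<in> G 1" "g \<notin> p" using degree_one pT by blast
  have kill: "\<exists>u\<in>homog G - p. u \<otimes> (h \<otimes> a) \<in> H" if h: "h \<in> E" for h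
  proof -
    obtain e where e: "h \<in> G e" using h E by (meson homogE subsetD)
    have "g [^] e \<in> G e" using pow_G[OF g(1), of e] by simp
    then have "(h, g [^] e) \<in> D" "g [^] e \<in> homog G - p"
      using e homogI proj_pow_notin[OF pT(2) G_carrier[OF g(1)] g(2)] by (auto simp: same_degree_pairs_def)
    then show ?thesis using ann[of h "g [^] e"] h Ep by blast
  qed
  have "\<exists>u\<in>homog G - p. \<forall>h\<in>E. u \<otimes> (h \<otimes> a) \<in> H"
    using E(1) kill Ec
  proof (induction E)
    case empty
    then show ?case using proj.S_1[OF pT(1)] by blast
  next
    case (insert h E)
    obtain u where u: "u \<in> homog G - p" "\<forall>h\<in>E. u \<otimes> (h \<otimes> a) \<in> H" using insert by auto
    obtain v where v: "v \<in> homog G - p" "v \<otimes> (h \<otimes> a) \<in> H"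
      using insert.prems(1)[of h] by blast
    have c: "u \<in> carrier B" "v \<in> carrier B" "h \<in> carrier B" using u v insert homog_carrier by auto
    have "u \<otimes> v \<otimes> (h' \<otimes> a) \<in> H" if h': "h' \<in> insert h E" for h'
    proof (cases "h' = h")
      case True
      then show ?thesis using H.I_l_closed[OF v(2) c(1)] c ac by (simp add: m_assoc)
    next
      case False
      then have "h' \<in> E" using h' by blast
      moreover have "h' \<in> carrier B" using h' insert.prems by blast
      then have "u \<otimes> v \<otimes> (h' \<otimes> a) = v \<otimes> (u \<otimes> (h' \<otimes> a))" using c ac by algebra
      ultimately show ?thesis using H.I_l_closed[of "u \<otimes> (h' \<otimes> a)" v] u c by simp
    qed
    then show ?case using proj.S_times[OF pT(1) u(1) v(1)] by blast
  qed
  then obtain u where u: "u \<in> homog G - p" "\<forall>h\<in>E. u \<otimes> (h \<otimes> a) \<in> H" by blast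
  have uc: "u \<in> carrier B" using u homog_carrier by blast
  have "h [^] (1::nat) \<otimes> (u \<otimes> a) \<in> H" if h: "h \<in> E" for h
  proof -
    have "h \<in> carrier B" using h Ec by blast
    then have "h [^] (1::nat) \<otimes> (u \<otimes> a) = u \<otimes> (h \<otimes> a)" using uc ac by (simp add: m_ac)
    then show ?thesis using u(2) h by simp
  qed
  then have "u \<otimes> a \<in> saturation H E" unfolding saturation_def using uc ac by blast
  then have "proj.frac p a b \<in> proj.numer p (saturation H E)"
    using proj.numer_frac_iff[OF pT(1) ab sat] u(1) by blast
  then have "proj.frac p a b \<in> proj.numer p H" using eq proj.J_eq_iff[OF Hi sat] pT(1) by blast
  then obtain v where "v \<in> homog G - p" "v \<otimes> a \<in> H" using proj.numer_frac_iff[OF pT(1) ab Hi] by blast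
  then have "\<exists>v\<in>homog G - p. v \<otimes> (\<one> \<otimes> a) \<in> H" using ac by auto
  then have "\<one> \<notin> homog G - p" using ann[OF proj.D_one proj.S_1[OF pT(1)]] by blast
  then show False using proj.S_1[OF pT(1)] by blast
qed

text \<open>If \<open>a\<close> is in the saturation but not in \<open>H\<close> near \<open>p\<close>, a maximal annihilator of a multiple of
  \<open>a\<close> is an associated point, and it contains \<open>E\<close> because powers of the elements of \<open>E\<close>
  annihilate \<open>a\<close>.\<close>

lemma exists_associated_point:
  assumes H: "homogeneous_ideal B G H" and E: "E \<subseteq> homog G"
    and ne: "proj.J H \<noteq> proj.J (saturation H E)"
  shows "\<exists>p\<in>assoc_points proj.X (proj.J H). E \<subseteq> p"
proof -
  have Hi: "ideal H B" and Hh: "\<And>x n. x \<in> H \<Longrightarrow> cmp n x \<in> H" using H unfolding homogeneous_ideal_iff by auto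
  interpret H: ideal H B by fact
  have Ec: "E \<subseteq> carrier B" using E homog_carrier by blast
  note sat = saturation_ideal[OF Hi Ec]
  have sub: "H \<subseteq> saturation H E"
  proof
    fix x assume x: "x \<in> H"
    have "h [^] (0::nat) \<otimes> x \<in> H" if "h \<in> E" for h using x H.Icarr by simp
    then show "x \<in> saturation H E" unfolding saturation_def using x H.Icarr by blast
  qed
  obtain p where p: "p \<in> topspace (zariski_proj B G)" "proj.numer p H \<noteq> proj.numer p (saturation H E)"
    using ne proj.J_eq_iff[OF Hi sat] by blast
  have "proj.numer p H \<subseteq> proj.numer p (saturation H E)" using sub by (auto simp: proj.numer_def)
  then obtain z where z: "z \<in> proj.numer p (saturation H E)" "z \<notin> proj.numer p H" using p(2) by blast
  obtain a b where ab: "z = proj.frac p a b" "(a, b) \<in> D" "b \<in> homog G - p" "a \<in> saturation H E"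
    using z(1) by (rule proj.numerE)
  have nu: "u \<otimes> a \<notin> H" if "u \<in> homog G - p" for u
    using proj.numer_frac_iff[OF p(1) ab(2,3) Hi] z(2) ab(1) that by blast
  have ah: "a \<in> homog G" "a \<in> carrier B" using ab(2) G_carrier homogI by (auto simp: same_degree_pairs_def)
  have pP: "p \<in> proj_points B G" using p by simp
  obtain g where g: "g \<in> G 1" "g \<notin> p" using degree_one pP by blast
  have gc: "g \<in> carrier B" using g G_carrier by blast
  have nk: "g [^] k \<otimes> a \<notin> H" for k :: nat
    using nu homogI[OF pow_G[OF g(1)]] proj_pow_notin[OF pP gc g(2)] by blast
  obtain c where c: "c \<in> homog G" "{r \<in> carrier B. \<exists>k::nat. g [^] k \<otimes> (r \<otimes> (c \<otimes> a)) \<in> H} \<in> proj_points B G"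
      (is "?Q \<in> _") "\<And>k::nat. g [^] k \<otimes> (c \<otimes> a) \<notin> H"
    using exists_annihilator_prime[OF noetherian Hi Hh ah(1) g(1) _ nk] by auto
  have cc: "c \<in> carrier B" using c homog_carrier by blast
  have gQ: "g \<notin> ?Q"
  proof
    assume "g \<in> ?Q"
    then obtain k :: nat where "g [^] k \<otimes> (g \<otimes> (c \<otimes> a)) \<in> H" by blast
    then have "g [^] Suc k \<otimes> (c \<otimes> a) \<in> H" using gc cc ah by (simp add: m_assoc)
    with c(3)[of "Suc k"] show False by simp
  qed
  have EQ: "E \<subseteq> ?Q"
  proof
    fix h assume h: "h \<in> E"
    have hc: "h \<in> carrier B" using h Ec by blast
    obtain n :: nat where n: "h [^] n \<otimes> a \<in> H" using ab(4) h unfolding saturation_def by blast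
    have "g [^] (0::nat) \<otimes> (h [^] n \<otimes> (c \<otimes> a)) = c \<otimes> (h [^] n \<otimes> a)" using hc cc ah by (simp add: m_ac)
    also have "\<dots> \<in> H" using H.I_l_closed[OF n cc] .
    finally have "h [^] n \<in> ?Q" using hc by blast
    then show "h \<in> ?Q" using proj_pow_notin[OF c(2) hc] by blast
  qed
  have cah: "c \<otimes> a \<in> homog G" using homog_mult[OF c(1) ah(1)] .
  then obtain e where e: "c \<otimes> a \<in> G e" by (rule homogE)
  \<comment> \<open>Since \<open>g\<close> has degree one, its powers provide a denominator of the right degree.\<close>
  have "g [^] e \<in> G e" using pow_G[OF g(1), of e] by simp
  then have ge: "(c \<otimes> a, g [^] e) \<in> D" "g [^] e \<in> homog G - ?Q"
    using e homogI proj_pow_notin[OF c(2) gc gQ] by (auto simp: same_degree_pairs_def)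
  have "x \<notin> homog G - ?Q \<longleftrightarrow> (\<exists>u\<in>homog G - ?Q. u \<otimes> (x \<otimes> (c \<otimes> a)) \<in> H)"
    if xy: "(x, y) \<in> D" for x y
  proof -
    have xh: "x \<in> homog G" "x \<in> carrier B" using xy G_carrier homogI by (auto simp: same_degree_pairs_def)
    show ?thesis
    proof
      assume "x \<notin> homog G - ?Q"
      then have "x \<in> ?Q" using xh by blast
      then obtain k :: nat where "g [^] k \<otimes> (x \<otimes> (c \<otimes> a)) \<in> H" by blast
      moreover have "g [^] k \<in> homog G - ?Q"
        using homogI[OF pow_G[OF g(1), of k]] proj_pow_notin[OF c(2) gc gQ, of k] by blast
      ultimately show "\<exists>u\<in>homog G - ?Q. u \<otimes> (x \<otimes> (c \<otimes> a)) \<in> H" by blast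
    next
      assume "\<exists>u\<in>homog G - ?Q. u \<otimes> (x \<otimes> (c \<otimes> a)) \<in> H"
      then obtain u where u: "u \<in> homog G" "u \<notin> ?Q" "u \<otimes> (x \<otimes> (c \<otimes> a)) \<in> H" by blast
      have uc: "u \<in> carrier B" using u homog_carrier by blast
      have "g [^] (0::nat) \<otimes> ((u \<otimes> x) \<otimes> (c \<otimes> a)) \<in> H" using u uc xh cc ah by (simp add: m_assoc)
      then have "u \<otimes> x \<in> ?Q" using uc xh by blast
      then have "x \<in> ?Q" using proj_mult_iff[OF c(2) uc xh(2)] u(2) by blast
      then show "x \<notin> homog G - ?Q" by blast
    qed
  qed
  note ann = this
  have "?Q \<in> assoc_points proj.X (proj.J H)"
    unfolding proj.assoc_points_iff[OF Hi, of ?Q] topspace_proj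
    by (intro conjI exI[of _ "c \<otimes> a"] exI[of _ "g [^] e"] allI impI c(2) ge; elim conjE) (rule ann)
  then show ?thesis using EQ by blast
qed

lemma saturated_iff_no_associated_point:
  assumes "homogeneous_ideal B G H" "finite E" "E \<subseteq> homog G"
  shows "proj.J H = proj.J (saturation H E) \<longleftrightarrow> (\<forall>p\<in>assoc_points proj.X (proj.J H). \<not> E \<subseteq> p)"
  using associated_point_not_saturated[OF assms] exists_associated_point[OF assms(1,3)] by blast

end

section \<open>Finitely generated extensions of noetherian rings\<close>

context cring
begin

definition relative_ideal where
  "relative_ideal A J \<longleftrightarrow> J \<subseteq> A \<and> \<zero> \<in> J \<and> (\<forall>x\<in>J. \<forall>y\<in>J. x \<oplus> y \<in> J) \<and> (\<forall>r\<in>A. \<forall>x\<in>J. r \<otimes> x \<in> J)"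

text \<open>Subrings are kept inside the ambient ring, so that several elements can be adjoined in turn
  without a change of type. That \<open>F\<close> generates \<open>J\<close> is expressed by the minimality of \<open>J\<close>.\<close>

definition noetherian_subring where
  "noetherian_subring A \<longleftrightarrow> subring A R \<and>
     (\<forall>J. relative_ideal A J \<longrightarrow> (\<exists>F. finite F \<and> F \<subseteq> J \<and> (\<forall>K. relative_ideal A K \<and> F \<subseteq> K \<longrightarrow> J \<subseteq> K)))"

lemma relative_idealD:
  assumes "relative_ideal A J"
  shows "J \<subseteq> A" "\<zero> \<in> J" "\<And>x y. x \<in> J \<Longrightarrow> y \<in> J \<Longrightarrow> x \<oplus> y \<in> J" "\<And>r x. r \<in> A \<Longrightarrow> x \<in> J \<Longrightarrow> r \<otimes> x \<in> J"
  using assms by (auto simp: relative_ideal_def)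

lemma relative_ideal_Int: "relative_ideal A J \<Longrightarrow> relative_ideal A K \<Longrightarrow> relative_ideal A (J \<inter> K)"
  by (auto simp: relative_ideal_def)

text \<open>Polynomial expressions in \<open>x\<close> of degree less than \<open>n\<close>.\<close>

primrec polys where
  "polys A x 0 = {\<zero>}"
| "polys A x (Suc n) = {a \<otimes> x [^] n \<oplus> m | a m. a \<in> A \<and> m \<in> polys A x n}"

definition adjoin where "adjoin A x = (\<Union>n. polys A x n)"

context
  fixes A x
  assumes A: "subring A R" and x: "x \<in> carrier R"
begin

lemma A_carrier: "a \<in> A \<Longrightarrow> a \<in> carrier R"
  using subringE(1)[OF A] by blast

lemma polys_carrier: "m \<in> polys A x n \<Longrightarrow> m \<in> carrier R"
proof (induction n arbitrary: m)
  case (Suc n)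
  then obtain a m' where "m = a \<otimes> x [^] n \<oplus> m'" "a \<in> A" "m' \<in> polys A x n" by auto
  then show ?case using Suc.IH A_carrier x by simp
qed simp

lemma polys_SucI: "a \<in> A \<Longrightarrow> m \<in> polys A x n \<Longrightarrow> a \<otimes> x [^] n \<oplus> m \<in> polys A x (Suc n)"
  by auto

lemma polys_SucE:
  assumes "p \<in> polys A x (Suc n)"
  obtains a m where "p = a \<otimes> x [^] n \<oplus> m" "a \<in> A" "m \<in> polys A x n"
  using assms by auto

lemma polys_le_Suc: "m \<in> polys A x n \<Longrightarrow> m \<in> polys A x (Suc n)"
  using polys_SucI[OF subringE(2)[OF A], of m n] polys_carrier[of m n] x by simp

lemma polys_mono: "m \<in> polys A x n \<Longrightarrow> n \<le> k \<Longrightarrow> m \<in> polys A x k"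
  by (induction k) (auto simp: le_Suc_eq simp del: polys.simps intro: polys_le_Suc)

lemma polys_zero: "\<zero> \<in> polys A x n"
  using polys_mono[of \<zero> 0 n] by simp

lemma polys_add: "p \<in> polys A x n \<Longrightarrow> q \<in> polys A x n \<Longrightarrow> p \<oplus> q \<in> polys A x n"
proof (induction n arbitrary: p q)
  case (Suc n)
  obtain a m b k where p: "p = a \<otimes> x [^] n \<oplus> m" "a \<in> A" "m \<in> polys A x n"
    and q: "q = b \<otimes> x [^] n \<oplus> k" "b \<in> A" "k \<in> polys A x n" using Suc.prems by (meson polys_SucE)
  have c: "a \<in> carrier R" "b \<in> carrier R" "m \<in> carrier R" "k \<in> carrier R" "x [^] n \<in> carrier R"
    using p q A_carrier polys_carrier x by auto
  have "p \<oplus> q = (a \<oplus> b) \<otimes> x [^] n \<oplus> (m \<oplus> k)" unfolding p q using c by algebra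
  then show ?case using polys_SucI[OF subringE(7)[OF A p(2) q(2)] Suc.IH[OF p(3) q(3)]] by simp
qed simp

lemma polys_scale: "a \<in> A \<Longrightarrow> p \<in> polys A x n \<Longrightarrow> a \<otimes> p \<in> polys A x n"
proof (induction n arbitrary: p)
  case 0 then show ?case using A_carrier by simp
next
  case (Suc n)
  obtain b m where p: "p = b \<otimes> x [^] n \<oplus> m" "b \<in> A" "m \<in> polys A x n" using Suc.prems(2) by (rule polys_SucE)
  have c: "a \<in> carrier R" "b \<in> carrier R" "m \<in> carrier R" "x [^] n \<in> carrier R"
    using p Suc.prems A_carrier polys_carrier x by auto
  have "a \<otimes> p = (a \<otimes> b) \<otimes> x [^] n \<oplus> a \<otimes> m" unfolding p using c by algebra
  then show ?case using polys_SucI[OF subringE(6)[OF A Suc.prems(1) p(2)] Suc.IH[OF Suc.prems(1) p(3)]] by simp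
qed

lemma polys_shift: "p \<in> polys A x n \<Longrightarrow> x \<otimes> p \<in> polys A x (Suc n)"
proof (induction n arbitrary: p)
  case 0 then show ?case using x polys_zero[of "Suc 0"] by simp
next
  case (Suc n)
  obtain b m where p: "p = b \<otimes> x [^] n \<oplus> m" "b \<in> A" "m \<in> polys A x n" using Suc.prems by (rule polys_SucE)
  have c: "b \<in> carrier R" "m \<in> carrier R" "x [^] n \<in> carrier R"
    using p A_carrier polys_carrier x by auto
  have "x \<otimes> p = b \<otimes> (x [^] n \<otimes> x) \<oplus> x \<otimes> m" unfolding p using c x by algebra
  then show ?case using polys_SucI[OF p(2) Suc.IH[OF p(3)]] by simp
qed

lemma polys_shift_pow: "p \<in> polys A x n \<Longrightarrow> x [^] (k::nat) \<otimes> p \<in> polys A x (k + n)"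
proof (induction k)
  case 0 then show ?case using polys_carrier by simp
next
  case (Suc k)
  have "x [^] Suc k \<otimes> p = x \<otimes> (x [^] k \<otimes> p)" using x polys_carrier[OF Suc.prems] by (simp add: m_ac)
  then show ?case using polys_shift[OF Suc.IH[OF Suc.prems]] by simp
qed

lemma polys_mult: "p \<in> polys A x m \<Longrightarrow> q \<in> polys A x n \<Longrightarrow> p \<otimes> q \<in> polys A x (m + n)"
proof (induction m arbitrary: p)
  case 0 then show ?case using polys_carrier polys_zero by simp
next
  case (Suc m)
  obtain a p' where p: "p = a \<otimes> x [^] m \<oplus> p'" "a \<in> A" "p' \<in> polys A x m" using Suc.prems(1) by (rule polys_SucE)
  have c: "a \<in> carrier R" "p' \<in> carrier R" "q \<in> carrier R" "x [^] m \<in> carrier R"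
    using p Suc.prems A_carrier polys_carrier x by auto
  have "p \<otimes> q = a \<otimes> (x [^] m \<otimes> q) \<oplus> p' \<otimes> q" unfolding p using c by algebra
  moreover have "a \<otimes> (x [^] m \<otimes> q) \<oplus> p' \<otimes> q \<in> polys A x (m + n)"
    by (intro polys_add polys_scale polys_shift_pow Suc.IH p Suc.prems)
  ultimately show ?case using polys_mono[of "p \<otimes> q" "m + n" "Suc m + n"] by simp
qed

lemma polys_const: "a \<in> A \<Longrightarrow> a \<in> polys A x (Suc 0)"
  using polys_SucI[of a \<zero> 0] A_carrier by simp

lemma polys_x: "x \<in> polys A x (Suc (Suc 0))"
  using polys_shift[OF polys_const[OF subringE(3)[OF A]]] x by simp

lemma adjoin_incl: "A \<subseteq> adjoin A x" "x \<in> adjoin A x"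
  using polys_const polys_x by (auto simp: adjoin_def simp del: polys.simps)

lemma adjoin_subring: "subring (adjoin A x) R"
proof (rule subringI)
  show "adjoin A x \<subseteq> carrier R" using polys_carrier by (auto simp: adjoin_def)
  show "\<one> \<in> adjoin A x" using adjoin_incl(1) subringE(3)[OF A] by blast
  show "\<ominus> h \<in> adjoin A x" if "h \<in> adjoin A x" for h
  proof -
    obtain n where n: "h \<in> polys A x n" using \<open>h \<in> adjoin A x\<close> by (auto simp: adjoin_def)
    have "\<ominus> \<one> \<in> A" using subringE(3,5)[OF A] by blast
    then have "(\<ominus> \<one>) \<otimes> h \<in> polys A x n" using polys_scale n by blast
    then have "\<ominus> h \<in> polys A x n" using polys_carrier[OF n] by (simp add: l_minus)
    then show ?thesis by (auto simp: adjoin_def)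
  qed
  show "h \<otimes> k \<in> adjoin A x" "h \<oplus> k \<in> adjoin A x" if hk: "h \<in> adjoin A x" "k \<in> adjoin A x" for h k
  proof -
    obtain m n where mn: "h \<in> polys A x m" "k \<in> polys A x n" using hk by (auto simp: adjoin_def)
    then have "h \<otimes> k \<in> polys A x (m + n)" "h \<in> polys A x (m + n)" "k \<in> polys A x (m + n)"
      using polys_mult polys_mono[of h m "m + n"] polys_mono[of k n "m + n"] by auto
    then show "h \<otimes> k \<in> adjoin A x" "h \<oplus> k \<in> adjoin A x" using polys_add unfolding adjoin_def by blast+
  qed
qed

text \<open>The leading coefficients of the polynomial expressions of degree \<open>n\<close> in \<open>J\<close>. As \<open>x\<close> may be
  algebraic over \<open>A\<close>, an element can have several leading coefficients.\<close>

definition lead where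
  "lead J n = {a \<in> A. \<exists>m\<in>polys A x n. a \<otimes> x [^] n \<oplus> m \<in> J}"

lemma leadI: "a \<in> A \<Longrightarrow> m \<in> polys A x n \<Longrightarrow> a \<otimes> x [^] n \<oplus> m \<in> J \<Longrightarrow> a \<in> lead J n"
  by (auto simp: lead_def)

lemma lead_ideal:
  assumes J: "relative_ideal (adjoin A x) J"
  shows "relative_ideal A (lead J n)"
  unfolding relative_ideal_def
proof (intro conjI ballI)
  show "lead J n \<subseteq> A" by (auto simp: lead_def)
  have "\<zero> \<otimes> x [^] n \<oplus> \<zero> \<in> J" using relative_idealD(2)[OF J] x by simp
  then show "\<zero> \<in> lead J n" unfolding lead_def using polys_zero subringE(2)[OF A] by blast
next
  fix a b assume "a \<in> lead J n" "b \<in> lead J n"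
  then obtain m k where mk: "a \<in> A" "m \<in> polys A x n" "a \<otimes> x [^] n \<oplus> m \<in> J" "b \<in> A" "k \<in> polys A x n" "b \<otimes> x [^] n \<oplus> k \<in> J"
    by (auto simp: lead_def)
  have c: "a \<in> carrier R" "b \<in> carrier R" "m \<in> carrier R" "k \<in> carrier R" "x [^] n \<in> carrier R"
    using mk A_carrier polys_carrier x by auto
  have "(a \<oplus> b) \<otimes> x [^] n \<oplus> (m \<oplus> k) = (a \<otimes> x [^] n \<oplus> m) \<oplus> (b \<otimes> x [^] n \<oplus> k)" using c by algebra
  then show "a \<oplus> b \<in> lead J n"
    using leadI[OF subringE(7)[OF A mk(1,4)] polys_add[OF mk(2,5)]] relative_idealD(3)[OF J mk(3,6)] by simp
next
  fix r a assume r: "r \<in> A" and "a \<in> lead J n"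
  then obtain m where m: "a \<in> A" "m \<in> polys A x n" "a \<otimes> x [^] n \<oplus> m \<in> J" by (auto simp: lead_def)
  have c: "a \<in> carrier R" "r \<in> carrier R" "m \<in> carrier R" "x [^] n \<in> carrier R"
    using m r A_carrier polys_carrier x by auto
  have "(r \<otimes> a) \<otimes> x [^] n \<oplus> r \<otimes> m = r \<otimes> (a \<otimes> x [^] n \<oplus> m)" using c by algebra
  moreover have "r \<in> adjoin A x" using adjoin_incl(1) r by blast
  ultimately show "r \<otimes> a \<in> lead J n"
    using leadI[OF subringE(6)[OF A r m(1)] polys_scale[OF r m(2)]] relative_idealD(4)[OF J _ m(3)] by simp
qed

lemma lead_Suc:
  assumes J: "relative_ideal (adjoin A x) J"
  shows "lead J n \<subseteq> lead J (Suc n)"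
proof
  fix a assume "a \<in> lead J n"
  then obtain m where m: "a \<in> A" "m \<in> polys A x n" "a \<otimes> x [^] n \<oplus> m \<in> J" by (auto simp: lead_def)
  have c: "a \<in> carrier R" "m \<in> carrier R" "x [^] n \<in> carrier R"
    using m A_carrier polys_carrier x by auto
  have "a \<otimes> (x [^] n \<otimes> x) \<oplus> x \<otimes> m = x \<otimes> (a \<otimes> x [^] n \<oplus> m)" using c x by algebra
  then have "a \<otimes> x [^] Suc n \<oplus> x \<otimes> m \<in> J" using relative_idealD(4)[OF J adjoin_incl(2) m(3)] by simp
  then show "a \<in> lead J (Suc n)" by (rule leadI[OF m(1) polys_shift[OF m(2)]])
qed

lemma lead_mono: "relative_ideal (adjoin A x) J \<Longrightarrow> n \<le> k \<Longrightarrow> lead J n \<subseteq> lead J k"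
  using lift_Suc_mono_le[of "lead J"] lead_Suc by blast

text \<open>Two nested ideals with the same leading coefficients in every degree are equal: subtract an
  element of the smaller one with the same leading term and induct on the degree.\<close>

lemma ideal_subset_by_lead:
  assumes J: "relative_ideal (adjoin A x) J" and K: "relative_ideal (adjoin A x) K" and KJ: "K \<subseteq> J"
    and lead: "\<And>n. lead J n \<subseteq> lead K n"
  shows "J \<subseteq> K"
proof -
  have "p \<in> K" if "p \<in> J" "p \<in> polys A x n" for p n
    using that
  proof (induction n arbitrary: p)
    case 0 then show ?case using relative_idealD(2)[OF K] by simp
  next
    case (Suc n)
    obtain a m where p: "p = a \<otimes> x [^] n \<oplus> m" "a \<in> A" "m \<in> polys A x n" using Suc.prems(2) by (rule polys_SucE)
    then have "a \<in> lead J n" using Suc.prems unfolding lead_def by blast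
    then obtain k where k: "k \<in> polys A x n" "a \<otimes> x [^] n \<oplus> k \<in> K" using lead unfolding lead_def by blast
    let ?q = "a \<otimes> x [^] n \<oplus> k"
    have c: "a \<in> carrier R" "m \<in> carrier R" "k \<in> carrier R" "x [^] n \<in> carrier R"
      using p k A_carrier polys_carrier x by auto
    have neg: "\<ominus> \<one> \<in> A" using subringE(3,5)[OF A] by blast
    have "p \<oplus> (\<ominus> \<one>) \<otimes> ?q = m \<oplus> (\<ominus> \<one>) \<otimes> k" unfolding p using c by algebra
    moreover have "p \<oplus> (\<ominus> \<one>) \<otimes> ?q \<in> J"
      using relative_idealD(3,4)[OF J] Suc.prems k KJ neg adjoin_incl(1) by blast
    moreover have "m \<oplus> (\<ominus> \<one>) \<otimes> k \<in> polys A x n" using polys_add polys_scale p k neg by blast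
    ultimately have "m \<oplus> (\<ominus> \<one>) \<otimes> k \<in> K" using Suc.IH by simp
    then have "?q \<oplus> (m \<oplus> (\<ominus> \<one>) \<otimes> k) \<in> K" using relative_idealD(3)[OF K] k by blast
    moreover have "?q \<oplus> (m \<oplus> (\<ominus> \<one>) \<otimes> k) = p" unfolding p using c by algebra
    ultimately show ?case by simp
  qed
  then show ?thesis using relative_idealD(1)[OF J] by (auto simp: adjoin_def)
qed

text \<open>Hilbert's basis theorem in its classical form: generators of the leading coefficient ideals in
  the finitely many degrees before these ideals become constant lift to generators of the ideal.\<close>

lemma noetherian_adjoin:
  assumes noeth: "noetherian_subring A"
  shows "noetherian_subring (adjoin A x)"
  unfolding noetherian_subring_def
proof (intro conjI allI impI adjoin_subring)
  fix J assume J: "relative_ideal (adjoin A x) J"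
  have gen: "\<exists>F. finite F \<and> F \<subseteq> L \<and> (\<forall>K. relative_ideal A K \<and> F \<subseteq> K \<longrightarrow> L \<subseteq> K)" if "relative_ideal A L" for L
    using noeth that by (simp add: noetherian_subring_def)
  have "relative_ideal A (\<Union>n. lead J n)"
  proof -
    have "a \<oplus> b \<in> (\<Union>n. lead J n)" if "a \<in> lead J m" "b \<in> lead J n" for a b m n
    proof -
      have "a \<in> lead J (max m n)" "b \<in> lead J (max m n)"
        using that lead_mono[OF J, of m "max m n"] lead_mono[OF J, of n "max m n"] by auto
      then show ?thesis using relative_idealD(3)[OF lead_ideal[OF J]] by blast
    qed
    moreover have "r \<otimes> a \<in> (\<Union>n. lead J n)" if "r \<in> A" "a \<in> (\<Union>n. lead J n)" for r a
      using that relative_idealD(4)[OF lead_ideal[OF J]] by auto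
    moreover have "(\<Union>n. lead J n) \<subseteq> A" "\<zero> \<in> (\<Union>n. lead J n)"
      using relative_idealD(1,2)[OF lead_ideal[OF J]] by auto
    ultimately show ?thesis unfolding relative_ideal_def by auto
  qed
  then obtain F where F: "finite F" "F \<subseteq> (\<Union>n. lead J n)" "\<And>K. relative_ideal A K \<Longrightarrow> F \<subseteq> K \<Longrightarrow> (\<Union>n. lead J n) \<subseteq> K"
    using gen by metis
  obtain N where N: "F \<subseteq> lead J N"
  proof -
    have "\<exists>N. F \<subseteq> lead J N" using F(1,2)
    proof (induction F)
      case (insert a F)
      then obtain N n where "F \<subseteq> lead J N" "a \<in> lead J n" by auto
      then have "insert a F \<subseteq> lead J (max N n)"
        using lead_mono[OF J, of N "max N n"] lead_mono[OF J, of n "max N n"] by auto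
      then show ?case by blast
    qed simp
    then show thesis using that by blast
  qed
  then have stable: "lead J n \<subseteq> lead J N" for n using F(3)[OF lead_ideal[OF J]] by blast
  obtain Fn where Fn: "\<And>n. finite (Fn n)" "\<And>n. Fn n \<subseteq> lead J n"
    "\<And>n K. relative_ideal A K \<Longrightarrow> Fn n \<subseteq> K \<Longrightarrow> lead J n \<subseteq> K"
    using gen[OF lead_ideal[OF J]] by metis
  have "\<forall>n a. \<exists>m. a \<in> Fn n \<longrightarrow> m \<in> polys A x n \<and> a \<otimes> x [^] n \<oplus> m \<in> J"
    using Fn(2) unfolding lead_def by blast
  then obtain \<mu> where \<mu>: "\<And>n a. a \<in> Fn n \<Longrightarrow> \<mu> n a \<in> polys A x n" "\<And>n a. a \<in> Fn n \<Longrightarrow> a \<otimes> x [^] n \<oplus> \<mu> n a \<in> J"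
    by metis
  let ?F = "\<Union>n\<in>{..N}. (\<lambda>a. a \<otimes> x [^] n \<oplus> \<mu> n a) ` Fn n"
  show "\<exists>F. finite F \<and> F \<subseteq> J \<and> (\<forall>K. relative_ideal (adjoin A x) K \<and> F \<subseteq> K \<longrightarrow> J \<subseteq> K)"
  proof (intro exI[of _ ?F] conjI allI impI)
    show "finite ?F" using Fn(1) by simp
    show "?F \<subseteq> J" using \<mu>(2) by auto
    fix K assume K: "relative_ideal (adjoin A x) K \<and> ?F \<subseteq> K"
    then have JK: "relative_ideal (adjoin A x) (J \<inter> K)" using relative_ideal_Int[OF J] by blast
    have low: "lead J n \<subseteq> lead (J \<inter> K) n" if "n \<le> N" for n
    proof (rule Fn(3)[OF lead_ideal[OF JK]])
      show "Fn n \<subseteq> lead (J \<inter> K) n"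
      proof
        fix a assume a: "a \<in> Fn n"
        then have "a \<in> A" using Fn(2) by (auto simp: lead_def)
        moreover have "a \<otimes> x [^] n \<oplus> \<mu> n a \<in> K" using K a \<open>n \<le> N\<close> by blast
        ultimately show "a \<in> lead (J \<inter> K) n" unfolding lead_def using \<mu>[OF a] by blast
      qed
    qed
    have "lead J n \<subseteq> lead (J \<inter> K) n" for n
    proof (cases "n \<le> N")
      case False
      then show ?thesis using stable[of n] low[of N] lead_mono[OF JK, of N n] by auto
    qed (rule low)
    then have "J \<subseteq> J \<inter> K" using ideal_subset_by_lead[OF J JK] by blast
    then show "J \<subseteq> K" by blast
  qed
qed

end

lemma noetherian_adjoin_finite:
  assumes "finite E" "E \<subseteq> carrier R" "noetherian_subring A"
  obtains A' where "noetherian_subring A'" "A \<subseteq> A'" "E \<subseteq> A'"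
proof -
  have "\<exists>A'. noetherian_subring A' \<and> A \<subseteq> A' \<and> E \<subseteq> A'"
    using assms(1,2)
  proof (induction E)
    case empty then show ?case using assms(3) by blast
  next
    case (insert x E)
    then obtain A' where A': "noetherian_subring A'" "A \<subseteq> A'" "E \<subseteq> A'" by auto
    then have sub: "subring A' R" by (simp add: noetherian_subring_def)
    have x: "x \<in> carrier R" using insert.prems by simp
    show ?case
      using noetherian_adjoin[OF sub x A'(1)] adjoin_incl[OF sub x] A'
      by (intro exI[of _ "adjoin A' x"]) blast
  qed
  then show thesis using that by blast
qed

lemma noetherian_subring_carrier:
  assumes "noetherian_subring (carrier R)"
  shows "noetherian_ring R"
proof (rule noetherian_ringI)
  fix J assume J: "ideal J R"
  then interpret J: ideal J R .
  have "relative_ideal (carrier R) J" unfolding relative_ideal_def using J.Icarr J.I_l_closed by auto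
  then obtain F where F: "finite F" "F \<subseteq> J" "\<And>K. relative_ideal (carrier R) K \<Longrightarrow> F \<subseteq> K \<Longrightarrow> J \<subseteq> K"
    using assms unfolding noetherian_subring_def by metis
  have Fc: "F \<subseteq> carrier R" using F(2) J.Icarr by blast
  interpret I: ideal "Idl F" R using genideal_ideal[OF Fc] .
  have "relative_ideal (carrier R) (Idl F)" unfolding relative_ideal_def using I.Icarr I.I_l_closed by auto
  then have "J \<subseteq> Idl F" using F(3) genideal_self[OF Fc] by blast
  then have "J = Idl F" using genideal_minimal[OF J F(2)] by blast
  then show "\<exists>A\<subseteq>carrier R. finite A \<and> J = Idl A" using Fc F(1) by blast
qed

end

lemma (in ring_hom_cring) noetherian_image:
  assumes "noetherian_ring R"
  shows "S.noetherian_subring (h ` carrier R)"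
  unfolding S.noetherian_subring_def
proof (intro conjI allI impI)
  show "subring (h ` carrier R) S" by (rule ring.img_is_subring[OF R.carrier_is_subring])
  have id: "ideal {a \<in> carrier R. h a \<in> K} R" if K: "S.relative_ideal (h ` carrier R) K" for K
    by (rule R.ideal_criterion) (use S.relative_idealD[OF K] in auto)
  fix J assume J: "S.relative_ideal (h ` carrier R) J"
  obtain F where F: "F \<subseteq> carrier R" "finite F" "{a \<in> carrier R. h a \<in> J} = Idl\<^bsub>R\<^esub> F"
    using noetherian_ring.finetely_gen[OF assms id[OF J]] by blast
  show "\<exists>F. finite F \<and> F \<subseteq> J \<and> (\<forall>K. S.relative_ideal (h ` carrier R) K \<and> F \<subseteq> K \<longrightarrow> J \<subseteq> K)"
  proof (intro exI[of _ "h ` F"] conjI allI impI)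
    show "finite (h ` F)" using F by simp
    show "h ` F \<subseteq> J" using R.genideal_self[OF F(1)] F(3) by blast
    fix K assume K: "S.relative_ideal (h ` carrier R) K \<and> h ` F \<subseteq> K"
    then have "Idl\<^bsub>R\<^esub> F \<subseteq> {a \<in> carrier R. h a \<in> K}" using F(1) id by (intro R.genideal_minimal) auto
    then show "J \<subseteq> K" using F(3) S.relative_idealD(1)[OF J] by blast
  qed
qed

section \<open>The Rees algebra\<close>

lemma (in ideal) finsum_in_ideal:
  assumes "finite A" "\<And>i. i \<in> A \<Longrightarrow> g i \<in> I"
  shows "finsum R g A \<in> I"
  using assms
proof (induction A)
  case (insert i A)
  then have "g \<in> A \<rightarrow> carrier R" "g i \<in> carrier R" using Icarr by auto
  then show ?case using insert by (simp add: a_closed)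
qed simp

locale rees_algebra = R?: cring R for R :: "('a, 'm) ring_scheme" (structure) +
  fixes I :: "'a set"
  assumes I: "ideal I R"
begin

sublocale UP: UP_cring R "UP R"
  by unfold_locales

definition Ip where "Ip n = ideal_power R I n"

abbreviation mon where "mon a n \<equiv> monom (UP R) a n"

abbreviation co where "co p n \<equiv> coeff (UP R) p n"

abbreviation B where "B \<equiv> rees R I"

abbreviation G where "G \<equiv> rees_grading R I"

lemma Ip_0: "Ip 0 = carrier R"
  by (simp add: Ip_def nat_pow_def ideals_set_def)

lemma Ip_Suc: "Ip (Suc n) = ideal_prod R (Ip n) I"
  by (simp add: Ip_def nat_pow_def ideals_set_def)

lemma Ip_ideal: "ideal (Ip n) R"
proof (induction n)
  case 0 then show ?case using oneideal by (simp add: Ip_0)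
next
  case (Suc n) then show ?case using ideal_prod_is_ideal[OF _ I] by (simp add: Ip_Suc)
qed

lemma Ip_carrier: "a \<in> Ip n \<Longrightarrow> a \<in> carrier R"
  by (rule ideal.Icarr[OF Ip_ideal])

lemma I_carrier: "a \<in> I \<Longrightarrow> a \<in> carrier R"
  by (rule ideal.Icarr[OF I])

lemma Ip_Suc_induct [consumes 1, case_names prod sum]:
  assumes a: "a \<in> Ip (Suc n)"
    and prod: "\<And>i j. i \<in> Ip n \<Longrightarrow> j \<in> I \<Longrightarrow> Q (i \<otimes> j)"
    and sum: "\<And>x y. \<lbrakk>x \<in> carrier R; y \<in> carrier R; Q x; Q y\<rbrakk> \<Longrightarrow> Q (x \<oplus> y)"
  shows "Q a"
proof -
  have "a \<in> ideal_prod R (Ip n) I" using a by (simp add: Ip_Suc)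
  then have "a \<in> carrier R \<and> Q a"
  proof (induction rule: ideal_prod.induct)
    case (prod i j) then show ?case using assms(2) Ip_carrier I_carrier by auto
  next
    case (sum x y) then show ?case using assms(3) by auto
  qed
  then show ?thesis ..
qed

lemma Ip_SucI: "i \<in> Ip n \<Longrightarrow> j \<in> I \<Longrightarrow> i \<otimes> j \<in> Ip (Suc n)"
  unfolding Ip_Suc by (rule ideal_prod.prod)

lemma Ip_pow: "h \<in> I \<Longrightarrow> h [^] (n::nat) \<in> Ip n"
  by (induction n) (simp_all add: Ip_0 Ip_SucI)

lemma Ip_1: "a \<in> I \<Longrightarrow> a \<in> Ip 1"
  using Ip_SucI[of \<one> 0 a] I_carrier by (simp add: Ip_0)

lemma Ip_mult: "a \<in> Ip m \<Longrightarrow> b \<in> Ip n \<Longrightarrow> a \<otimes> b \<in> Ip (m + n)"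
proof (induction n arbitrary: b)
  case 0 then show ?case using ideal.I_r_closed[OF Ip_ideal] by (simp add: Ip_0)
next
  case (Suc n)
  have a: "a \<in> carrier R" using Suc.prems Ip_carrier by blast
  from Suc.prems(2) show ?case
  proof (induction rule: Ip_Suc_induct)
    case (prod i j)
    have "a \<otimes> (i \<otimes> j) = (a \<otimes> i) \<otimes> j" using a prod Ip_carrier I_carrier by (simp add: m_assoc)
    then show ?case using Ip_SucI[OF Suc.IH[OF Suc.prems(1) prod(1)] prod(2)] by simp
  next
    case (sum x y)
    have "a \<otimes> (x \<oplus> y) = a \<otimes> x \<oplus> a \<otimes> y" using a sum by (simp add: r_distr)
    then show ?case using sum additive_subgroup.a_closed[OF ideal.axioms(1)[OF Ip_ideal]] by simp
  qed
qed

lemma rees_ops [simp]: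
  "p \<otimes>\<^bsub>B\<^esub> q = p \<otimes>\<^bsub>UP R\<^esub> q" "p \<oplus>\<^bsub>B\<^esub> q = p \<oplus>\<^bsub>UP R\<^esub> q" "\<one>\<^bsub>B\<^esub> = \<one>\<^bsub>UP R\<^esub>" "\<zero>\<^bsub>B\<^esub> = \<zero>\<^bsub>UP R\<^esub>"
  by (simp_all add: rees_def)

lemma rees_carrier: "p \<in> carrier B \<longleftrightarrow> p \<in> carrier (UP R) \<and> (\<forall>n. co p n \<in> Ip n)"
  by (simp add: rees_def Ip_def)

lemma rees_subring: "subring (carrier B) (UP R)"
proof (rule UP.P.subringI)
  have z: "\<zero> \<in> Ip n" for n using additive_subgroup.zero_closed[OF ideal.axioms(1)[OF Ip_ideal]] .
  show "carrier B \<subseteq> carrier (UP R)" by (auto simp: rees_carrier)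
  show "\<one>\<^bsub>UP R\<^esub> \<in> carrier B" using z by (simp add: rees_carrier Ip_0)
  show "\<ominus>\<^bsub>UP R\<^esub> p \<in> carrier B" if "p \<in> carrier B" for p
    using that additive_subgroup.a_inv_closed[OF ideal.axioms(1)[OF Ip_ideal]] by (simp add: rees_carrier)
  show "p \<oplus>\<^bsub>UP R\<^esub> q \<in> carrier B" if "p \<in> carrier B" "q \<in> carrier B" for p q
    using that additive_subgroup.a_closed[OF ideal.axioms(1)[OF Ip_ideal]] by (simp add: rees_carrier)
  show "p \<otimes>\<^bsub>UP R\<^esub> q \<in> carrier B" if "p \<in> carrier B" "q \<in> carrier B" for p q
  proof -
    have "co p i \<otimes> co q (n - i) \<in> Ip n" if "i \<le> n" for i n
      using Ip_mult[of "co p i" i "co q (n - i)" "n - i"] that \<open>p \<in> carrier B\<close> \<open>q \<in> carrier B\<close> by (simp add: rees_carrier)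
    then have "(\<Oplus>i\<in>{..n}. co p i \<otimes> co q (n - i)) \<in> Ip n" for n
      by (intro ideal.finsum_in_ideal[OF Ip_ideal]) auto
    then show ?thesis using that by (simp add: rees_carrier)
  qed
qed

lemma rees_cring: "cring B"
proof -
  have "cring ((UP R)\<lparr>carrier := carrier B\<rparr>)"
    using UP.P.subcringI'[OF rees_subring] UP.P.subcring_iff[OF subringE(1)[OF rees_subring]] by simp
  then show ?thesis by (simp add: rees_def)
qed

lemma mon_in_rees: "a \<in> Ip n \<Longrightarrow> mon a n \<in> carrier B"
  using additive_subgroup.zero_closed[OF ideal.axioms(1)[OF Ip_ideal]] Ip_carrier[of a n] by (auto simp: rees_carrier)

lemma mon_G: "a \<in> Ip n \<Longrightarrow> mon a n \<in> G n"
  by (auto simp: rees_grading_def Ip_def)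

lemma G_E:
  assumes "x \<in> G n" obtains a where "x = mon a n" "a \<in> Ip n"
  using assms by (auto simp: rees_grading_def Ip_def)

lemma coeff_mult_mon:
  assumes r: "r \<in> carrier (UP R)" and b: "b \<in> carrier R"
  shows "co (r \<otimes>\<^bsub>UP R\<^esub> mon b j) k = (if j \<le> k then co r (k - j) \<otimes> b else \<zero>)"
proof -
  have "co (r \<otimes>\<^bsub>UP R\<^esub> mon b j) k = (\<Oplus>i\<in>{..k}. if i + j = k then co r i \<otimes> b else \<zero>)"
    using r b by (simp, intro R.finsum_cong') auto
  also have "\<dots> = (if j \<le> k then co r (k - j) \<otimes> b else \<zero>)"
  proof (cases "j \<le> k")
    case True
    have "(\<Oplus>i\<in>{..k}. if i + j = k then co r i \<otimes> b else \<zero>) = (\<Oplus>i\<in>{..k}. if k - j = i then co r i \<otimes> b else \<zero>)"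
      using True r b by (intro R.finsum_cong') auto
    also have "\<dots> = co r (k - j) \<otimes> b"
      using R.finsum_singleton[of "k - j" "{..k}" "\<lambda>i. co r i \<otimes> b"] r b by simp
    finally show ?thesis using True by simp
  next
    case False
    then have "(\<Oplus>i\<in>{..k}. if i + j = k then co r i \<otimes> b else \<zero>) = (\<Oplus>i\<in>{..k}. \<zero>)"
      by (intro R.finsum_cong') auto
    then show ?thesis using False by simp
  qed
  finally show ?thesis .
qed

sublocale graded: graded_ring B G "\<lambda>n p. mon (co p n) n"
proof (intro graded_ring.intro rees_cring graded_ring_axioms.intro)
  show "x \<in> carrier B" if "x \<in> G n" for x n using that mon_in_rees by (auto elim: G_E)
  show "mon (co x n) n \<in> G n" if "x \<in> carrier B" for x n using that mon_G by (simp add: rees_carrier)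
  show "mon (co x n) n = x" if "x \<in> G n" for x n using that Ip_carrier by (auto elim!: G_E)
  show "mon (co x m) m = \<zero>\<^bsub>B\<^esub>" if "x \<in> G n" "m \<noteq> n" for x m n using that Ip_carrier by (auto elim!: G_E)
  show "mon (co (x \<oplus>\<^bsub>B\<^esub> y) n) n = mon (co x n) n \<oplus>\<^bsub>B\<^esub> mon (co y n) n" if "x \<in> carrier B" "y \<in> carrier B" for x y n
    using that by (simp add: rees_carrier)
  show "mon (co (r \<otimes>\<^bsub>B\<^esub> y) k) k = (if j \<le> k then mon (co r (k - j)) (k - j) \<otimes>\<^bsub>B\<^esub> y else \<zero>\<^bsub>B\<^esub>)"
    if r: "r \<in> carrier B" and y: "y \<in> G j" for r y j k
  proof -
    obtain b where b: "y = mon b j" "b \<in> Ip j" using y by (rule G_E)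
    have rc: "r \<in> carrier (UP R)" using r by (simp add: rees_carrier)
    have bc: "b \<in> carrier R" using b(2) by (rule Ip_carrier)
    show ?thesis
    proof (cases "j \<le> k")
      case True
      have "mon (co r (k - j) \<otimes> b) (k - j + j) = mon (co r (k - j)) (k - j) \<otimes>\<^bsub>UP R\<^esub> mon b j"
        by (rule UP.monom_mult) (use rc bc in auto)
      then have "mon (co r (k - j) \<otimes> b) k = mon (co r (k - j)) (k - j) \<otimes>\<^bsub>UP R\<^esub> mon b j"
        by (simp only: le_add_diff_inverse2[OF True])
      then show ?thesis
        unfolding b(1) rees_ops coeff_mult_mon[OF rc bc] using True by (simp only: if_True)
    next
      case False
      then show ?thesis unfolding b(1) rees_ops coeff_mult_mon[OF rc bc] by simp
    qed
  qed
  show "x \<in> M" if x: "x \<in> carrier B" and M: "\<zero>\<^bsub>B\<^esub> \<in> M" "\<And>a b. \<lbrakk>a \<in> M; b \<in> M\<rbrakk> \<Longrightarrow> a \<oplus>\<^bsub>B\<^esub> b \<in> M"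
    "\<And>n. mon (co x n) n \<in> M" for x M
  proof -
    have xc: "x \<in> carrier (UP R)" using x by (simp add: rees_carrier)
    then have mc: "mon (co x i) i \<in> carrier (UP R)" for i by simp
    have "(\<Oplus>\<^bsub>UP R\<^esub>i\<in>{..N}. mon (co x i) i) \<in> M" for N
    proof (induction N)
      case 0
      then show ?case using UP.P.finsum_0[of "\<lambda>i. mon (co x i) i"] mc M(3)[of 0] by simp
    next
      case (Suc N)
      then show ?case using UP.P.finsum_Suc[of "\<lambda>i. mon (co x i) i" N] mc M(2)[OF M(3)[of "Suc N"] Suc] by simp
    qed
    then show ?thesis using UP.up_repr[OF xc] by metis
  qed
  show "\<one>\<^bsub>B\<^esub> \<in> G 0" using mon_G[of \<one> 0] by (simp add: Ip_0)
qed

lemma mon_hom: "ring_hom_cring R B (\<lambda>a. mon a 0)"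
proof (intro ring_hom_cring.intro R.is_cring rees_cring ring_hom_cring_axioms.intro ring_hom_memI)
  fix x y assume x: "x \<in> carrier R" and y: "y \<in> carrier R"
  show "mon x 0 \<in> carrier B" using mon_in_rees[of x 0] x by (simp add: Ip_0)
  show "mon (x \<otimes> y) 0 = mon x 0 \<otimes>\<^bsub>B\<^esub> mon y 0" using UP.monom_mult[OF x y, of 0 0] by simp
  show "mon (x \<oplus> y) 0 = mon x 0 \<oplus>\<^bsub>B\<^esub> mon y 0" using x y by simp
qed simp

sublocale base: ring_hom_cring R B "\<lambda>a. mon a 0"
  by (rule mon_hom)

text \<open>Elements of positive degree are sums of products that have a factor of degree one.\<close>

lemma mon_Suc_in:
  assumes M: "\<And>i j. i \<in> Ip n \<Longrightarrow> j \<in> I \<Longrightarrow> mon i n \<otimes>\<^bsub>B\<^esub> mon j 1 \<in> M"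
    "\<And>x y. x \<in> M \<Longrightarrow> y \<in> M \<Longrightarrow> x \<oplus>\<^bsub>B\<^esub> y \<in> M" and a: "a \<in> Ip (Suc n)"
  shows "mon a (Suc n) \<in> M"
  using a
proof (induction rule: Ip_Suc_induct)
  case (prod i j)
  have "mon (i \<otimes> j) (Suc n) = mon i n \<otimes>\<^bsub>B\<^esub> mon j 1"
    using UP.monom_mult[OF Ip_carrier[OF prod(1)] I_carrier[OF prod(2)], of n 1] by simp
  then show ?case using M(1) prod by simp
next
  case (sum x y)
  then show ?case using M(2)[OF sum(3,4)] by simp
qed

lemma degree_one:
  assumes p: "p \<in> proj_points B G"
  shows "\<exists>g\<in>G 1. g \<notin> p"
proof (rule ccontr)
  assume no: "\<not> (\<exists>g\<in>G 1. g \<notin> p)"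
  interpret p: primeideal p B using graded.proj_prime[OF p] .
  have "G n \<subseteq> p" if "0 < n" for n
  proof
    obtain m where n: "n = Suc m" using \<open>0 < n\<close> by (cases n) auto
    fix x assume "x \<in> G n"
    then obtain a where a: "x = mon a n" "a \<in> Ip n" by (rule G_E)
    have "mon i m \<otimes>\<^bsub>B\<^esub> mon j 1 \<in> p" if "i \<in> Ip m" "j \<in> I" for i j
      using p.I_l_closed[of "mon j 1" "mon i m"] no mon_G[OF Ip_1[OF that(2)]] mon_in_rees[OF that(1)] by blast
    then show "x \<in> p" using mon_Suc_in[of m p a] a n p.a_closed by blast
  qed
  then show False using p by (auto simp: proj_points_def)
qed

lemma rees_noetherian:
  assumes noeth: "noetherian_ring R"
  shows "noetherian_ring B"
proof (rule graded.noetherian_subring_carrier)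
  obtain F where F: "F \<subseteq> carrier R" "finite F" "I = Idl F"
    using noetherian_ring.finetely_gen[OF noeth I] by blast
  have FI: "F \<subseteq> I" using R.genideal_self[OF F(1)] F(3) by simp
  have "(\<lambda>a. mon a 1) ` F \<subseteq> carrier B" using mon_in_rees Ip_1 FI by blast
  then obtain A where A: "graded.noetherian_subring A" "(\<lambda>a. mon a 0) ` carrier R \<subseteq> A" "(\<lambda>a. mon a 1) ` F \<subseteq> A"
    using graded.noetherian_adjoin_finite[OF finite_imageI[OF F(2)] _ base.noetherian_image[OF noeth]] by metis
  have sub: "subring A B" using A(1) by (simp add: graded.noetherian_subring_def)
  have one: "mon a 1 \<in> A" if "a \<in> I" for a
  proof -
    have "ideal {a \<in> I. mon a 1 \<in> A} R"
    proof (rule R.ideal_criterion)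
      show "{a \<in> I. mon a 1 \<in> A} \<subseteq> carrier R" using I_carrier by auto
      show "\<zero> \<in> {a \<in> I. mon a 1 \<in> A}"
        using additive_subgroup.zero_closed[OF ideal.axioms(1)[OF I]] subringE(2)[OF sub] by simp
      show "x \<oplus> y \<in> {a \<in> I. mon a 1 \<in> A}" if "x \<in> {a \<in> I. mon a 1 \<in> A}" "y \<in> {a \<in> I. mon a 1 \<in> A}" for x y
        using that additive_subgroup.a_closed[OF ideal.axioms(1)[OF I]] subringE(7)[OF sub] I_carrier by simp
      show "r \<otimes> x \<in> {a \<in> I. mon a 1 \<in> A}" if r: "r \<in> carrier R" and x: "x \<in> {a \<in> I. mon a 1 \<in> A}" for r x
      proof -
        have "mon (r \<otimes> x) 1 = mon r 0 \<otimes>\<^bsub>B\<^esub> mon x 1" using UP.monom_mult[of r x 0 1] r x I_carrier by simp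
        moreover have "mon r 0 \<in> A" using A(2) r by blast
        ultimately show ?thesis using subringE(6)[OF sub, of "mon r 0" "mon x 1"] x r ideal.I_l_closed[OF I] by simp
      qed
    qed
    then have "I \<subseteq> {a \<in> I. mon a 1 \<in> A}" using R.genideal_minimal[of "{a \<in> I. mon a 1 \<in> A}" F] F(3) FI A(3) by auto
    then show ?thesis using that by blast
  qed
  have mon: "mon a n \<in> A" if "a \<in> Ip n" for a n
    using that
  proof (induction n arbitrary: a)
    case 0 then show ?case using A(2) by (auto simp: Ip_0)
  next
    case (Suc n)
    show ?case
      by (rule mon_Suc_in[OF _ _ Suc.prems]) (use Suc.IH one subringE(6,7)[OF sub] in blast)+
  qed
  have "x \<in> A" if x: "x \<in> carrier B" for x
    by (rule graded.cmp_span[OF x]) (use mon x subringE(2,7)[OF sub] in \<open>auto simp: rees_carrier\<close>)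
  then have "A = carrier B" using subringE(1)[OF sub] by blast
  then show "graded.noetherian_subring (carrier B)" using A(1) by simp
qed

end

section \<open>Weak and strict transforms on a blowup\<close>

lemma (in cring) openin_spec_iff:
  "openin (zariski_spec R) U \<longleftrightarrow> (\<exists>E\<subseteq>carrier R. U = {P. primeideal P R \<and> \<not> E \<subseteq> P})"
proof -
  have "istopology (\<lambda>U. \<exists>E\<subseteq>carrier R. U = {P \<in> {P. primeideal P R}. \<not> E \<subseteq> P})"
    by (rule istopology_zariski) auto
  then show ?thesis unfolding zariski_spec_def by (simp add: topology_inverse')
qed

lemma (in primeideal) one_notin: "\<one> \<notin> I"
  using one_imp_carrier I_notcarr by blast

lemma (in cring) mult_set_prime:
  assumes "primeideal P R"
  shows "mult_set R (carrier R - P)"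
proof unfold_locales
  interpret P: primeideal P R by fact
  show "\<one> \<in> carrier R - P" using P.one_notin by simp
  show "u \<otimes> v \<in> carrier R - P" if "u \<in> carrier R - P" "v \<in> carrier R - P" for u v
    using that P.I_prime by auto
qed auto

locale noetherian_blowup = rees_algebra +
  assumes noeth: "noetherian_ring R"
begin

sublocale standard: standard_graded_ring B G "\<lambda>n p. mon (co p n) n"
  by (intro standard_graded_ring.intro standard_graded_ring_axioms.intro graded.graded_ring_axioms
    rees_noetherian[OF noeth] degree_one)

abbreviation proj_pts where "proj_pts \<equiv> proj_points B G"

abbreviation contr where "contr Q \<equiv> {a \<in> carrier R. mon a 0 \<in> Q}"

lemma blowup_eq: "blowup R I = graded.proj.X"
  by (simp add: blowup_def Proj_def)

lemma mon0:
  assumes "x \<in> carrier R"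
  shows "mon x 0 \<in> G 0" "mon x 0 \<in> homog G" "mon x 0 \<in> carrier B"
proof -
  show "mon x 0 \<in> G 0" using mon_G[of x 0] assms by (simp add: Ip_0)
  then show "mon x 0 \<in> homog G" "mon x 0 \<in> carrier B" by (rule graded.homogI, rule graded.G_carrier)
qed

lemma mon0_pair: "a \<in> carrier R \<Longrightarrow> b \<in> carrier R \<Longrightarrow> (mon a 0, mon b 0) \<in> same_degree_pairs G"
  using mon0(1)[of a] mon0(1)[of b] unfolding same_degree_pairs_def by blast

lemma contr_prime: "Q \<in> proj_pts \<Longrightarrow> primeideal (contr Q) R"
  using base.ring.primeideal_vimage[OF R.is_cring] graded.proj_prime by blast

lemma pt_blowup_map: "pt (blowup_map R I) Q = contr Q"
  by (simp add: blowup_map_def Let_def)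

lemma preimage_eq: "preimage (blowup R I) (blowup_map R I) V = {Q \<in> proj_pts. contr Q \<in> V}"
  by (simp add: preimage_def blowup_eq pt_blowup_map)

lemma preimage_open:
  assumes "openin (zariski_spec R) V"
  shows "openin (zariski_proj B G) {Q \<in> proj_pts. contr Q \<in> V}"
proof -
  obtain E where E: "E \<subseteq> carrier R" "V = {P. primeideal P R \<and> \<not> E \<subseteq> P}"
    using assms unfolding openin_spec_iff by (elim exE conjE) (rule that)
  have "\<not> E \<subseteq> contr Q \<longleftrightarrow> \<not> (\<lambda>a. mon a 0) ` E \<subseteq> Q" for Q using E(1) by blast
  then have "{Q \<in> proj_pts. contr Q \<in> V} = {Q \<in> proj_pts. \<not> (\<lambda>a. mon a 0) ` E \<subseteq> Q}"
    using E(2) contr_prime by auto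
  moreover have "(\<lambda>a. mon a 0) ` E \<subseteq> homog G" using E(1) mon0(2) by (intro image_subsetI) (rule mon0(2), blast)
  ultimately show ?thesis unfolding graded.openin_proj_iff by (intro exI[of _ "(\<lambda>a. mon a 0) ` E"] conjI)
qed

text \<open>The pull-back of fractions does not depend on the representative, because \<open>R \<rightarrow> B\<close> maps
  the complement of \<open>contr Q\<close> into that of \<open>Q\<close>.\<close>

lemma pull_frac:
  assumes Q: "Q \<in> proj_pts" "contr Q \<in> V" and a: "a \<in> carrier R" and b: "b \<in> carrier R - contr Q"
    and t: "t (contr Q) = fract_cls R (carrier R - contr Q) a b"
  shows "pull (blowup_map R I) V t Q = graded.proj.frac Q (mon a 0) (mon b 0)"
proof -
  have M: "mult_set R (carrier R - contr Q)" by (rule R.mult_set_prime[OF contr_prime[OF Q(1)]])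
  have QT: "Q \<in> topspace (zariski_proj B G)" using Q(1) by simp
  note h = mon0(2,3)
  have n: "mon x 0 \<in> homog G - Q" if "x \<in> carrier R - contr Q" for x using that h(1)[of x] by simp
  have eq: "graded.proj.frac Q (mon a' 0) (mon b' 0) = graded.proj.frac Q (mon a 0) (mon b 0)"
    if m: "(a', b') \<in> t (contr Q)" for a' b'
  proof -
    have ab': "a' \<in> carrier R" "b' \<in> carrier R - contr Q"
      "fract_cls R (carrier R - contr Q) a' b' = fract_cls R (carrier R - contr Q) a b"
      using mult_set.frac_memD[OF M a b m[unfolded t]] by simp_all
    then obtain u where u: "u \<in> carrier R - contr Q" "u \<otimes> (a' \<otimes> b \<ominus> a \<otimes> b') = \<zero>"
      using mult_set.frac_eq_iff[OF M ab'(1,2) a b] by blast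
    have c: "a' \<in> carrier R" "b' \<in> carrier R" "u \<in> carrier R" "b \<in> carrier R" using ab' u b by auto
    have "mon u 0 \<otimes>\<^bsub>B\<^esub> (mon a' 0 \<otimes>\<^bsub>B\<^esub> mon b 0 \<ominus>\<^bsub>B\<^esub> mon a 0 \<otimes>\<^bsub>B\<^esub> mon b' 0)
      = mon (u \<otimes> (a' \<otimes> b \<ominus> a \<otimes> b')) 0"
      by (simp only: a_minus_def base.hom_mult base.hom_add base.hom_a_inv R.m_closed R.a_closed R.a_inv_closed c a)
    also have "\<dots> = \<zero>\<^bsub>B\<^esub>" using u(2) by simp
    finally show ?thesis
      using graded.proj.frac_eq_iff[OF QT mon0_pair n[OF ab'(2)] mon0_pair n[OF b]] n[OF u(1)] c a by blast
  qed
  have "(a, b) \<in> t (contr Q)" unfolding t by (rule mult_set.frac_self[OF M a b])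
  then have "(\<Union>(a', b')\<in>t (contr Q). graded.proj.frac Q (mon a' 0) (mon b' 0)) = graded.proj.frac Q (mon a 0) (mon b 0)"
    using eq by fast
  then show ?thesis using Q by (simp add: blowup_map_def Let_def blowup_eq)
qed

context
  fixes f s
  assumes f: "f \<in> Ip s"
begin

abbreviation H where "H \<equiv> PIdl\<^bsub>B\<^esub> (mon f s)"

lemma fc: "f \<in> carrier R" "mon f s \<in> carrier B"
  using f Ip_carrier mon_in_rees by auto

lemma H_iff: "x \<in> H \<longleftrightarrow> (\<exists>c\<in>carrier B. x = c \<otimes>\<^bsub>B\<^esub> mon f s)"
  by (auto simp: cgenideal_def)

lemma H_ideal: "ideal H B"
  using graded.cgenideal_ideal[OF fc(2)] .

lemma H_homogeneous: "homogeneous_ideal B G H"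
  unfolding graded.homogeneous_ideal_iff
proof (intro conjI H_ideal ballI allI)
  fix x n assume "x \<in> H"
  then obtain c where c: "c \<in> carrier B" "x = c \<otimes>\<^bsub>B\<^esub> mon f s" using H_iff by blast
  show "mon (co x n) n \<in> H"
  proof (cases "s \<le> n")
    case True
    then have "mon (co x n) n = mon (co c (n - s)) (n - s) \<otimes>\<^bsub>B\<^esub> mon f s"
      using graded.cmp_mult[OF c(1) mon_G[OF f], of n] c(2) by simp
    then show ?thesis using H_iff graded.cmp_closed[OF c(1)] by blast
  next
    case False
    then have "mon (co x n) n = \<zero>\<^bsub>B\<^esub>" using graded.cmp_mult[OF c(1) mon_G[OF f], of n] c(2) by simp
    then show ?thesis using additive_subgroup.zero_closed[OF ideal.axioms(1)[OF H_ideal]] by simp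
  qed
qed

lemma weak_transform_eq: "weak_transform R I f s = graded.proj.J H"
  by (simp add: weak_transform_def Proj_subscheme_def)

text \<open>At a point where \<open>h t\<close> does not vanish, \<open>f/1 = h\<^sup>s (f t\<^sup>s)/(h t)\<^sup>s\<close>, so the pull-back of \<open>f\<close>
  is a section of the ideal sheaf of the weak transform.\<close>

lemma pull_in_weak_transform:
  assumes V: "openin (zariski_spec R) V" and t: "t \<in> Spec_subscheme R (PIdl\<^bsub>R\<^esub> f) V"
    and W: "openin (zariski_proj B G) W" "W \<subseteq> {Q \<in> proj_pts. contr Q \<in> V}"
  shows "restrict (pull (blowup_map R I) V t) W \<in> graded.proj.J H W"
proof -
  let ?g = "pull (blowup_map R I) V t"
  let ?D = "{(a, b) \<in> carrier R \<times> carrier R. a \<in> PIdl\<^bsub>R\<^esub> f}"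
  have lf: "local_fract R (zariski_spec R) (\<lambda>P. carrier R - P) ?D V t"
    using t V by (simp add: Spec_subscheme_def fract_ideal_sheaf_def)
  have loc: "\<exists>N a b. openin (zariski_proj B G) N \<and> Q \<in> N \<and> a \<in> PIdl\<^bsub>R\<^esub> f \<and> a \<in> carrier R \<and> b \<in> carrier R \<and>
     (\<forall>Q'\<in>N \<inter> W. mon b 0 \<in> homog G - Q' \<and> ?g Q' = graded.proj.frac Q' (mon a 0) (mon b 0))" if Q: "Q \<in> W" for Q
  proof -
    have Q': "contr Q \<in> V" "Q \<in> proj_pts" using W Q by auto
    obtain N a b where N: "openin (zariski_spec R) N" "contr Q \<in> N" "(a, b) \<in> ?D"
       "\<forall>P\<in>N. b \<in> carrier R - P \<and> t P = fract_cls R (carrier R - P) a b"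
      using bspec[OF lf[unfolded local_fract_iff] Q'(1)] by (elim exE conjE) (rule that)
    let ?N = "{Q \<in> proj_pts. contr Q \<in> N}"
    have "mon b 0 \<in> homog G - Q' \<and> ?g Q' = graded.proj.frac Q' (mon a 0) (mon b 0)" if "Q' \<in> ?N \<inter> W" for Q'
    proof -
      have q: "Q' \<in> proj_pts" "contr Q' \<in> N" "contr Q' \<in> V" using that W by auto
      have "mon b 0 \<in> homog G" using N(3) mon0(2)[of b] by simp
      moreover have "b \<in> carrier R - contr Q'" "t (contr Q') = fract_cls R (carrier R - contr Q') a b"
        using N(4) q(2) by auto
      ultimately show ?thesis using pull_frac[OF q(1,3), of a b t] N(3) q(1) by simp
    qed
    then show ?thesis
      using preimage_open[OF N(1)] N(2,3) Q' by (intro exI[of _ ?N] exI[of _ a] exI[of _ b]) auto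
  qed
  note mc = mon0_pair
  have "restrict ?g W \<in> carrier (sec graded.proj.X W)"
  proof (rule graded.proj.secI[OF W(1)])
    fix Q assume "Q \<in> W"
    then obtain N a b where N: "openin (zariski_proj B G) N" "Q \<in> N" "a \<in> carrier R" "b \<in> carrier R"
     "\<forall>Q'\<in>N \<inter> W. mon b 0 \<in> homog G - Q' \<and> ?g Q' = graded.proj.frac Q' (mon a 0) (mon b 0)" using loc by metis
    then show "\<exists>N a b. openin (zariski_proj B G) N \<and> Q \<in> N \<and> (a, b) \<in> same_degree_pairs G \<and>
       (\<forall>q\<in>N \<inter> W. b \<in> homog G - q \<and> restrict ?g W q = graded.proj.frac q a b)"
      using mc[OF N(3,4)] by (intro exI[of _ N] exI[of _ "mon a 0"] exI[of _ "mon b 0"]) simp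
  qed simp
  moreover have "restrict ?g W Q \<in> graded.proj.numer Q H" if Q: "Q \<in> W" for Q
  proof -
    obtain N a b where N: "Q \<in> N" "a \<in> PIdl\<^bsub>R\<^esub> f" "a \<in> carrier R" "b \<in> carrier R"
     "\<forall>Q'\<in>N \<inter> W. mon b 0 \<in> homog G - Q' \<and> ?g Q' = graded.proj.frac Q' (mon a 0) (mon b 0)" using loc[OF Q] by metis
    then have g: "?g Q = graded.proj.frac Q (mon a 0) (mon b 0)" "mon b 0 \<in> homog G - Q" using Q by auto
    have QP: "Q \<in> proj_pts" using W Q by auto
    then obtain e where e: "e \<in> G 1" "e \<notin> Q" using degree_one by blast
    have ec: "e \<in> carrier B" using e graded.G_carrier by blast
    have es: "e [^]\<^bsub>B\<^esub> s \<in> G s" "e [^]\<^bsub>B\<^esub> s \<notin> Q"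
      using graded.pow_G[OF e(1), of s] graded.proj_pow_notin[OF QP ec e(2), of s] by auto
    then obtain d where d: "e [^]\<^bsub>B\<^esub> s = mon d s" "d \<in> Ip s" using G_E by blast
    obtain c where c: "c \<in> carrier R" "a = c \<otimes> f" using N(2) by (auto simp: cgenideal_def)
    have dc: "d \<in> carrier R" using d Ip_carrier by blast
    have "mon d s \<otimes>\<^bsub>B\<^esub> mon a 0 = mon (d \<otimes> a) s" using UP.monom_mult[OF dc N(3), of s 0] by simp
    also have "d \<otimes> a = (d \<otimes> c) \<otimes> f" using c dc fc by (simp add: m_assoc)
    also have "mon ((d \<otimes> c) \<otimes> f) s = mon (d \<otimes> c) 0 \<otimes>\<^bsub>B\<^esub> mon f s"
      using UP.monom_mult[of "d \<otimes> c" f 0 s] c dc fc by simp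
    also have "\<dots> \<in> H" using H_iff mon0(3)[of "d \<otimes> c"] c dc by blast
    finally have "e [^]\<^bsub>B\<^esub> s \<otimes>\<^bsub>B\<^esub> mon a 0 \<in> H" using d by simp
    moreover have "e [^]\<^bsub>B\<^esub> s \<in> homog G - Q" using es graded.homogI by blast
    ultimately have "graded.proj.frac Q (mon a 0) (mon b 0) \<in> graded.proj.numer Q H"
      using graded.proj.numer_frac_iff[OF _ mc[OF N(3,4)] g(2) H_ideal] QP by auto
    then show ?thesis using g Q by simp
  qed
  ultimately show ?thesis using graded.proj.J_iff[OF H_ideal W(1)] by blast
qed

text \<open>Where \<open>h t\<^sup>0\<close> is a unit, the identity can be solved for \<open>f t\<^sup>s\<close>: a section \<open>c f t\<^sup>s/b\<close> of the
  ideal sheaf of the weak transform is \<open>c (h t)\<^sup>s/(b h\<^sup>s)\<close> times the pull-back of \<open>f\<close>.\<close>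

lemma inverse_image_eq_weak_transform:
  assumes V: "openin (zariski_proj B G) V" and away: "\<And>Q. Q \<in> V \<Longrightarrow> \<exists>h\<in>I. mon h 0 \<notin> Q"
  shows "inverse_image_subscheme (blowup R I) (blowup_map R I) (Spec R) (Spec_subscheme R (PIdl\<^bsub>R\<^esub> f)) V = graded.proj.J H V"
proof -
  let ?E = "{(preimage (blowup R I) (blowup_map R I) V, pull (blowup_map R I) V t) |
     V t. openin (topo (Spec R)) V \<and> t \<in> Spec_subscheme R (PIdl\<^bsub>R\<^esub> f) V}"
  have topo: "topo (Spec R) = zariski_spec R" by (simp add: Spec_def fract_space_def)
  have E: "restrict g W \<in> graded.proj.J H W" if "(U, g) \<in> ?E" "openin (zariski_proj B G) W" "W \<subseteq> U" for U g W
    using that pull_in_weak_transform by (auto simp: preimage_eq topo)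
  have "graded.proj.J H V \<subseteq> gen_ideal_sheaf graded.proj.X ?E V"
  proof
    fix \<sigma> assume \<sigma>: "\<sigma> \<in> graded.proj.J H V"
    then have \<sigma>V: "\<sigma> \<in> carrier (sec graded.proj.X V)" using graded.proj.J_iff[OF H_ideal V] by blast
    have lf: "local_fract B (zariski_proj B G) (\<lambda>P. homog G - P) {(a, b) \<in> same_degree_pairs G. a \<in> H} V \<sigma>"
      using \<sigma> V by (simp add: fract_ideal_sheaf_def)
    let ?U = "{P. primeideal P R}"
    let ?t = "\<lambda>P\<in>?U. fract_cls R (carrier R - P) f \<one>"
    have one: "\<one> \<in> carrier R - P" if "primeideal P R" for P using primeideal.one_notin[OF that] by simp
    have U: "openin (zariski_spec R) ?U"
      unfolding openin_spec_iff using one by (intro exI[of _ "{\<one>}"]) auto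
    have t: "?t \<in> Spec_subscheme R (PIdl\<^bsub>R\<^esub> f) ?U"
    proof -
      have ff: "f \<in> PIdl\<^bsub>R\<^esub> f" using R.cgenideal_self[OF fc(1)] .
      have v: "?t P \<in> carrier (localization R (carrier R - P))" if "P \<in> ?U" for P
        using that one[of P] fc(1) by (auto simp: localization_def)
      have "local_fract R (zariski_spec R) (\<lambda>P. carrier R - P) D ?U ?t" if "(f, \<one>) \<in> D" for D
        unfolding local_fract_iff using that U one
        by (intro ballI exI[of _ ?U] exI[of _ f] exI[of _ \<one>]) auto
      then have "local_fract R (zariski_spec R) (\<lambda>P. carrier R - P) (carrier R \<times> carrier R) ?U ?t"
        "local_fract R (zariski_spec R) (\<lambda>P. carrier R - P) {(a, b) \<in> carrier R \<times> carrier R. a \<in> PIdl\<^bsub>R\<^esub> f} ?U ?t"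
        using fc(1) ff by auto
      then show ?thesis using U v by (auto simp: Spec_subscheme_def fract_ideal_sheaf_def fract_space_def)
    qed
    let ?g = "pull (blowup_map R I) ?U ?t"
    have pre: "preimage (blowup R I) (blowup_map R I) ?U = proj_pts" using contr_prime by (auto simp: preimage_eq)
    have "openin (topo (Spec R)) ?U" unfolding topo by (rule U)
    then have "(preimage (blowup R I) (blowup_map R I) ?U, ?g) \<in> ?E"
      unfolding mem_Collect_eq by (intro exI[of _ ?U] exI[of _ ?t] conjI refl t)
    then have gE: "(proj_pts, ?g) \<in> ?E" unfolding pre .
    have gQ: "?g Q = graded.proj.frac Q (mon f 0) (mon \<one> 0)" if Q: "Q \<in> proj_pts" for Q
    proof -
      have cU: "contr Q \<in> ?U" using contr_prime[OF Q] by (rule CollectI)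
      show ?thesis by (rule pull_frac[OF Q cU fc(1) one[OF contr_prime[OF Q]]]) (rule restrict_apply'[OF cU])
    qed
    show "\<sigma> \<in> gen_ideal_sheaf graded.proj.X ?E V"
    proof (rule graded.proj.gen_ideal_sheafI[OF V \<sigma>V])
      show "restrict g W \<in> carrier (sec graded.proj.X W)"
        if "(U, g) \<in> ?E" "openin (zariski_proj B G) W" "W \<subseteq> U" for U g W
        using E[OF that] graded.proj.J_iff[OF H_ideal that(2)] by blast
      fix p assume p: "p \<in> V"
      obtain W a b where W: "openin (zariski_proj B G) W" "p \<in> W" "W \<subseteq> V" "(a, b) \<in> same_degree_pairs G" "a \<in> H"
        "\<forall>q\<in>W. b \<in> homog G - q \<and> \<sigma> q = graded.proj.frac q a b"
        using bspec[OF lf[unfolded graded.proj.local_fract_numer_iff] p] by (elim exE conjE) (rule that)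
      obtain h where h: "h \<in> I" "mon h 0 \<notin> p" using away[OF p] by blast
      define h0 where "h0 = mon (h [^] s) 0"
      define ht where "ht = mon (h [^] s) s"
      have hc: "h [^] s \<in> carrier R" "h [^] s \<in> Ip s" using h I_carrier Ip_pow by auto
      have h0: "h0 \<in> G 0" "h0 \<in> carrier B" and ht: "ht \<in> G s" "ht \<in> carrier B"
        using mon0(1,3)[OF hc(1)] mon_G[OF hc(2)] mon_in_rees[OF hc(2)] by (simp_all add: h0_def ht_def)
      have h0p: "h0 = mon h 0 [^]\<^bsub>B\<^esub> s" unfolding h0_def using base.ring.hom_nat_pow h I_carrier by blast
      have pP: "p \<in> proj_pts" using graded.proj.open_point[OF V p] by simp
      have "h0 \<notin> p" unfolding h0p
        by (rule graded.proj_pow_notin[OF pP mon0(3)[OF I_carrier[OF h(1)]] h(2)])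
      obtain n where ab: "a \<in> G n" "b \<in> G n" using W(4) by (auto simp: same_degree_pairs_def)
      have abc: "a \<in> carrier B" "b \<in> carrier B" using ab graded.G_carrier by auto
      obtain c where c: "c \<in> carrier B" "a = c \<otimes>\<^bsub>B\<^esub> mon f s" "c \<otimes>\<^bsub>B\<^esub> ht \<in> G n"
      proof -
        obtain c where c: "c \<in> carrier B" "a = c \<otimes>\<^bsub>B\<^esub> mon f s" using W(5) H_iff by blast
        have a': "a = (if s \<le> n then mon (co c (n - s)) (n - s) \<otimes>\<^bsub>B\<^esub> mon f s else \<zero>\<^bsub>B\<^esub>)"
          using graded.cmp_mult[OF c(1) mon_G[OF f], of n] c(2) graded.cmp_same[OF ab(1)] by simp
        \<comment> \<open>Replace \<open>c\<close> by its component of degree \<open>n - s\<close>; for \<open>n < s\<close> both this and \<open>a\<close> are zero.\<close>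
        show thesis
        proof (cases "s \<le> n")
          case True
          show thesis
            by (rule that[of "mon (co c (n - s)) (n - s)"])
              (use True a' graded.cmp_closed[OF c(1)] graded.mult_G[OF graded.cmp_in[OF c(1), of "n - s"] ht(1)] in auto)
        next
          case False
          show thesis
            by (rule that[of "\<zero>\<^bsub>B\<^esub>"]) (use False a' fc ht graded.zero_G in \<open>auto simp del: rees_ops\<close>)
        qed
      qed
      define N where "N = W \<inter> {q \<in> proj_pts. h0 \<notin> q}"
      have N: "openin (zariski_proj B G) N" "p \<in> N" "N \<subseteq> V"
        using W graded.openin_proj_basic[OF graded.homogI[OF h0(1)]] \<open>h0 \<notin> p\<close> pP by (auto simp: N_def)
      have bh: "b \<otimes>\<^bsub>B\<^esub> h0 \<in> G n" using graded.mult_G[OF ab(2) h0(1)] by simp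
      have Dn: "(c \<otimes>\<^bsub>B\<^esub> ht, b \<otimes>\<^bsub>B\<^esub> h0) \<in> same_degree_pairs G" using c(3) bh by (auto simp: same_degree_pairs_def)
      have Dn': "b \<otimes>\<^bsub>B\<^esub> h0 \<in> homog G - q" "h0 \<in> homog G - q" "b \<in> homog G - q" "q \<in> topspace (zariski_proj B G)" if "q \<in> N" for q
        using that W(6) graded.homogI[OF h0(1)] graded.proj.S_times[of q b h0] by (auto simp: N_def)
      let ?e = "\<lambda>q\<in>N. graded.proj.frac q (c \<otimes>\<^bsub>B\<^esub> ht) (b \<otimes>\<^bsub>B\<^esub> h0)"
      have e: "?e \<in> carrier (sec graded.proj.X N)" using graded.proj.frac_sec[OF Dn N(1) Dn'(1)] .
      have "\<sigma> q = ?e q \<otimes>\<^bsub>graded.proj.Loc q\<^esub> ?g q" if q: "q \<in> N" for q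
      proof -
        have qP: "q \<in> proj_pts" using q by (simp add: N_def)
        have f1: "(mon f 0, mon \<one> 0) \<in> same_degree_pairs G" by (rule mon0_pair[OF fc(1) R.one_closed])
        have 1: "mon \<one> 0 \<in> homog G - q" using graded.proj.S_1[OF Dn'(4)[OF q]] by simp
        have fm: "mon f 0 \<in> carrier B" by (rule mon0(3)[OF fc(1)])
        have "ht \<otimes>\<^bsub>B\<^esub> mon f 0 = h0 \<otimes>\<^bsub>B\<^esub> mon f s"
          using UP.monom_mult[OF hc(1) fc(1), of s 0] UP.monom_mult[OF hc(1) fc(1), of 0 s] by (simp add: ht_def h0_def)
        then have "c \<otimes>\<^bsub>B\<^esub> ht \<otimes>\<^bsub>B\<^esub> mon f 0 = h0 \<otimes>\<^bsub>B\<^esub> a"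
          using c(1) ht(2) fm h0(2) fc(2) graded.m_assoc graded.m_lcomm c(2) by (simp del: rees_ops)
        moreover have "b \<otimes>\<^bsub>B\<^esub> h0 \<otimes>\<^bsub>B\<^esub> mon \<one> 0 = h0 \<otimes>\<^bsub>B\<^esub> b"
          using abc h0 graded.m_comm[of b h0] base.hom_one graded.r_one[of "b \<otimes>\<^bsub>B\<^esub> h0"] graded.m_closed by (simp del: rees_ops)
        ultimately have "graded.proj.frac q (c \<otimes>\<^bsub>B\<^esub> ht) (b \<otimes>\<^bsub>B\<^esub> h0) \<otimes>\<^bsub>graded.proj.Loc q\<^esub> graded.proj.frac q (mon f 0) (mon \<one> 0)
            = graded.proj.frac q (h0 \<otimes>\<^bsub>B\<^esub> a) (h0 \<otimes>\<^bsub>B\<^esub> b)"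
          using graded.proj.Loc_mult[OF Dn'(4)[OF q] Dn Dn'(1)[OF q] f1 1] by (simp del: rees_ops)
        also have "\<dots> = graded.proj.frac q a b" using graded.proj.frac_cancel[OF Dn'(4)[OF q] W(4) Dn'(3,2)[OF q]] .
        finally show ?thesis using gQ[OF qP] W(6) q by (simp add: N_def)
      qed
      then show "\<exists>W Va g e. openin (zariski_proj B G) W \<and> p \<in> W \<and> W \<subseteq> V \<inter> Va \<and> (Va, g) \<in> ?E \<and>
          e \<in> carrier (sec graded.proj.X W) \<and> (\<forall>q\<in>W. \<sigma> q = e q \<otimes>\<^bsub>graded.proj.Loc q\<^esub> g q)"
        using N gE e by (intro exI[of _ N] exI[of _ proj_pts] exI[of _ ?g] exI[of _ ?e]) (auto simp: N_def)
    qed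
  qed
  moreover have "gen_ideal_sheaf graded.proj.X ?E V \<subseteq> graded.proj.J H V"
    by (rule graded.proj.gen_ideal_sheaf_subset[OF H_ideal E])
  ultimately show ?thesis unfolding inverse_image_subscheme_def blowup_eq by blast
qed

text \<open>The exceptional divisor is cut out by the finite set \<open>E\<close> of generators of \<open>I\<close> in degree zero,
  so the results on Proj apply.\<close>

lemma weak_eq_strict_iff:
  "weak_transform R I f s = strict_transform R I (Spec_subscheme R (PIdl\<^bsub>R\<^esub> f)) \<longleftrightarrow>
    subscheme_supp (blowup R I) (exceptional_divisor R I) \<inter>
      assoc_points (blowup R I) (weak_transform R I f s) = {}"
proof -
  obtain F where F: "F \<subseteq> carrier R" "finite F" "I = Idl\<^bsub>R\<^esub> F"
    using noetherian_ring.finetely_gen[OF noeth I] by blast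
  have FI: "F \<subseteq> I" using R.genideal_self[OF F(1)] F(3) by simp
  define E where "E = (\<lambda>a. mon a 0) ` F"
  have Efin: "finite E" using F(2) by (simp add: E_def)
  have Ehom: "E \<subseteq> homog G" unfolding E_def by (intro image_subsetI mon0(2)) (use F(1) in blast)
  have E_iff: "E \<subseteq> Q \<longleftrightarrow> (\<forall>a\<in>I. mon a 0 \<in> Q)" if Q: "Q \<in> proj_pts" for Q
  proof
    assume "E \<subseteq> Q"
    then have "F \<subseteq> contr Q" using F(1) unfolding E_def by blast
    then have "I \<subseteq> contr Q"
      unfolding F(3) by (rule R.genideal_minimal[OF primeideal.axioms(1)[OF contr_prime[OF Q]]])
    then show "\<forall>a\<in>I. mon a 0 \<in> Q" by blast
  next
    assume "\<forall>a\<in>I. mon a 0 \<in> Q"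
    then show "E \<subseteq> Q" using FI unfolding E_def by blast
  qed
  define W0 where "W0 = {Q \<in> proj_pts. \<not> E \<subseteq> Q}"
  have pre: "preimage (blowup R I) (blowup_map R I) {P. primeideal P R \<and> \<not> I \<subseteq> P} = W0"
    unfolding preimage_eq W0_def using contr_prime E_iff I_carrier by auto
  have strict: "strict_transform R I (Spec_subscheme R (PIdl\<^bsub>R\<^esub> f)) = graded.proj.J (graded.saturation H E)"
    unfolding strict_transform_def pre unfolding blowup_eq
  proof (rule standard.scheme_closure_eq[OF H_homogeneous Efin Ehom W0_def])
    fix V assume V: "openin (zariski_proj B G) V" "V \<subseteq> W0"
    have "\<exists>h\<in>I. mon h 0 \<notin> Q" if "Q \<in> V" for Q
      using that V(2) E_iff[of Q] by (auto simp: W0_def)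
    then show "inverse_image_subscheme graded.proj.X (blowup_map R I) (Spec R) (Spec_subscheme R (PIdl\<^bsub>R\<^esub> f)) V = graded.proj.J H V"
      using inverse_image_eq_weak_transform[OF V(1)] unfolding blowup_eq by blast
  qed
  let ?I0 = "{mon a 0 | a. a \<in> I}"
  have I0: "?I0 \<subseteq> carrier B" using mon0(3)[OF I_carrier] by blast
  have supp: "subscheme_supp (blowup R I) (exceptional_divisor R I) = {Q \<in> proj_pts. E \<subseteq> Q}"
  proof -
    have ex: "exceptional_divisor R I = graded.proj.J (Idl\<^bsub>B\<^esub> ?I0)"
      by (simp add: exceptional_divisor_def Proj_subscheme_def)
    have "Idl\<^bsub>B\<^esub> ?I0 \<inter> (homog G - Q) = {} \<longleftrightarrow> E \<subseteq> Q" if Q: "Q \<in> proj_pts" for Q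
    proof
      assume e: "Idl\<^bsub>B\<^esub> ?I0 \<inter> (homog G - Q) = {}"
      have "E \<subseteq> Idl\<^bsub>B\<^esub> ?I0" using graded.genideal_self[OF I0] FI by (auto simp: E_def)
      then show "E \<subseteq> Q" using e Ehom by blast
    next
      assume "E \<subseteq> Q"
      then have "?I0 \<subseteq> Q" using E_iff[OF Q] by blast
      then have "Idl\<^bsub>B\<^esub> ?I0 \<subseteq> Q"
        using graded.genideal_minimal[OF primeideal.axioms(1)[OF graded.proj_prime[OF Q]]] by blast
      then show "Idl\<^bsub>B\<^esub> ?I0 \<inter> (homog G - Q) = {}" by blast
    qed
    then show ?thesis
      unfolding ex blowup_eq using graded.proj.subscheme_supp_iff[OF graded.genideal_ideal[OF I0]] by auto
  qed
  have disj: "(\<forall>p\<in>A. \<not> E \<subseteq> p) \<longleftrightarrow> {Q \<in> proj_pts. E \<subseteq> Q} \<inter> A = {}" if "A \<subseteq> proj_pts" for A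
    using that by blast
  have "assoc_points graded.proj.X (graded.proj.J H) \<subseteq> proj_pts"
    using graded.proj.assoc_points_iff[OF H_ideal] by auto
  from disj[OF this] show ?thesis
    unfolding weak_transform_eq strict supp unfolding blowup_eq
    by (rule trans[OF standard.saturated_iff_no_associated_point[OF H_homogeneous Efin Ehom]])
qed

end

end

theorem lemma3p2:
  fixes R :: "('a, 'm) ring_scheme" and I :: "'a set" and f :: 'a and s :: nat
  assumes "cring R" and "noetherian_ring R" and "ideal I R"
    and "f \<in> ideal_power R I s - ideal_power R I (Suc s)"
  shows "weak_transform R I f s = strict_transform R I (Spec_subscheme R (PIdl\<^bsub>R\<^esub> f)) \<longleftrightarrow>
    subscheme_supp (blowup R I) (exceptional_divisor R I) \<inter>
      assoc_points (blowup R I) (weak_transform R I f s) = {}"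
proof -
  interpret noetherian_blowup R I
    using assms by (intro noetherian_blowup.intro rees_algebra.intro rees_algebra_axioms.intro noetherian_blowup_axioms.intro)
  show ?thesis using weak_eq_strict_iff[of f s] assms(4) by (simp add: Ip_def)
qed

end
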